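(* Let $f(z)=\sum_{k=0}^\infty a_kz^{n_k}$ be analytic in $\mathbb D$, where $n_{k+1}\ge\lambda n_k$ for all $k$ and some $\lambda>1$, and suppose $\sum_{k=1}^\infty|a_k|^2(\log n_k)^3<\infty$. Then (i) $f\in\mathcal M(BMOA)$; (ii) $f\in\mathcal M(\mathcal D^p_{p-1}\cap BMOA,\ \mathcal D^q_{q-1}\cap BMOA)$ whenever $0<p\le q$ and $q>\frac12$. Furthermore, for each $0<q<\frac12$ there is such a lacunary $f$ (with coefficients satisfying $\sum_k|a_k|^2(\log n_k)^3<\infty$) with $f\notin\mathcal D^q_{q-1}$; for it: (a) $f\in\mathcal M(BMOA)$; (b) $f\in\mathcal M(\mathcal D^p_{p-1}\cap BMOA,\ \mathcal D^\mu_{\mu-1})$ whenever $\mu>\frac12$ and $0<p\le\mu$; (c) $f\notin\mathcal M(\mathcal D^p_{p-1}\cap BMOA,\ \mathcal D^q_{q-1}\cap BMOA)$ whenever $0<p\le q$.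
   Context: $\mathbb D$ is the open unit disc, $dA=\frac1\pi dx\,dy$. For $0<p<\infty$, $\mathcal D^p_{p-1}$ is the space of analytic $f$ with $\int_{\mathbb D}(1-|z|)^{p-1}|f'(z)|^p\,dA(z)<\infty$. $BMOA$ is the space of $f\in H^1$ whose boundary values have bounded mean oscillation. $\mathcal M(X,Y)=\{g\text{ analytic in }\mathbb D: fg\in Y\ \forall f\in X\}$, $\mathcal M(X)=\mathcal M(X,X)$. *)

theory Defs
  imports "HOL-Analysis.Analysis"
begin

definition dirichlet_type :: "real \<Rightarrow> (complex \<Rightarrow> complex) set" where
  "dirichlet_type p = {f. f holomorphic_on ball 0 1 \<and>
     (\<integral>\<^sup>+ z. indicator (ball (0::complex) 1) z *
        ennreal ((1 - norm z) powr (p - 1) * norm (deriv f z) powr p / pi) \<partial>lborel) < \<infinity>}"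

definition hardy1 :: "(complex \<Rightarrow> complex) set" where
  "hardy1 = {f. f holomorphic_on ball 0 1 \<and>
     (\<exists>C::real. \<forall>r. 0 \<le> r \<and> r < 1 \<longrightarrow>
        (\<integral>\<^sup>+ t. indicator {0..2*pi} t * ennreal (norm (f (complex_of_real r * cis t))) \<partial>lborel)
          \<le> ennreal C)}"

definition boundary_fn :: "(complex \<Rightarrow> complex) \<Rightarrow> real \<Rightarrow> complex" where
  "boundary_fn f t = Lim (at_left 1) (\<lambda>r::real. f (complex_of_real r * cis t))"

text \<open>Bounded mean oscillation on the circle (arcs = parameter intervals of length at most 2 pi).\<close>
definition bmo_circle :: "(real \<Rightarrow> complex) \<Rightarrow> bool" where
  "bmo_circle g \<longleftrightarrow> (\<exists>C::real. \<forall>a b. a < b \<and> b - a \<le> 2*pi \<longrightarrow>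
      set_integrable lborel {a..b} g \<and>
      (\<integral>\<^sup>+ t. indicator {a..b} t *
         ennreal (norm (g t - (LINT s:{a..b}|lborel. g s) / complex_of_real (b - a))) \<partial>lborel)
        \<le> ennreal (C * (b - a)))"

definition BMOA :: "(complex \<Rightarrow> complex) set" where
  "BMOA = {f \<in> hardy1. bmo_circle (boundary_fn f)}"

definition multipliers :: "(complex \<Rightarrow> complex) set \<Rightarrow> (complex \<Rightarrow> complex) set \<Rightarrow> (complex \<Rightarrow> complex) set" where
  "multipliers X Y = {g. g holomorphic_on ball 0 1 \<and> (\<forall>f\<in>X. (\<lambda>z. f z * g z) \<in> Y)}"

definition lacunary_repr :: "(complex \<Rightarrow> complex) \<Rightarrow> (nat \<Rightarrow> complex) \<Rightarrow> (nat \<Rightarrow> nat) \<Rightarrow> real \<Rightarrow> bool" where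
  "lacunary_repr f a n lam \<longleftrightarrow> lam > 1 \<and> (\<forall>k. real (n (Suc k)) \<ge> lam * real (n k)) \<and>
     f holomorphic_on ball 0 1 \<and>
     (\<forall>z\<in>ball 0 1. (\<lambda>k. a k * z ^ n k) sums f z) \<and>
     summable (\<lambda>k. norm (a (Suc k)) ^ 2 * (ln (real (n (Suc k)))) ^ 3)"

end

theory Submission
  imports Defs "HOL-Complex_Analysis.Complex_Analysis"
begin

text \<open>
  Write \<open>f = \<Sum> a\<^sub>k z\<^bsup>n\<^sub>k\<^esup>\<close> with weights \<open>l\<^sub>k = ln n\<^sub>k\<close>, which grow at least linearly in \<open>k\<close>.
  By Cauchy--Schwarz, \<open>\<Sum> |a\<^sub>k|\<^sup>2 l\<^sub>k\<^sup>3 < \<infinity>\<close> makes the tails of \<open>\<Sum> |a\<^sub>k|\<close> at most \<open>C / l\<^sub>k\<close>, so the boundary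
  function \<open>F\<close> of \<open>f\<close> is bounded with modulus of continuity \<open>O(1 / log (1 / h))\<close>.  The mean of a BMO function over
  an arc of length \<open>h\<close> is \<open>O(log (1 / h))\<close>, hence multiplication by \<open>F\<close> preserves BMO.  That the boundary function of \<open>h f\<close>
  is the product of the boundary functions needs radial limits of \<open>h\<close> almost everywhere: \<open>h\<close> is a product of two
  functions in \<open>H\<^sup>2\<close>, so its dilates are Cauchy in \<open>L\<^sup>1\<close>, and the weak type estimate for the radial maximal
  function gives convergence.

  For the Dirichlet-type spaces, \<open>(h f)' = h' f + h f'\<close>.  BMOA functions are Bloch, which settles \<open>h' f\<close> and reduces
  \<open>h f'\<close> to exponents \<open>1/2 < q \<le> 1\<close>.  There \<open>|f'|\<^sup>q\<close> is bounded term by term and rotation averaging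
  leaves \<open>\<Sum> |a\<^sub>k|\<^sup>q\<close>, which converges exactly because \<open>q > 1/2\<close>.  For \<open>q < 1/2\<close> take
  \<open>n\<^sub>k = N\<^sup>k\<close> and \<open>a\<^sub>k = (k + 1)\<^bsup>-1/q\<^esup>\<close>: on the annulus \<open>1/(2 n\<^sub>k) \<le> 1 - |z| \<le> 1/n\<^sub>k\<close> the \<open>k\<close>-th
  term dominates \<open>f'\<close>, and the area integral is at least a multiple of the harmonic series.
\<close>

subsection \<open>Arcs and the Cauchy formula on the circle\<close>

text \<open>The exponent 3 is matched twice. Weighted Cauchy--Schwarz leaves tail sums of l^-3,
  which are O(l^-2) because consecutive logarithms differ by at least ln lam; the square root gives
  decay 1/l, exactly the reciprocal of the logarithmic growth of BMO means. In the sum of |a_k|^q, a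
  term exceeding |a_k|^2 l_k^3 is at most l_k^(-3q/(2-q)), and 3q/(2-q) > 1 precisely when q > 1/2.
  In the example |a_k|^2 l_k^3 is of order k^(3-2/q), summable precisely when q < 1/2.

  \<open>BMOA\<close> is defined through radial limits, and a product has the expected radial limit
  only where both factors have one. This forces the almost everywhere existence of radial limits in
  H1; the same limits turn the interior Cauchy formula into a bound of h' by the oscillation of the
  boundary function, which is the Bloch estimate.

  The reduction for q > 1 rests on h f' = (h f)' - h' f: since h f has already been shown to be in
  BMOA, both h f and h are Bloch while f is bounded, so (1 - |z|) |h f'| is bounded and q - 1 of the
  q powers can be discarded.\<close>

definition arc_meas :: "real \<Rightarrow> real \<Rightarrow> real measure" where
  "arc_meas a b = density lborel (indicator {a..b})"

lemma sets_arc_meas [simp, measurable_cong]: "sets (arc_meas a b) = sets borel"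
  by (simp add: arc_meas_def)

lemma space_arc_meas [simp]: "space (arc_meas a b) = UNIV"
  by (simp add: arc_meas_def)

lemma nn_integral_arc_meas:
  assumes [measurable]: "f \<in> borel_measurable borel"
  shows "(\<integral>\<^sup>+t. f t \<partial>arc_meas a b) = (\<integral>\<^sup>+t. indicator {a..b} t * f t \<partial>lborel)"
  unfolding arc_meas_def by (subst nn_integral_density) auto

lemma emeasure_arc_meas: "a \<le> b \<Longrightarrow> emeasure (arc_meas a b) UNIV = ennreal (b - a)"
  unfolding arc_meas_def by (subst emeasure_density) auto

lemma finite_measure_arc_meas [simp]: "finite_measure (arc_meas a b)"
proof (rule finite_measureI)
  have "emeasure (arc_meas a b) UNIV = emeasure lborel {a..b}"
    unfolding arc_meas_def by (subst emeasure_density) auto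
  then show "emeasure (arc_meas a b) (space (arc_meas a b)) \<noteq> \<infinity>"
    by (simp add: emeasure_lborel_Icc_eq)
qed

lemma integrable_arc_meas:
  fixes g :: "real \<Rightarrow> complex"
  assumes [measurable]: "g \<in> borel_measurable borel"
  shows "integrable (arc_meas a b) g \<longleftrightarrow> set_integrable lborel {a..b} g"
proof -
  have "integrable (density lborel (\<lambda>x. ennreal (indicator {a..b} x))) g \<longleftrightarrow>
      integrable lborel (\<lambda>x. indicator {a..b} x *\<^sub>R g x)"
    by (rule integrable_density) auto
  then show ?thesis unfolding arc_meas_def set_integrable_def
    by (simp add: ennreal_indicator)
qed

lemma integral_arc_meas:
  fixes g :: "real \<Rightarrow> complex"
  assumes [measurable]: "g \<in> borel_measurable borel"
  shows "(\<integral>t. g t \<partial>arc_meas a b) = (LINT t:{a..b}|lborel. g t)"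
proof -
  have "(\<integral>t. g t \<partial>density lborel (\<lambda>x. ennreal (indicator {a..b} x))) =
      (\<integral>x. indicator {a..b} x *\<^sub>R g x \<partial>lborel)"
    by (rule integral_density) auto
  then show ?thesis unfolding arc_meas_def set_lebesgue_integral_def
    by (simp add: ennreal_indicator)
qed

lemma nn_integral_arc_meas_split:
  assumes [measurable]: "f \<in> borel_measurable borel" and "a \<le> b" "b \<le> c"
  shows "(\<integral>\<^sup>+t. f t \<partial>arc_meas a c) = (\<integral>\<^sup>+t. f t \<partial>arc_meas a b) + (\<integral>\<^sup>+t. f t \<partial>arc_meas b c)"
proof -
  have "AE t in lborel. t \<noteq> b" by (rule AE_lborel_singleton)
  then have "AE t in lborel. indicator {a..c} t * f t = indicator {a..b} t * f t + indicator {b..c} t * f t"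
    by eventually_elim (use assms in \<open>auto simp: indicator_def\<close>)
  then have "(\<integral>\<^sup>+t. indicator {a..c} t * f t \<partial>lborel)
    = (\<integral>\<^sup>+t. indicator {a..b} t * f t + indicator {b..c} t * f t \<partial>lborel)"
    by (rule nn_integral_cong_AE)
  also have "\<dots> = (\<integral>\<^sup>+t. indicator {a..b} t * f t \<partial>lborel) + (\<integral>\<^sup>+t. indicator {b..c} t * f t \<partial>lborel)"
    by (rule nn_integral_add) auto
  finally show ?thesis by (simp add: nn_integral_arc_meas)
qed

lemma nn_integral_arc_meas_mono_set:
  assumes [measurable]: "f \<in> borel_measurable borel" and "a' \<le> a" "b \<le> b'"
  shows "(\<integral>\<^sup>+t. f t \<partial>arc_meas a b) \<le> (\<integral>\<^sup>+t. f t \<partial>arc_meas a' b')"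
  using assms(2,3) by (auto simp: nn_integral_arc_meas indicator_def intro!: nn_integral_mono)

lemma nn_integral_arc_meas_shift:
  assumes [measurable]: "f \<in> borel_measurable borel"
  shows "(\<integral>\<^sup>+t. f (t + c) \<partial>arc_meas a b) = (\<integral>\<^sup>+t. f t \<partial>arc_meas (a + c) (b + c))"
proof -
  have "(\<integral>\<^sup>+t. indicator {a+c..b+c} t * f t \<partial>lborel)
     = (\<integral>\<^sup>+t. indicator {a+c..b+c} (c + t) * f (c + t) \<partial>lborel)"
    by (subst lborel_distr_plus[of c, symmetric], subst nn_integral_distr) auto
  also have "\<dots> = (\<integral>\<^sup>+t. indicator {a..b} t * f (t + c) \<partial>lborel)"
    by (intro nn_integral_cong) (auto simp: indicator_def add.commute)
  finally show ?thesis by (simp add: nn_integral_arc_meas)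
qed

lemma periodic_int:
  fixes f :: "real \<Rightarrow> 'a"
  assumes per: "\<And>t. f (t + 2*pi) = f t"
  shows "f (t + 2*pi * of_int k) = f t"
proof -
  have n: "f (t + 2*pi * real n) = f t" for n t
  proof (induction n)
    case (Suc n)
    have "f (t + 2*pi * real (Suc n)) = f ((t + 2*pi * real n) + 2*pi)"
      by (simp add: algebra_simps)
    then show ?case using Suc per by simp
  qed simp
  show ?thesis
  proof (cases "k \<ge> 0")
    case True
    then show ?thesis using n[of t "nat k"] by simp
  next
    case False
    then show ?thesis using n[of "t + 2*pi * of_int k" "nat (-k)"] by (simp add: algebra_simps)
  qed
qed

text \<open>The window contains the multiple p + 2 pi of the period; it is cut there, and the piece
  beyond the cut is moved back by one period to complete [p, p + 2 pi].\<close>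

lemma nn_integral_arc_meas_periodic:
  assumes [measurable]: "f \<in> borel_measurable borel" and per: "\<And>t. f (t + 2*pi) = f t"
  shows "(\<integral>\<^sup>+t. f t \<partial>arc_meas a (a + 2*pi)) = (\<integral>\<^sup>+t. f t \<partial>arc_meas 0 (2*pi))"
proof -
  define k where "k = \<lfloor>a / (2*pi)\<rfloor>"
  define p where "p = 2*pi * of_int k"
  have "of_int k \<le> a / (2*pi)" "a / (2*pi) \<le> of_int k + 1"
    unfolding k_def by linarith+
  then have k: "p \<le> a" "a \<le> p + 2*pi"
    by (auto simp: field_simps p_def)
  have shift: "(\<integral>\<^sup>+t. f t \<partial>arc_meas (x + 2*pi) (y + 2*pi)) = (\<integral>\<^sup>+t. f t \<partial>arc_meas x y)" for x y
    using nn_integral_arc_meas_shift[of f x y "2*pi"] by (simp add: per)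
  have "(\<integral>\<^sup>+t. f t \<partial>arc_meas a (a + 2*pi)) =
      (\<integral>\<^sup>+t. f t \<partial>arc_meas a (p + 2*pi)) + (\<integral>\<^sup>+t. f t \<partial>arc_meas (p + 2*pi) (a + 2*pi))"
    using k by (intro nn_integral_arc_meas_split) auto
  also have "\<dots> = (\<integral>\<^sup>+t. f t \<partial>arc_meas p a) + (\<integral>\<^sup>+t. f t \<partial>arc_meas a (p + 2*pi))"
    by (simp add: shift add.commute)
  also have "\<dots> = (\<integral>\<^sup>+t. f t \<partial>arc_meas p (p + 2*pi))"
    using k by (intro nn_integral_arc_meas_split[symmetric]) auto
  also have "\<dots> = (\<integral>\<^sup>+t. f (t + p) \<partial>arc_meas 0 (2*pi))"
    using nn_integral_arc_meas_shift[of f 0 "2*pi" p] by (simp add: add.commute)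
  also have "(\<lambda>t. f (t + p)) = f" using periodic_int[of f, OF per] by (auto simp: p_def)
  finally show ?thesis .
qed

lemma nn_integral_arc_meas_continuous:
  assumes "continuous_on {a..b} f" "\<And>t. t \<in> {a..b} \<Longrightarrow> f t \<ge> (0::real)" "f \<in> borel_measurable borel"
  shows "(\<integral>\<^sup>+t. ennreal (f t) \<partial>arc_meas a b) = ennreal (integral {a..b} f)"
proof -
  have "(f has_integral integral {a..b} f) {a..b}"
    using assms(1) integrable_continuous_real by blast
  then have "integral\<^sup>N lborel (\<lambda>x. indicator {a..b} x * f x) = integral {a..b} f"
    by (rule nn_integral_has_integral_lebesgue[rotated]) (use assms in auto)
  then show ?thesis using assms(3)
    by (simp add: nn_integral_arc_meas ennreal_mult' ennreal_indicator)
qed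

text \<open>The parametrization \<open>cis\<close> has speed one, so a contour integral over the
  circle is dominated by the plain integral of the modulus in the angle.\<close>

lemma has_contour_integral_unit_circle_norm_le:
  assumes I: "(w has_contour_integral I) (circlepath 0 1)" and cont: "continuous_on (sphere 0 1) w"
  shows "ennreal (norm I) \<le> (\<integral>\<^sup>+t. ennreal (norm (w (cis t))) \<partial>arc_meas 0 (2*pi))"
proof -
  have c: "continuous_on UNIV (\<lambda>t. w (cis t))"
    by (rule continuous_on_compose2[OF cont]) (auto intro!: continuous_intros)
  then have m: "(\<lambda>t. w (cis t)) \<in> borel_measurable borel"
    by (rule borel_measurable_continuous_onI)
  have cn: "continuous_on {0..2*pi} (\<lambda>t. norm (w (cis t)))"
    using continuous_on_subset[OF c] by (intro continuous_intros) auto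
  have "((\<lambda>t. w (0 + of_real 1 * cis t) * of_real 1 * \<i> * cis t) has_integral I) {0..2*pi}"
    using I unfolding circlepath_def
    by (subst (asm) has_contour_integral_part_circlepath_iff) auto
  then have hi: "((\<lambda>t. w (cis t) * \<i> * cis t) has_integral I) {0..2*pi}" by simp
  have "norm (integral {0..2*pi} (\<lambda>t. w (cis t) * \<i> * cis t)) \<le> integral {0..2*pi} (\<lambda>t. norm (w (cis t)))"
    by (intro integral_norm_bound_integral has_integral_integrable[OF hi] integrable_continuous_real cn)
       (simp add: norm_mult)
  then have "norm I \<le> integral {0..2*pi} (\<lambda>t. norm (w (cis t)))"
    using integral_unique[OF hi] by simp
  then show ?thesis
    by (subst nn_integral_arc_meas_continuous) (use cn m in \<open>auto intro!: ennreal_leI\<close>)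
qed

lemma norm_one_minus_cnj_mult:
  assumes "norm w = 1" shows "norm (1 - cnj z * w) = norm (w - z)"
proof -
  have "1 - cnj z * w = w * (cnj w - cnj z)"
    using complex_norm_square[of w] assms by (simp add: algebra_simps)
  then show ?thesis using assms by (metis complex_cnj_diff complex_mod_cnj mult_1 norm_mult)
qed

text \<open>Cauchy's formula is applied to v(w) / (1 - cnj z * w). At w = z the denominator is 1 -
  |z|^2, and on the circle it has the modulus of w - z, so the Cauchy kernel turns into the Poisson
  kernel after taking absolute values. No harmonic functions are involved.\<close>

lemma norm_le_poisson:
  assumes v: "v holomorphic_on ball 0 \<rho>" and "\<rho> > 1" and z: "norm z < 1"
  shows "ennreal (norm (v z)) \<le>
    (\<integral>\<^sup>+t. ennreal (norm (v (cis t)) * ((1 - (norm z)^2) / (2*pi * (norm (cis t - z))^2))) \<partial>arc_meas 0 (2*pi))"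
proof -
  define g where "g = (\<lambda>w. v w / (1 - cnj z * w))"
  have nz: "1 - cnj z * w \<noteq> 0" if "norm w \<le> 1" for w
  proof
    assume "1 - cnj z * w = 0"
    then have "norm (cnj z * w) = 1" by (metis eq_iff_diff_eq_0 norm_one)
    moreover have "norm (cnj z * w) \<le> norm z * 1" unfolding norm_mult using that
      by (simp add: mult_left_le)
    ultimately show False using z by simp
  qed
  have vc: "v holomorphic_on cball 0 1" using v by (rule holomorphic_on_subset) (use \<open>\<rho> > 1\<close> in auto)
  have hol: "g holomorphic_on cball 0 1"
    unfolding g_def by (intro holomorphic_intros vc) (use nz in auto)
  have "((\<lambda>w. g w / (w - z)) has_contour_integral (2 * of_real pi * \<i> * g z)) (circlepath 0 1)"
    by (rule Cauchy_integral_circlepath) (use hol z in \<open>auto intro: holomorphic_on_imp_continuous_on holomorphic_on_subset\<close>)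
  then have "ennreal (norm (2 * of_real pi * \<i> * g z)) \<le> (\<integral>\<^sup>+t. ennreal (norm (g (cis t) / (cis t - z))) \<partial>arc_meas 0 (2*pi))"
  proof (rule has_contour_integral_unit_circle_norm_le)
    show "continuous_on (sphere 0 1) (\<lambda>w. g w / (w - z))"
      by (intro continuous_intros continuous_on_subset[OF holomorphic_on_imp_continuous_on[OF hol]])
         (use z in auto)
  qed
  also have "norm (2 * of_real pi * \<i> * g z) = 2 * pi / (1 - (norm z)^2) * norm (v z)"
  proof -
    have "1 - cnj z * z = of_real (1 - (norm z)^2)"
      using complex_norm_square[of z] by (simp add: mult.commute)
    moreover have "(norm z)^2 < 1" using z by (simp add: power_less_one_iff)
    ultimately show ?thesis by (simp add: g_def norm_mult norm_divide del: of_real_diff)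
  qed
  finally have 1: "ennreal (2 * pi / (1 - (norm z)^2) * norm (v z)) \<le> (\<integral>\<^sup>+t. ennreal (norm (g (cis t) / (cis t - z))) \<partial>arc_meas 0 (2*pi))" .
  have z2: "1 - (norm z)^2 > 0" using z by (simp add: power_less_one_iff)
  have mv: "(\<lambda>t. norm (g (cis t) / (cis t - z))) \<in> borel_measurable borel"
  proof (intro borel_measurable_continuous_onI continuous_intros)
    show "continuous_on UNIV (\<lambda>t. g (cis t))"
      by (rule continuous_on_compose2[OF holomorphic_on_imp_continuous_on[OF hol]]) (auto intro!: continuous_intros)
  qed (use z in auto)
  have "ennreal (norm (v z)) = ennreal ((1 - (norm z)^2) / (2*pi)) * ennreal (2 * pi / (1 - (norm z)^2) * norm (v z))"
    using z2 by (subst ennreal_mult[symmetric]) auto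
  also have "\<dots> \<le> ennreal ((1 - (norm z)^2) / (2*pi)) * (\<integral>\<^sup>+t. ennreal (norm (g (cis t) / (cis t - z))) \<partial>arc_meas 0 (2*pi))"
    by (intro mult_left_mono 1) auto
  also have "\<dots> = (\<integral>\<^sup>+t. ennreal ((1 - (norm z)^2) / (2*pi)) * ennreal (norm (g (cis t) / (cis t - z))) \<partial>arc_meas 0 (2*pi))"
    by (rule nn_integral_cmult[symmetric]) (use mv in auto)
  also have "\<dots> = (\<integral>\<^sup>+t. ennreal (norm (v (cis t)) * ((1 - (norm z)^2) / (2*pi * (norm (cis t - z))^2))) \<partial>arc_meas 0 (2*pi))"
  proof (rule nn_integral_cong)
    fix t
    have "norm (1 - cnj z * cis t) = norm (cis t - z)" by (rule norm_one_minus_cnj_mult) simp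
    then have "norm (g (cis t) / (cis t - z)) = norm (v (cis t)) / (norm (cis t - z))^2"
      by (simp add: g_def norm_divide norm_mult power2_eq_square)
    then show "ennreal ((1 - (norm z)^2) / (2*pi)) * ennreal (norm (g (cis t) / (cis t - z)))
       = ennreal (norm (v (cis t)) * ((1 - (norm z)^2) / (2*pi * (norm (cis t - z))^2)))"
      using z2 by (subst ennreal_mult[symmetric]) (auto simp: mult_ac)
  qed
  finally show ?thesis .
qed

text \<open>Subtracting c does not change the derivative. The free constant lets the oscillation of
  the boundary values, rather than their size, control v'.\<close>

lemma norm_deriv_le_circle:
  assumes v: "v holomorphic_on ball 0 \<rho>" and "\<rho> > 1" and z: "norm z < 1"
  shows "ennreal (norm (deriv v z)) \<le>
    (\<integral>\<^sup>+t. ennreal (norm (v (cis t) - c) / (2*pi * (norm (cis t - z))^2)) \<partial>arc_meas 0 (2*pi))"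
proof -
  have vc: "v holomorphic_on cball 0 1" using v by (rule holomorphic_on_subset) (use \<open>\<rho> > 1\<close> in auto)
  define w where "w = (\<lambda>u. v u - c)"
  have wc: "w holomorphic_on cball 0 1" unfolding w_def by (intro holomorphic_intros vc)
  have cw: "continuous_on (cball 0 1) w" "w holomorphic_on ball 0 1" "z \<in> ball 0 1"
    using wc z by (auto intro: holomorphic_on_imp_continuous_on holomorphic_on_subset)
  define I where "I = contour_integral (circlepath 0 1) (\<lambda>u. w u / (u - z)^2)"
  have I: "((\<lambda>u. w u / (u - z)^2) has_contour_integral I) (circlepath 0 1)"
    unfolding I_def using Cauchy_derivative_integral_circlepath(1)[OF cw] by (rule has_contour_integral_integral)
  have d: "(w has_field_derivative (1 / (2 * of_real pi * \<i>) * I)) (at z)"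
    unfolding I_def by (rule Cauchy_derivative_integral_circlepath(2)[OF cw])
  have "(v has_field_derivative deriv v z) (at z)"
    using holomorphic_derivI[OF v open_ball] z \<open>\<rho> > 1\<close> by auto
  then have "(w has_field_derivative deriv v z) (at z)"
    unfolding w_def by (auto intro!: derivative_eq_intros)
  then have dv: "deriv v z = 1 / (2 * of_real pi * \<i>) * I" using d DERIV_unique by blast
  have cont: "continuous_on (sphere 0 1) (\<lambda>u. w u / (u - z)^2)"
    by (intro continuous_intros continuous_on_subset[OF cw(1)]) (use z in auto)
  have 1: "ennreal (norm I) \<le> (\<integral>\<^sup>+t. ennreal (norm (w (cis t) / (cis t - z)^2)) \<partial>arc_meas 0 (2*pi))"
    by (rule has_contour_integral_unit_circle_norm_le[OF I cont])
  have mv: "(\<lambda>t. norm (w (cis t) / (cis t - z)^2)) \<in> borel_measurable borel"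
  proof (intro borel_measurable_continuous_onI continuous_intros)
    show "continuous_on UNIV (\<lambda>t. w (cis t))"
      by (rule continuous_on_compose2[OF cw(1)]) (auto intro!: continuous_intros)
  qed (use z in auto)
  have "ennreal (norm (deriv v z)) = ennreal (1 / (2*pi)) * ennreal (norm I)"
    unfolding dv by (subst ennreal_mult[symmetric]) (auto simp: norm_mult norm_divide)
  also have "\<dots> \<le> ennreal (1 / (2*pi)) * (\<integral>\<^sup>+t. ennreal (norm (w (cis t) / (cis t - z)^2)) \<partial>arc_meas 0 (2*pi))"
    by (intro mult_left_mono 1) auto
  also have "\<dots> = (\<integral>\<^sup>+t. ennreal (1 / (2*pi)) * ennreal (norm (w (cis t) / (cis t - z)^2)) \<partial>arc_meas 0 (2*pi))"
    by (rule nn_integral_cmult[symmetric]) (use mv in auto)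
  also have "\<dots> = (\<integral>\<^sup>+t. ennreal (norm (v (cis t) - c) / (2*pi * (norm (cis t - z))^2)) \<partial>arc_meas 0 (2*pi))"
    by (intro nn_integral_cong, subst ennreal_mult[symmetric])
       (auto simp: w_def norm_divide norm_power field_simps)
  finally show ?thesis .
qed

subsection \<open>Rotation invariance and radial integrals in the disc\<close>

lemma nn_integral_lborel_plus:
  fixes f :: "'a::euclidean_space \<Rightarrow> ennreal"
  assumes [measurable]: "f \<in> borel_measurable borel"
  shows "(\<integral>\<^sup>+x. f (c + x) \<partial>lborel) = (\<integral>\<^sup>+x. f x \<partial>lborel)"
proof -
  have "(\<integral>\<^sup>+x. f x \<partial>lborel) = (\<integral>\<^sup>+x. f x \<partial>distr lborel borel ((+) c))"
    by (simp add: lborel_distr_plus)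
  also have "\<dots> = (\<integral>\<^sup>+x. f (c + x) \<partial>lborel)" by (subst nn_integral_distr) auto
  finally show ?thesis ..
qed

text \<open>Both measures are translation invariant, so Fubini applied to
  \<open>1\<^sub>B(y) 1\<^sub>A(x + y)\<close> shows that they are proportional; the unit ball \<open>B\<close> fixes the factor.\<close>

lemma distr_lborel_isometry:
  fixes T :: "'a::euclidean_space \<Rightarrow> 'a"
  assumes lin: "linear T" and norm: "\<And>x. norm (T x) = norm x" and surj: "surj T"
  shows "distr lborel borel T = lborel"
proof (rule measure_eqI)
  have T [measurable]: "T \<in> borel_measurable borel"
    using linear_continuous_on linear_conv_bounded_linear lin
    by (intro borel_measurable_continuous_onI) blast
  fix A assume "A \<in> sets (distr lborel borel T)"
  then have A [measurable]: "A \<in> sets borel" by simp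
  define B where "B = ball (0::'a) 1"
  have B [measurable]: "B \<in> sets borel" by (simp add: B_def)
  have TB: "T x \<in> B \<longleftrightarrow> x \<in> B" for x by (simp add: B_def norm)
  have mT: "emeasure (distr lborel borel T) A = (\<integral>\<^sup>+y. indicator A (T y) \<partial>lborel)"
    by (simp add: nn_integral_indicator[symmetric] nn_integral_distr del: nn_integral_indicator)
  have "(\<integral>\<^sup>+x. \<integral>\<^sup>+y. indicator B (T y) * indicator A (x + T y) \<partial>lborel \<partial>lborel)
      = (\<integral>\<^sup>+y. \<integral>\<^sup>+x. indicator B (T y) * indicator A (x + T y) \<partial>lborel \<partial>(lborel::'a measure))"
    by (rule lborel_pair.Fubini'[symmetric]) measurable
  also have "\<dots> = (\<integral>\<^sup>+y. indicator B (T y) * emeasure lborel A \<partial>(lborel::'a measure))"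
  proof (intro nn_integral_cong)
    fix y
    have "(\<integral>\<^sup>+x. indicator B (T y) * indicator A (x + T y) \<partial>lborel)
       = indicator B (T y) * (\<integral>\<^sup>+x. indicator A (T y + x) \<partial>(lborel::'a measure))"
      by (subst nn_integral_cmult[symmetric]) (auto simp: add.commute)
    also have "(\<integral>\<^sup>+x. indicator A (T y + x) \<partial>(lborel::'a measure)) = emeasure lborel A"
      by (subst nn_integral_lborel_plus) auto
    finally show "(\<integral>\<^sup>+x. indicator B (T y) * indicator A (x + T y) \<partial>lborel) = indicator B (T y) * emeasure lborel A" .
  qed
  also have "\<dots> = (\<integral>\<^sup>+y. indicator B y * emeasure lborel A \<partial>(lborel::'a measure))"
    by (simp add: TB indicator_def)
  also have "\<dots> = emeasure lborel B * emeasure lborel A"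
    by (subst nn_integral_multc) auto
  finally have 1: "(\<integral>\<^sup>+x. \<integral>\<^sup>+y. indicator B (T y) * indicator A (x + T y) \<partial>lborel \<partial>lborel) = emeasure lborel B * emeasure lborel A" .
  have "(\<integral>\<^sup>+x. \<integral>\<^sup>+y. indicator B (T y) * indicator A (x + T y) \<partial>lborel \<partial>lborel)
     = (\<integral>\<^sup>+x. \<integral>\<^sup>+y. indicator B (T y - x) * indicator A (T y) \<partial>lborel \<partial>(lborel::'a measure))"
  proof (rule nn_integral_cong)
    fix x :: 'a
    \<comment> \<open>Surjectivity rewrites the shift by x after T as a shift by a preimage x'
      before T, and Lebesgue measure is invariant under the latter.\<close>
    obtain x' where x': "x = T x'" using surj by auto
    have "(\<integral>\<^sup>+y. indicator B (T y - x) * indicator A (T y) \<partial>lborel)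
       = (\<integral>\<^sup>+y. indicator B (T (x' + y) - x) * indicator A (T (x' + y)) \<partial>(lborel::'a measure))"
      by (subst nn_integral_lborel_plus[where f = "\<lambda>y. indicator B (T y - x) * indicator A (T y)"]) auto
    then show "(\<integral>\<^sup>+y. indicator B (T y) * indicator A (x + T y) \<partial>lborel)
        = (\<integral>\<^sup>+y. indicator B (T y - x) * indicator A (T y) \<partial>(lborel::'a measure))"
      using linear_add[OF lin] by (simp add: x')
  qed
  also have "\<dots> = (\<integral>\<^sup>+y. \<integral>\<^sup>+x. indicator B (T y - x) * indicator A (T y) \<partial>lborel \<partial>(lborel::'a measure))"
    by (rule lborel_pair.Fubini'[symmetric]) measurable
  also have "\<dots> = (\<integral>\<^sup>+y. emeasure lborel B * indicator A (T y) \<partial>(lborel::'a measure))"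
  proof (intro nn_integral_cong)
    fix y
    have "(\<integral>\<^sup>+x. indicator B (T y - x) * indicator A (T y) \<partial>lborel)
       = (\<integral>\<^sup>+x. indicator (ball (T y) 1) x * indicator A (T y) \<partial>(lborel::'a measure))"
      by (intro nn_integral_cong) (auto simp: B_def indicator_def dist_norm norm_minus_commute)
    also have "\<dots> = emeasure lborel (ball (T y) 1) * indicator A (T y)"
      by (subst nn_integral_multc) (auto intro!: borel_measurable_indicator)
    also have "emeasure lborel (ball (T y) 1) = emeasure lborel B"
      by (simp add: B_def emeasure_ball)
    finally show "(\<integral>\<^sup>+x. indicator B (T y - x) * indicator A (T y) \<partial>lborel) = emeasure lborel B * indicator A (T y)" .
  qed
  also have "\<dots> = emeasure lborel B * emeasure (distr lborel borel T) A"
    unfolding mT by (subst nn_integral_cmult) auto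
  finally have 2: "emeasure lborel B * emeasure (distr lborel borel T) A = emeasure lborel B * emeasure lborel A"
    using 1 by simp
  have nz: "unit_ball_vol (real DIM('a)) \<noteq> 0"
    using unit_ball_vol_pos[of "real DIM('a)"] by linarith
  have "emeasure lborel B \<noteq> \<infinity>" "emeasure lborel B \<noteq> 0"
    unfolding B_def by (simp_all add: emeasure_ball nz)
  with 2 show "emeasure (distr lborel borel T) A = emeasure lborel A"
    by (simp add: ennreal_mult_cancel_left)
qed simp

lemma nn_integral_rotate:
  assumes [measurable]: "f \<in> borel_measurable borel"
  shows "(\<integral>\<^sup>+z. f (cis t * z) \<partial>lborel) = (\<integral>\<^sup>+z. f z \<partial>lborel)"
proof -
  have "surj ((*) (cis t))"
    by (rule surjI[of _ "\<lambda>z. cis (-t) * z"]) (simp add: mult.assoc[symmetric] cis_mult)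
  then have "distr lborel borel ((*) (cis t)) = lborel"
    by (intro distr_lborel_isometry) (auto simp: norm_mult intro!: linear_times)
  then have "(\<integral>\<^sup>+z. f z \<partial>lborel) = (\<integral>\<^sup>+z. f z \<partial>distr lborel borel ((*) (cis t)))" by simp
  also have "\<dots> = (\<integral>\<^sup>+z. f (cis t * z) \<partial>lborel)" by (subst nn_integral_distr) auto
  finally show ?thesis ..
qed

section \<open>Polar coordinates for radial integrands\<close>

lemma borel_measurable_norm_ident: "norm \<in> borel_measurable (borel :: complex measure)"
  by (intro borel_measurable_continuous_onI continuous_intros)

text \<open>Both measures are finite on the half-lines above a point and therefore determined by
  them; the unit disc without the closed disc of radius x has area pi (1 - x^2), which is the
  integral of 2 pi r from x to 1.\<close>

lemma distr_norm_unit_disc: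
  "distr (density lborel (indicator (ball (0::complex) 1))) borel norm
    = density lborel (\<lambda>r. indicator {0..1} r * ennreal (2 * pi * r))" (is "?M = ?N")
proof (rule measure_eqI_lessThan)
  show "sets ?M = sets borel" "sets ?N = sets borel" by auto
  have M: "emeasure ?M {x<..} = ennreal (if x < 0 then pi else if x \<le> 1 then pi * (1 - x^2) else 0)" for x
  proof -
    have "emeasure ?M {x<..} = emeasure (density lborel (indicator (ball (0::complex) 1))) (norm -` {x<..})"
      by (subst emeasure_distr) auto
    also have "\<dots> = emeasure lborel (ball (0::complex) 1 \<inter> norm -` {x<..})"
    proof -
      have s: "norm -` {x<..} \<in> sets (borel :: complex measure)"
        by (metis borel_measurable_norm_ident measurable_sets_borel greaterThan_borel)
      then have s': "ball 0 1 \<inter> norm -` {x<..} \<in> sets (borel :: complex measure)"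
        by auto
      show ?thesis using s s'
        by (subst emeasure_density) (auto simp: indicator_inter_arith[symmetric] intro!: borel_measurable_indicator)
    qed
    also have "ball (0::complex) 1 \<inter> norm -` {x<..} = ball 0 1 - cball 0 x"
      by auto
    also have "emeasure lborel (ball (0::complex) 1 - cball 0 x)
        = ennreal (if x < 0 then pi else if x \<le> 1 then pi * (1 - x^2) else 0)"
    proof -
      consider "x < 0" | "0 \<le> x" "x < 1" | "x \<ge> 1" by linarith
      then show ?thesis
      proof cases
        case 1 then show ?thesis by (simp add: emeasure_ball unit_ball_vol_2)
      next
        case 2
        then have "emeasure lborel (ball (0::complex) 1 - cball 0 x) = emeasure lborel (ball (0::complex) 1) - emeasure lborel (cball (0::complex) x)"
          by (intro emeasure_Diff) (auto simp: emeasure_cball)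
        also have "\<dots> = ennreal (pi - pi * x^2)"
          using 2 by (subst ennreal_minus[symmetric]) (auto simp: emeasure_ball emeasure_cball unit_ball_vol_2)
        finally show ?thesis using 2 by (simp add: algebra_simps)
      next
        case 3
        then have "ball (0::complex) 1 - cball 0 x = {}" by auto
        show ?thesis unfolding \<open>ball (0::complex) 1 - cball 0 x = {}\<close> using 3 by (auto simp: power2_eq_square)
      qed
    qed
    finally show ?thesis .
  qed
  show "emeasure ?M {x<..} < \<infinity>" for x by (simp add: M)
  show "emeasure ?M {x<..} = emeasure ?N {x<..}" for x
  proof -
    \<comment> \<open>Clipping x to [0, 1] gives the left end of the part of [0, 1] above x, up to
      end points of measure zero.\<close>
    define y where "y = min 1 (max 0 x)"
    have "emeasure ?N {x<..} = (\<integral>\<^sup>+r. indicator {0..1} r * ennreal (2 * pi * r) * indicator {x<..} r \<partial>lborel)"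
      by (subst emeasure_density) auto
    also have "\<dots> = (\<integral>\<^sup>+r. ennreal (2 * pi * r) * indicator {y..1} r \<partial>lborel)"
    proof (rule nn_integral_cong_AE)
      have "AE r in lborel. r \<noteq> y \<and> r \<noteq> 1 \<and> r \<noteq> x" by (auto intro: AE_lborel_singleton)
      then show "AE r in lborel. indicator {0..1} r * ennreal (2 * pi * r) * indicator {x<..} r = ennreal (2 * pi * r) * indicator {y..1} r"
        by eventually_elim (auto simp: indicator_def y_def)
    qed
    also have "\<dots> = ennreal (pi * 1^2 - pi * y^2)"
    proof (rule nn_integral_FTC_Icc[where F = "\<lambda>r. pi * r^2"])
      show "((\<lambda>r. pi * r^2) has_real_derivative 2 * pi * r) (at r)" for r
        by (auto intro!: derivative_eq_intros)
    qed (auto simp: y_def)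
    finally show ?thesis unfolding M y_def by (auto simp: algebra_simps power2_eq_square)
  qed
qed

lemma nn_integral_unit_disc_radial:
  assumes [measurable]: "g \<in> borel_measurable borel"
  shows "(\<integral>\<^sup>+z. indicator (ball (0::complex) 1) z * g (norm z) \<partial>lborel)
    = (\<integral>\<^sup>+r. indicator {0..1} r * ennreal (2 * pi * r) * g r \<partial>lborel)"
proof -
  have "(\<integral>\<^sup>+z. indicator (ball (0::complex) 1) z * g (norm z) \<partial>lborel)
     = (\<integral>\<^sup>+r. g r \<partial>distr (density lborel (indicator (ball (0::complex) 1))) borel norm)"
    by (subst nn_integral_distr, simp, simp, subst nn_integral_density) (auto intro!: borel_measurable_indicator)
  also have "\<dots> = (\<integral>\<^sup>+r. indicator {0..1} r * ennreal (2 * pi * r) * g r \<partial>lborel)"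
    unfolding distr_norm_unit_disc by (subst nn_integral_density) auto
  finally show ?thesis .
qed

subsection \<open>Parseval's identity\<close>

lemma has_integral_cis_int:
  "((\<lambda>t. cis (of_int k * t)) has_integral (if k = 0 then 2 * of_real pi else 0)) {0..2*pi}"
proof (cases "k = 0")
  case True
  have "((\<lambda>t::real. 1::complex) has_integral (2*pi - 0) *\<^sub>R 1) {0..2*pi}"
    by (rule has_integral_const_real[THEN has_integral_eq_rhs]) auto
  then show ?thesis using True by (simp add: scaleR_conv_of_real)
next
  case False
  have "((\<lambda>t. cis (of_int k * t)) has_integral
     (cis (of_int k * (2*pi)) / (\<i> * of_int k) - cis (of_int k * 0) / (\<i> * of_int k))) {0..2*pi}"
  proof (rule fundamental_theorem_of_calculus)
    fix t :: real
    have "((\<lambda>z. exp (\<i> * of_int k * z) / (\<i> * of_int k)) has_field_derivative exp (\<i> * of_int k * of_real t)) (at (of_real t))"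
      using False by (auto intro!: derivative_eq_intros)
    from has_vector_derivative_real_field[OF this, of "{0..2*pi}"]
    show "((\<lambda>t. cis (of_int k * t) / (\<i> * of_int k)) has_vector_derivative cis (of_int k * t)) (at t within {0..2*pi})"
      by (simp add: cis_conv_exp mult.assoc)
  qed auto
  moreover have "cis (of_int k * (2*pi)) = 1"
    using cos_int_2pin[of k] sin_int_2pin[of k] by (simp add: complex_eq_iff mult_ac)
  ultimately show ?thesis using False by simp
qed

lemma parseval_finite:
  fixes d :: "nat \<Rightarrow> complex"
  shows "((\<lambda>t. (norm (\<Sum>n<N. d n * cis (real n * t)))^2) has_integral (2*pi * (\<Sum>n<N. (norm (d n))^2))) {0..2*pi}"
proof -
  have "((\<lambda>t. \<Sum>n<N. \<Sum>m<N. d n * cnj (d m) * cis (of_int (int n - int m) * t)) has_integral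
     (\<Sum>n<N. \<Sum>m<N. d n * cnj (d m) * (if int n - int m = 0 then 2 * of_real pi else 0))) {0..2*pi}"
    by (intro has_integral_sum has_integral_mult_right has_integral_cis_int) auto
  also have "(\<Sum>n<N. \<Sum>m<N. d n * cnj (d m) * (if int n - int m = 0 then 2 * of_real pi else 0))
     = (\<Sum>n<N. d n * cnj (d n) * (2 * of_real pi))"
    by (simp add: if_distrib[of "\<lambda>x. _ * x"] sum.delta' cong: if_cong)
  also have "\<dots> = of_real (2*pi * (\<Sum>n<N. (norm (d n))^2))"
    by (simp add: sum_distrib_left complex_norm_square[symmetric] mult_ac del: of_real_power)
  also have "(\<lambda>t. \<Sum>n<N. \<Sum>m<N. d n * cnj (d m) * cis (of_int (int n - int m) * t))
      = (\<lambda>t. of_real ((norm (\<Sum>n<N. d n * cis (real n * t)))^2))"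
  proof
    fix t
    have "complex_of_real ((norm (\<Sum>n<N. d n * cis (real n * t)))^2)
       = (\<Sum>n<N. d n * cis (real n * t)) * (\<Sum>m<N. cnj (d m) * cis (- (real m * t)))"
      by (subst complex_norm_square) (simp add: cis_cnj)
    also have "\<dots> = (\<Sum>n<N. \<Sum>m<N. d n * cnj (d m) * cis (of_int (int n - int m) * t))"
      unfolding sum_product
      by (intro sum.cong refl) (simp add: cis_mult[symmetric] left_diff_distrib cis_divide[symmetric] divide_inverse)
    finally show "(\<Sum>n<N. \<Sum>m<N. d n * cnj (d m) * cis (of_int (int n - int m) * t))
      = of_real ((norm (\<Sum>n<N. d n * cis (real n * t)))^2)" ..
  qed
  finally have "((\<lambda>t. Re (of_real ((norm (\<Sum>n<N. d n * cis (real n * t)))^2))) has_integral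
      Re (of_real (2*pi * (\<Sum>n<N. (norm (d n))^2)))) {0..2*pi}"
    using has_integral_linear[OF _ bounded_linear_Re, unfolded o_def] by blast
  then show ?thesis by (simp del: of_real_power of_real_mult)
qed

text \<open>All partial sums are bounded by the sum of the |d n|, so dominated convergence with a
  constant majorant extends the finite identity. Absolute summability is available for the
  coefficients of every dilate of a holomorphic function.\<close>

lemma parseval:
  fixes d :: "nat \<Rightarrow> complex"
  assumes d: "summable (\<lambda>n. norm (d n))"
  shows "((\<lambda>t. (norm (\<Sum>n. d n * cis (real n * t)))^2) has_integral (2*pi * (\<Sum>n. (norm (d n))^2))) {0..2*pi}"
    and "summable (\<lambda>n. (norm (d n))^2)"
proof -
  define S where "S = (\<Sum>n. norm (d n))"
  have bd: "norm (\<Sum>n<N. d n * cis (real n * t)) \<le> S" for N t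
  proof -
    have "norm (\<Sum>n<N. d n * cis (real n * t)) \<le> (\<Sum>n<N. norm (d n))"
      by (rule order_trans[OF norm_sum]) (simp add: norm_mult)
    also have "\<dots> \<le> S" unfolding S_def by (rule sum_le_suminf[OF d]) auto
    finally show ?thesis .
  qed
  have S0: "S \<ge> 0" unfolding S_def by (rule suminf_nonneg[OF d]) auto
  have lim: "(\<lambda>N. (norm (\<Sum>n<N. d n * cis (real n * t)))^2) \<longlonglongrightarrow> (norm (\<Sum>n. d n * cis (real n * t)))^2" for t
  proof -
    have "summable (\<lambda>n. d n * cis (real n * t))"
      by (rule summable_norm_cancel) (use d in \<open>simp add: norm_mult\<close>)
    then show ?thesis by (intro tendsto_intros summable_LIMSEQ)
  qed
  have I: "(\<lambda>t. (norm (\<Sum>n<N. d n * cis (real n * t)))^2) integrable_on {0..2*pi}"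
     "integral {0..2*pi} (\<lambda>t. (norm (\<Sum>n<N. d n * cis (real n * t)))^2) = 2*pi * (\<Sum>n<N. (norm (d n))^2)" for N
    using parseval_finite[of d N] by (auto simp: has_integral_integrable_integral)
  note dom = dominated_convergence[where f = "\<lambda>N t. (norm (\<Sum>n<N. d n * cis (real n * t)))^2" and S = "{0..2*pi}" and h = "\<lambda>_. S^2"
      and g = "\<lambda>t. (norm (\<Sum>n. d n * cis (real n * t)))^2", OF I(1) integrable_const_ivl _ lim]
  have bd2: "norm ((norm (\<Sum>n<N. d n * cis (real n * t)))^2) \<le> S^2" for N t
    using bd[where N = N and t = t] by (simp add: power_mono)
  have dc: "(\<lambda>t. (norm (\<Sum>n. d n * cis (real n * t)))^2) integrable_on {0..2*pi}"
     "(\<lambda>N. integral {0..2*pi} (\<lambda>t. (norm (\<Sum>n<N. d n * cis (real n * t)))^2))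
       \<longlonglongrightarrow> integral {0..2*pi} (\<lambda>t. (norm (\<Sum>n. d n * cis (real n * t)))^2)"
    using dom[OF bd2] by blast+
  show s: "summable (\<lambda>n. (norm (d n))^2)"
  proof (rule summable_comparison_test_ev[OF _ summable_mult[OF d, of S]])
    show "\<forall>\<^sub>F n in sequentially. norm ((norm (d n))^2) \<le> S * norm (d n)"
    proof (intro always_eventually allI)
      fix n
      have "norm (d n) \<le> S" unfolding S_def
        using sum_le_suminf[OF d, of "{n}"] by simp
      then show "norm ((norm (d n))^2) \<le> S * norm (d n)"
        by (simp add: power2_eq_square mult_right_mono)
    qed
  qed
  have "(\<lambda>N. 2*pi * (\<Sum>n<N. (norm (d n))^2)) \<longlonglongrightarrow> 2*pi * (\<Sum>n. (norm (d n))^2)"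
    by (intro tendsto_intros summable_LIMSEQ s)
  then have "integral {0..2*pi} (\<lambda>t. (norm (\<Sum>n. d n * cis (real n * t)))^2) = 2*pi * (\<Sum>n. (norm (d n))^2)"
    using dc(2) unfolding I(2) using LIMSEQ_unique by blast
  then show "((\<lambda>t. (norm (\<Sum>n. d n * cis (real n * t)))^2) has_integral (2*pi * (\<Sum>n. (norm (d n))^2))) {0..2*pi}"
    using dc(1) by (simp add: has_integral_integrable_integral)
qed

section \<open>Square means over concentric circles\<close>

lemma borel_measurable_circle:
  assumes "continuous_on (ball 0 1) u" "0 \<le> r" "r < 1"
  shows "(\<lambda>t. u (of_real r * cis t)) \<in> borel_measurable borel"
  by (intro borel_measurable_continuous_onI continuous_on_compose2[OF assms(1)] continuous_intros)
     (use assms in \<open>auto simp: norm_mult\<close>)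

text \<open>Coefficientwise this is \<open>(r\<^sup>n - s\<^sup>n)\<^sup>2 + s\<^sup>2\<^sup>n \<le> r\<^sup>2\<^sup>n\<close>.  Since the norms increase to a finite
  limit, the dilates of a function in \<open>H\<^sup>2\<close> are Cauchy without any tail estimate.\<close>

lemma circle_L2_increment:
  assumes u: "u holomorphic_on ball 0 1" and sr: "0 \<le> s" "s \<le> r" "r < 1"
  shows "(\<integral>\<^sup>+t. ennreal ((norm (u (of_real r * cis t) - u (of_real s * cis t)))^2) \<partial>arc_meas 0 (2*pi))
     + (\<integral>\<^sup>+t. ennreal ((norm (u (of_real s * cis t)))^2) \<partial>arc_meas 0 (2*pi))
    \<le> (\<integral>\<^sup>+t. ennreal ((norm (u (of_real r * cis t)))^2) \<partial>arc_meas 0 (2*pi))"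
proof -
  define c where "c = (\<lambda>n. (deriv ^^ n) u 0 / fact n)"
  have ps: "(\<lambda>n. c n * z ^ n) sums u z" if "norm z < 1" for z
    using holomorphic_power_series[OF u, of z] that by (simp add: c_def)
  have cu: "continuous_on (ball 0 1) u" by (rule holomorphic_on_imp_continuous_on[OF u])
  have ab: "summable (\<lambda>n. norm (c n * of_real x ^ n))" if x: "0 \<le> x" "x < 1" for x :: real
  proof -
    \<comment> \<open>Convergence of the power series at a radius strictly beyond x makes it
      absolutely convergent at x.\<close>
    obtain y where y: "x < y" "y < 1" using x dense by blast
    have "summable (\<lambda>n. c n * of_real y ^ n)"
      using ps[of "of_real y"] x y by (auto simp: sums_iff)
    then show ?thesis by (rule powser_insidea) (use x y in auto)
  qed
  have ux: "u (of_real x * cis t) = (\<Sum>n. (c n * of_real x ^ n) * cis (real n * t))" if x: "0 \<le> x" "x < 1" for x t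
  proof -
    have "(of_real x * cis t) ^ n = of_real x ^ n * cis (real n * t)" for n
      by (simp only: power_mult_distrib Complex.DeMoivre)
    then show ?thesis using ps[of "of_real x * cis t"] x
      by (simp add: sums_iff norm_mult mult.assoc)
  qed
  have nn: "(\<integral>\<^sup>+t. ennreal ((norm (\<Sum>n. d n * cis (real n * t)))^2) \<partial>arc_meas 0 (2*pi)) = ennreal (2*pi * (\<Sum>n. (norm (d n))^2))"
    if d: "summable (\<lambda>n. norm (d n))" and m: "(\<lambda>t. \<Sum>n. d n * cis (real n * t)) \<in> borel_measurable borel" for d
  proof -
    have m': "(\<lambda>t. ennreal ((norm (\<Sum>n. d n * cis (real n * t)))^2)) \<in> borel_measurable borel"
      using m by measurable
    show ?thesis
      using nn_integral_has_integral_lebesgue[OF _ parseval(1)[OF d]]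
      by (subst nn_integral_arc_meas[OF m']) (simp add: ennreal_mult' ennreal_indicator)
  qed
  have s1: "s < 1" and r0: "r \<ge> 0" using sr by auto
  define cr cs where "cr n = c n * of_real r ^ n" and "cs n = c n * of_real s ^ n" for n
  have sm: "summable (\<lambda>n. norm (cr n))" "summable (\<lambda>n. norm (cs n))"
    unfolding cr_def cs_def by (intro ab sr s1 r0)+
  then have smd: "summable (\<lambda>n. norm (cr n - cs n))"
    by (intro summable_comparison_test_ev[OF _ summable_add[OF sm]] always_eventually) (auto intro: norm_triangle_ineq4)
  have ucr: "u (of_real r * cis t) = (\<Sum>n. cr n * cis (real n * t))" for t
    unfolding cr_def by (rule ux) (use sr r0 in auto)
  have ucs: "u (of_real s * cis t) = (\<Sum>n. cs n * cis (real n * t))" for t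
    unfolding cs_def by (rule ux) (use sr s1 in auto)
  have sc: "summable (\<lambda>n. d n * cis (real n * t))" if "summable (\<lambda>n. norm (d n))" for d t
    by (rule summable_norm_cancel) (use that in \<open>simp add: norm_mult\<close>)
  have ucd: "u (of_real r * cis t) - u (of_real s * cis t) = (\<Sum>n. (cr n - cs n) * cis (real n * t))" for t
    unfolding ucr ucs by (subst suminf_diff[OF sc[OF sm(1)] sc[OF sm(2)]]) (simp add: algebra_simps)
  note mr = borel_measurable_circle[OF cu r0 sr(3)] and ms = borel_measurable_circle[OF cu sr(1) s1]
  have md: "(\<lambda>t. u (of_real r * cis t) - u (of_real s * cis t)) \<in> borel_measurable borel"
    using mr ms by measurable
  have "2*pi * (\<Sum>n. (norm (cr n - cs n))^2) + 2*pi * (\<Sum>n. (norm (cs n))^2)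
      = 2*pi * (\<Sum>n. (norm (cr n - cs n))^2 + (norm (cs n))^2)"
    by (subst suminf_add[symmetric]) (auto intro: parseval(2) sm smd simp: algebra_simps)
  also have "\<dots> \<le> 2*pi * (\<Sum>n. (norm (cr n))^2)"
  proof (intro mult_left_mono suminf_le summable_add parseval(2) sm smd)
    fix n
    have sn: "s ^ n \<le> r ^ n" "0 \<le> s ^ n" using sr by (auto intro: power_mono)
    have "(norm (cr n - cs n))^2 + (norm (cs n))^2 = (norm (c n))^2 * ((r^n - s^n)^2 + (s^n)^2)"
    proof -
      have "cr n - cs n = c n * of_real (r^n - s^n)" by (simp add: cr_def cs_def algebra_simps)
      then have "norm (cr n - cs n) = norm (c n) * (r^n - s^n)"
        using sn by (simp add: norm_mult del: of_real_diff of_real_power)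
      moreover have "norm (cs n) = norm (c n) * s^n" using sr by (simp add: cs_def norm_mult norm_power)
      ultimately show ?thesis by (simp only: power_mult_distrib distrib_left)
    qed
    also have "\<dots> \<le> (norm (c n))^2 * (r^n)^2"
    proof (rule mult_left_mono)
      have "s^n * s^n \<le> r^n * s^n" using sn by (intro mult_right_mono) auto
      then show "(r^n - s^n)^2 + (s^n)^2 \<le> (r^n)^2" by (simp add: power2_eq_square algebra_simps)
    qed auto
    also have "\<dots> = (norm (cr n))^2" using sr by (simp add: cr_def norm_mult norm_power power_mult_distrib)
    finally show "(norm (cr n - cs n))^2 + (norm (cs n))^2 \<le> (norm (cr n))^2" .
  qed auto
  finally have "ennreal (2*pi * (\<Sum>n. (norm (cr n - cs n))^2) + 2*pi * (\<Sum>n. (norm (cs n))^2)) \<le> ennreal (2*pi * (\<Sum>n. (norm (cr n))^2))"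
    by (rule ennreal_leI)
  moreover have "(\<Sum>n. (norm (cr n - cs n))^2) \<ge> 0" "(\<Sum>n. (norm (cs n))^2) \<ge> 0"
    by (auto intro!: suminf_nonneg parseval(2) sm smd)
  ultimately show ?thesis
    using nn[OF sm(1)] nn[OF sm(2)] nn[OF smd] mr ms md unfolding ucd unfolding ucr ucs
    by (simp add: ennreal_plus[symmetric] del: ennreal_plus)
qed

subsection \<open>The radial maximal function\<close>

text \<open>Jordan's inequality: \<open>sin\<close> is concave, hence lies above its chord from 0 to
  pi/2.\<close>

lemma sin_ge_two_over_pi:
  fixes x :: real
  assumes "0 \<le> x" "x \<le> pi/2" shows "sin x \<ge> 2 * x / pi"
proof -
  have "convex_on {0..pi} (\<lambda>x. - sin x)"
  proof (rule f''_ge0_imp_convex)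
    show "((\<lambda>x. - sin x) has_real_derivative - cos x) (at x)" for x :: real
      by (auto intro!: derivative_eq_intros)
    show "((\<lambda>x. - cos x) has_real_derivative sin x) (at x)" for x :: real
      by (auto intro!: derivative_eq_intros)
  qed (auto intro: sin_ge_zero)
  from convex_onD[OF this, of "2*x/pi" 0 "pi/2"] assms show ?thesis
    by (simp add: field_simps)
qed

text \<open>The squared distance is (1-r)^2 + 4 r sin(x/2)^2. With y = |x|/pi at most 1, Jordan's
  inequality bounds it below by ((1-r)^2 + 4 r) y^2 = (1+r)^2 y^2, which stays at least y^2 even for
  small r.\<close>

lemma norm_cis_minus_real_ge:
  assumes x: "\<bar>x\<bar> \<le> pi" and r: "0 \<le> r" "r < 1"
  shows "max (1 - r) \<bar>x\<bar> / pi \<le> norm (cis x - of_real r)"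
proof -
  have n2: "(norm (cis x - of_real r))^2 = (1 - r)^2 + 4 * r * (sin (x/2))^2"
  proof -
    have "cos x = 1 - 2 * (sin (x/2))^2" using cos_double_sin[of "x/2"] by simp
    moreover have "(norm (cis x - of_real r))^2 = ((cos x)^2 + (sin x)^2) - 2 * r * cos x + r^2"
      by (simp add: cmod_power2 power2_diff)
    ultimately have "(norm (cis x - of_real r))^2 = 1 - 2 * r * (1 - 2 * (sin (x/2))^2) + r^2"
      unfolding sin_cos_squared_add2 by simp
    then show ?thesis by (simp add: power2_eq_square algebra_simps)
  qed
  have "(1 - r)^2 \<le> (norm (cis x - of_real r))^2" unfolding n2 using r by simp
  then have 1: "1 - r \<le> norm (cis x - of_real r)" by (rule power2_le_imp_le) simp
  have "\<bar>x\<bar> / pi \<le> norm (cis x - of_real r)"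
  proof (rule power2_le_imp_le)
    define y where "y = \<bar>x\<bar> / pi"
    have y: "0 \<le> y" "y \<le> 1" using x by (auto simp: y_def)
    have "y \<le> sin (\<bar>x\<bar>/2)" unfolding y_def using sin_ge_two_over_pi[of "\<bar>x\<bar>/2"] x by simp
    then have "y^2 \<le> (sin (\<bar>x\<bar>/2))^2" using y by (intro power_mono) auto
    also have "(sin (\<bar>x\<bar>/2))^2 = (sin (x/2))^2" by (cases "x \<ge> 0") auto
    finally have s: "y^2 \<le> (sin (x/2))^2" .
    have "(1 - r)^2 * y^2 \<le> (1 - r)^2 * 1" using y by (intro mult_left_mono) (auto simp: power_le_one)
    moreover have "4 * r * y^2 \<le> 4 * r * (sin (x/2))^2" using s r by (intro mult_left_mono) auto
    moreover have "(1 - r)^2 * y^2 + 4 * r * y^2 = (1 + r)^2 * y^2" by (simp add: power2_eq_square algebra_simps)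
    moreover have "1 * y^2 \<le> (1 + r)^2 * y^2" using r by (intro mult_right_mono) (auto simp: power2_eq_square algebra_simps)
    ultimately show "(\<bar>x\<bar> / pi)^2 \<le> (norm (cis x - of_real r))^2" unfolding n2 y_def by linarith
  qed auto
  moreover have "(1 - r) / pi \<le> 1 - r" using r pi_gt3 by (simp add: divide_le_eq mult_le_cancel_left1)
  ultimately show ?thesis using 1 by (simp add: max_def)
qed

text \<open>The dyadic radii \<open>\<pi> / 2\<^sup>j\<close> replace all arcs: kernels, means and moduli of continuity are only evaluated at these scales.\<close>

definition rho :: "nat \<Rightarrow> real" where "rho j = pi / 2 ^ j"

lemma rho_pos [simp]: "rho j > 0" by (simp add: rho_def)
lemma rho_nonneg [simp]: "rho j \<ge> 0" by (simp add: rho_def)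
lemma rho_le_pi: "rho j \<le> pi" by (simp add: rho_def field_simps)
lemma rho_Suc: "rho (Suc j) = rho j / 2" by (simp add: rho_def)
lemma rho_mono: "i \<le> j \<Longrightarrow> rho j \<le> rho i" unfolding rho_def by (intro divide_left_mono) auto

lemma rho_scale_exists:
  assumes "0 < d" "d \<le> pi" obtains K where "d \<le> rho K" "rho K < 2 * d"
proof -
  have "rho \<longlonglongrightarrow> 0" unfolding rho_def by real_asymp
  then have "eventually (\<lambda>j. rho j < d) sequentially" using assms(1) by (rule order_tendstoD)
  then obtain N where N: "rho N < d" by (auto simp: eventually_sequentially)
  define M where "M = (LEAST j. rho j < d)"
  have M: "rho M < d" unfolding M_def by (rule LeastI[of _ N]) (rule N)
  have "M \<noteq> 0" using M assms(2) by (intro notI) (simp add: rho_def)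
  then obtain K where K: "M = Suc K" by (cases M) auto
  have "\<not> rho K < d" using not_less_Least[of K "\<lambda>j. rho j < d"] K by (simp add: M_def)
  moreover have "rho K < 2 * d" using M K by (simp add: rho_Suc)
  ultimately show ?thesis by (intro that) auto
qed

text \<open>A single summand is enough: some j \<le> K satisfies |x| \<le> \<open>rho j\<close>
  \<le> 2 max d |x|, so that y \<ge> \<open>rho j\<close> / (2 pi) and the j-th indicator is 1. This
  is the origin of 4 pi^2.\<close>

lemma dyadic_kernel_bound:
  assumes K: "d \<le> rho K" "rho K < 2 * d" and x: "\<bar>x\<bar> \<le> pi" and y: "y \<ge> max d \<bar>x\<bar> / pi" and d: "d > 0"
  shows "1 / y^2 \<le> (\<Sum>j\<le>K. 4 * pi^2 / (rho j)^2 * indicator {-rho j..rho j} x)"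
proof -
  have key: "\<exists>j\<le>K. \<bar>x\<bar> \<le> rho j \<and> rho j \<le> 2 * max d \<bar>x\<bar>"
  proof (cases "\<bar>x\<bar> \<le> rho K")
    case True then show ?thesis using K by (intro exI[of _ K]) auto
  next
    case False
    define M where "M = (LEAST j. rho j < \<bar>x\<bar>)"
    have P: "rho K < \<bar>x\<bar>" using False by simp
    have M: "rho M < \<bar>x\<bar>" "M \<le> K" unfolding M_def by (rule LeastI[of _ K], rule P) (rule Least_le, rule P)
    have "M \<noteq> 0" using M(1) x by (intro notI) (simp add: rho_def)
    then obtain j where j: "M = Suc j" by (cases M) auto
    have "\<not> rho j < \<bar>x\<bar>" using not_less_Least[of j "\<lambda>j. rho j < \<bar>x\<bar>"] j by (simp add: M_def)
    then show ?thesis using M j by (intro exI[of _ j]) (auto simp: rho_Suc)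
  qed
  then obtain j where j: "j \<le> K" "\<bar>x\<bar> \<le> rho j" "rho j \<le> 2 * max d \<bar>x\<bar>" by blast
  have "rho j / (2*pi) \<le> 2 * max d \<bar>x\<bar> / (2*pi)" using j(3) by (intro divide_right_mono) auto
  then have "rho j / (2*pi) \<le> y" using y by simp
  then have "(rho j / (2*pi))^2 \<le> y^2" by (intro power_mono) auto
  then have "1 / y^2 \<le> 1 / (rho j / (2*pi))^2" 
  proof (intro divide_left_mono)
    have "0 < max d \<bar>x\<bar> / pi" using d by (auto simp: max_def)
    then have "y > 0" using y by linarith
    moreover have "rho j / (2*pi) > 0" by simp
    ultimately show "0 < y^2 * (rho j / (2*pi))^2" by (metis mult_pos_pos zero_less_power)
  qed auto
  also have "\<dots> = 4 * pi^2 / (rho j)^2 * indicator {-rho j..rho j} x"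
    using j(2) by (auto simp: power_divide power_mult_distrib indicator_def)
  also have "\<dots> \<le> (\<Sum>j\<le>K. 4 * pi^2 / (rho j)^2 * indicator {-rho j..rho j} x)"
    by (rule member_le_sum) (use j in auto)
  finally show ?thesis .
qed

lemma borel_measurable_circle_kernel:
  assumes r: "0 \<le> r" "r < 1"
  shows "(\<lambda>t. 1 / (norm (cis t - of_real r * cis \<theta>))^2) \<in> borel_measurable borel"
proof (intro borel_measurable_continuous_onI continuous_intros)
  show "\<forall>t\<in>UNIV. (norm (cis t - complex_of_real r * cis \<theta>))\<^sup>2 \<noteq> 0"
  proof (intro ballI notI)
    fix t assume "(norm (cis t - complex_of_real r * cis \<theta>))\<^sup>2 = 0"
    then have "cis t = of_real r * cis \<theta>" by simp
    then have "norm (cis t) = norm (of_real r * cis \<theta>)" by simp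
    then show False using r by (simp add: norm_mult)
  qed
qed

text \<open>The kernel 1 / |cis t - z|^2 is traded for dyadic arcs centred at the angle of z. As G
  is an arbitrary nonnegative periodic function, the estimate serves both the Poisson kernel in the
  maximal inequality and the derivative kernel in the Bloch bound.\<close>

lemma nn_integral_kernel_le:
  fixes G :: "real \<Rightarrow> ennreal"
  assumes [measurable]: "G \<in> borel_measurable borel" and per: "\<And>t. G (t + 2*pi) = G t"
    and r: "0 \<le> r" "r < 1" and K: "1 - r \<le> rho K" "rho K < 2 * (1 - r)"
  shows "(\<integral>\<^sup>+t. G t * ennreal (1 / (norm (cis t - of_real r * cis \<theta>))^2) \<partial>arc_meas 0 (2*pi))
    \<le> (\<Sum>j\<le>K. ennreal (4 * pi^2 / (rho j)^2) * (\<integral>\<^sup>+t. G t \<partial>arc_meas (\<theta> - rho j) (\<theta> + rho j)))"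
proof -
  note [measurable] = borel_measurable_circle_kernel[OF r]
  have "(\<integral>\<^sup>+t. G t * ennreal (1 / (norm (cis t - of_real r * cis \<theta>))^2) \<partial>arc_meas 0 (2*pi))
     = (\<integral>\<^sup>+t. G t * ennreal (1 / (norm (cis t - of_real r * cis \<theta>))^2) \<partial>arc_meas (\<theta> - pi) ((\<theta> - pi) + 2*pi))"
    by (rule nn_integral_arc_meas_periodic[symmetric]) (auto simp: per cis_mult[symmetric])
  \<comment> \<open>Hidden by periodicity, the window is recentred at \<theta>, so that the distance
    from t to \<theta> is at most pi and equals the angle between them.\<close>
  also have "\<dots> = (\<integral>\<^sup>+t. indicator {\<theta> - pi..\<theta> + pi} t * (G t * ennreal (1 / (norm (cis t - of_real r * cis \<theta>))^2)) \<partial>lborel)"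
    by (subst nn_integral_arc_meas) (auto simp: add.commute)
  also have "\<dots> \<le> (\<integral>\<^sup>+t. (\<Sum>j\<le>K. ennreal (4 * pi^2 / (rho j)^2) * (indicator {\<theta> - rho j..\<theta> + rho j} t * G t)) \<partial>lborel)"
  proof (rule nn_integral_mono)
    fix t
    show "indicator {\<theta> - pi..\<theta> + pi} t * (G t * ennreal (1 / (norm (cis t - of_real r * cis \<theta>))^2))
      \<le> (\<Sum>j\<le>K. ennreal (4 * pi^2 / (rho j)^2) * (indicator {\<theta> - rho j..\<theta> + rho j} t * G t))"
    proof (cases "\<bar>t - \<theta>\<bar> \<le> pi")
      case False
      then have "indicator {\<theta> - pi..\<theta> + pi} t = (0::ennreal)" by (auto simp: indicator_def)
      then show ?thesis by simp
    next
      case True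
      have "cis t - of_real r * cis \<theta> = cis \<theta> * (cis (t - \<theta>) - of_real r)"
        by (simp add: right_diff_distrib cis_mult)
      then have "norm (cis t - of_real r * cis \<theta>) = norm (cis (t - \<theta>) - of_real r)" by (simp add: norm_mult)
      then have "norm (cis t - of_real r * cis \<theta>) \<ge> max (1 - r) \<bar>t - \<theta>\<bar> / pi"
        using norm_cis_minus_real_ge[OF True r] by simp
      from dyadic_kernel_bound[OF K True this] r
      have "1 / (norm (cis t - of_real r * cis \<theta>))^2 \<le> (\<Sum>j\<le>K. 4 * pi^2 / (rho j)^2 * indicator {-rho j..rho j} (t - \<theta>))" by simp
      then have "ennreal (1 / (norm (cis t - of_real r * cis \<theta>))^2) \<le> ennreal (\<Sum>j\<le>K. 4 * pi^2 / (rho j)^2 * indicator {-rho j..rho j} (t - \<theta>))"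
        by (rule ennreal_leI)
      also have "\<dots> = (\<Sum>j\<le>K. ennreal (4 * pi^2 / (rho j)^2) * indicator {\<theta> - rho j..\<theta> + rho j} t)"
      proof -
        have "indicator {-rho j..rho j} (t - \<theta>) = (indicator {\<theta> - rho j..\<theta> + rho j} t :: real)" for j
          by (auto simp: indicator_def)
        moreover have "ennreal (4 * pi^2 / (rho j)^2 * indicator S t) = ennreal (4 * pi^2 / (rho j)^2) * indicator S t" for j S
          by (cases "t \<in> S") auto
        moreover have "0 \<le> 4 * pi^2 / (rho j)^2 * indicator S t" for j S
          by simp
        ultimately show ?thesis by (simp only: sum_ennreal[symmetric])
      qed
      finally have "indicator {\<theta> - pi..\<theta> + pi} t * (G t * ennreal (1 / (norm (cis t - of_real r * cis \<theta>))^2))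
        \<le> 1 * (G t * (\<Sum>j\<le>K. ennreal (4 * pi^2 / (rho j)^2) * indicator {\<theta> - rho j..\<theta> + rho j} t))"
        by (intro mult_mono) (auto simp: indicator_def)
      then show ?thesis by (simp only: sum_distrib_left mult_1 mult.assoc mult.commute mult.left_commute)
    qed
  qed
  also have "\<dots> = (\<Sum>j\<le>K. \<integral>\<^sup>+t. ennreal (4 * pi^2 / (rho j)^2) * (indicator {\<theta> - rho j..\<theta> + rho j} t * G t) \<partial>lborel)"
    by (rule nn_integral_sum) auto
  also have "\<dots> = (\<Sum>j\<le>K. ennreal (4 * pi^2 / (rho j)^2) * (\<integral>\<^sup>+t. G t \<partial>arc_meas (\<theta> - rho j) (\<theta> + rho j)))"
    by (intro sum.cong refl, subst nn_integral_cmult) (auto simp: nn_integral_arc_meas)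
  finally show ?thesis .
qed

lemma sum_inverse_rho_le: "(\<Sum>j\<le>K. 1 / rho j) \<le> 2 / rho K"
proof -
  have "(\<Sum>j\<le>K. (2::real) ^ j) = 2 ^ Suc K - 1"
    by (induction K) auto
  then have "(\<Sum>j\<le>K. (2::real) ^ j / pi) \<le> 2 * 2 ^ K / pi"
    by (subst sum_divide_distrib[symmetric]) (auto intro: divide_right_mono)
  then show ?thesis by (simp add: rho_def)
qed

text \<open>If all dyadic averages were small, the Poisson estimate would add up to at most (1+r)/2
  * L, which is no more than L. The constant 8 pi is the one for which the kernel factor 4 pi^2, the
  Poisson factor 1/(2 pi) and the geometric sum 2 / \<open>rho K\<close> combine to this
  value.\<close>

lemma large_value_large_average:
  assumes v: "v holomorphic_on ball 0 \<rho>" "\<rho> > 1" and r: "0 \<le> r" "r < 1" and lam: "L > 0"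
    and big: "norm (v (of_real r * cis \<theta>)) > L"
  shows "\<exists>j. ennreal (L * rho j) \<le> ennreal (8*pi) * (\<integral>\<^sup>+t. ennreal (norm (v (cis t))) \<partial>arc_meas (\<theta> - rho j) (\<theta> + rho j))"
proof (rule ccontr)
  assume neg: "\<not> ?thesis"
  define I where "I = (\<lambda>j. \<integral>\<^sup>+t. ennreal (norm (v (cis t))) \<partial>arc_meas (\<theta> - rho j) (\<theta> + rho j))"
  have small: "I j \<le> ennreal (L * rho j / (8*pi))" for j
  proof -
    have "ennreal (8*pi) * I j \<le> ennreal (L * rho j)" using neg unfolding I_def by (meson le_cases)
    then have "ennreal (1/(8*pi)) * (ennreal (8*pi) * I j) \<le> ennreal (1/(8*pi)) * ennreal (L * rho j)" by (intro mult_left_mono) auto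
    then show ?thesis
      by (simp add: mult.assoc[symmetric] ennreal_mult[symmetric] lam less_imp_le)
  qed
  define z where "z = of_real r * cis \<theta>"
  have nz: "norm z = r" using r by (simp add: z_def norm_mult)
  have [measurable]: "(\<lambda>t. v (cis t)) \<in> borel_measurable borel"
    by (intro borel_measurable_continuous_onI continuous_on_compose2[OF holomorphic_on_imp_continuous_on[OF v(1)]] continuous_intros) (use v in auto)
  have "1 - r > 0" "1 - r \<le> pi" using r pi_gt3 by auto
  then obtain K where K: "1 - r \<le> rho K" "rho K < 2 * (1 - r)" by (rule rho_scale_exists)
  have r2: "1 - r^2 \<ge> 0" using r by (simp add: power_le_one)
  have "ennreal (norm (v z)) \<le> (\<integral>\<^sup>+t. ennreal (norm (v (cis t)) * ((1 - (norm z)^2) / (2*pi * (norm (cis t - z))^2))) \<partial>arc_meas 0 (2*pi))"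
    by (rule norm_le_poisson[OF v]) (use nz r in auto)
  also have "\<dots> = (\<integral>\<^sup>+t. ennreal ((1 - r^2) / (2*pi)) * (ennreal (norm (v (cis t))) * ennreal (1 / (norm (cis t - of_real r * cis \<theta>))^2)) \<partial>arc_meas 0 (2*pi))"
    unfolding nz z_def[symmetric] using r2 by (intro nn_integral_cong) (auto simp: ennreal_mult[symmetric] mult.commute)
  also have "\<dots> = ennreal ((1 - r^2) / (2*pi)) * (\<integral>\<^sup>+t. ennreal (norm (v (cis t))) * ennreal (1 / (norm (cis t - of_real r * cis \<theta>))^2) \<partial>arc_meas 0 (2*pi))"
    using borel_measurable_circle_kernel[OF r, measurable] by (intro nn_integral_cmult) measurable
  also have "\<dots> \<le> ennreal ((1 - r^2) / (2*pi)) * (\<Sum>j\<le>K. ennreal (4 * pi^2 / (rho j)^2) * I j)"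
    unfolding I_def
    by (intro mult_left_mono nn_integral_kernel_le r K) (auto simp: cis_mult[symmetric])
  also have "\<dots> \<le> ennreal ((1 - r^2) / (2*pi)) * (\<Sum>j\<le>K. ennreal (4 * pi^2 / (rho j)^2) * ennreal (L * rho j / (8*pi)))"
    by (intro mult_left_mono sum_mono small) auto
  also have "\<dots> = ennreal ((1 - r^2) / (2*pi) * (\<Sum>j\<le>K. 4 * pi^2 / (rho j)^2 * (L * rho j / (8*pi))))"
    using lam r2 by (simp add: ennreal_mult[symmetric] sum_ennreal sum_nonneg)
  also have "\<dots> \<le> ennreal L"
  proof (rule ennreal_leI)
    have "(\<Sum>j\<le>K. 4 * pi^2 / (rho j)^2 * (L * rho j / (8*pi))) = L * pi / 2 * (\<Sum>j\<le>K. 1 / rho j)"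
      unfolding sum_distrib_left by (intro sum.cong refl) (simp add: power2_eq_square field_simps)
    also have "\<dots> \<le> L * pi / 2 * (2 / rho K)" using lam by (intro mult_left_mono sum_inverse_rho_le) auto
    also have "\<dots> \<le> L * pi / (1 - r)" using lam K(1) r by (auto intro!: divide_left_mono)
    finally have "(1 - r^2) / (2*pi) * (\<Sum>j\<le>K. 4 * pi^2 / (rho j)^2 * (L * rho j / (8*pi))) \<le> (1 - r^2) / (2*pi) * (L * pi / (1 - r))"
      using r2 by (intro mult_left_mono) auto
    also have "\<dots> = (1 + r) / 2 * L" using r by (simp add: power2_eq_square field_simps)
    also have "\<dots> \<le> 1 * L" using r lam by (intro mult_right_mono) auto
    finally show "(1 - r^2) / (2*pi) * (\<Sum>j\<le>K. 4 * pi^2 / (rho j)^2 * (L * rho j / (8*pi))) \<le> L" by simp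
  qed
  finally have "norm (v z) \<le> L" using lam by (simp add: ennreal_le_iff)
  then show False using big by (simp add: z_def)
qed

text \<open>Each point of E is the centre of an arc carrying a large average. Vitali's lemma selects
  disjoint arcs whose fivefold enlargements cover E. The constant is 8 pi for the averages, times 10
  for the length of an enlarged arc over its original radius, times 2 because the arcs may spread
  over two periods.\<close>

lemma maximal_weak_type:
  assumes v: "v holomorphic_on ball 0 \<rho>" "\<rho> > 1" and lam: "L > 0"
    and E: "E \<in> sets borel" "\<And>t. t \<in> E \<Longrightarrow> t \<in> {0..2*pi} \<and> (\<exists>r. 0 \<le> r \<and> r < 1 \<and> norm (v (of_real r * cis t)) > L)"
  shows "ennreal L * emeasure lborel E \<le> ennreal (160*pi) * (\<integral>\<^sup>+t. ennreal (norm (v (cis t))) \<partial>arc_meas 0 (2*pi))"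
proof -
  have [measurable]: "(\<lambda>t. v (cis t)) \<in> borel_measurable borel"
    by (intro borel_measurable_continuous_onI continuous_on_compose2[OF holomorphic_on_imp_continuous_on[OF v(1)]] continuous_intros) (use v in auto)
  define I where "I = (\<lambda>\<theta> j. \<integral>\<^sup>+t. ennreal (norm (v (cis t))) \<partial>arc_meas (\<theta> - rho j) (\<theta> + rho j))"
  have "\<exists>j. ennreal (L * rho j) \<le> ennreal (8*pi) * I \<theta> j" if "\<theta> \<in> E" for \<theta>
    using E(2)[OF that] large_value_large_average[OF v _ _ lam] unfolding I_def by blast
  then obtain J where J: "\<And>\<theta>. \<theta> \<in> E \<Longrightarrow> ennreal (L * rho (J \<theta>)) \<le> ennreal (8*pi) * I \<theta> (J \<theta>)" by metis
  obtain C where C: "countable C" "C \<subseteq> E"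
     "pairwise (\<lambda>i j. disjnt (cball i (rho (J i))) (cball j (rho (J j)))) C"
     "E \<subseteq> (\<Union>i\<in>C. cball i (5 * rho (J i)))"
    by (rule Vitali_covering_lemma_cballs[where S = E and K = E and a = "\<lambda>i. i" and r = "\<lambda>i. rho (J i)" and B = pi]) (auto simp: rho_le_pi intro!: bexI)
  \<comment> \<open>The countable family is indexed by a subset of the naturals and padded with
    empty sets, so that finite and infinite families are treated alike by countable
    additivity.\<close>
  define N where "N = to_nat_on C ` C"
  define a where "a = from_nat_into C"
  have aC: "a n \<in> C" if "n \<in> N" for n using that C(1) by (auto simp: N_def a_def)
  have aN: "\<exists>n\<in>N. a n = x" if "x \<in> C" for x using that C(1) by (auto simp: N_def a_def)
  have ainj: "m = n" if "m \<in> N" "n \<in> N" "a m = a n" for m n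
    using that C(1) by (auto simp: N_def a_def)
  define A where "A = (\<lambda>n. if n \<in> N then cball (a n) (rho (J (a n))) else {})"
  define B where "B = (\<lambda>n. if n \<in> N then cball (a n) (5 * rho (J (a n))) else {})"
  define w where "w = (\<lambda>t. ennreal (norm (v (cis t))))"
  have [measurable]: "w \<in> borel_measurable borel" unfolding w_def by measurable
  define \<nu> where "\<nu> = density lborel w"
  have [measurable]: "A n \<in> sets borel" "B n \<in> sets borel" for n by (auto simp: A_def B_def)
  have dis: "disjoint_family A"
  proof (unfold disjoint_family_on_def, intro ballI impI)
    fix m n :: nat assume mn: "m \<noteq> n"
    show "A m \<inter> A n = {}"
    proof (cases "m \<in> N \<and> n \<in> N")
      case True
      then have "a m \<noteq> a n" using ainj mn by blast
      then have "disjnt (cball (a m) (rho (J (a m)))) (cball (a n) (rho (J (a n))))"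
        using C(3) aC True unfolding pairwise_def by blast
      then show ?thesis using True by (simp add: A_def disjnt_def)
    qed (auto simp: A_def)
  qed
  have \<nu>: "emeasure \<nu> (A n) = (if n \<in> N then I (a n) (J (a n)) else 0)" for n
    unfolding \<nu>_def I_def A_def w_def[symmetric]
    by (subst emeasure_density) (auto simp: nn_integral_arc_meas cball_eq_atLeastAtMost mult.commute)
  have "E \<subseteq> (\<Union>n. B n)"
  proof
    fix x assume "x \<in> E"
    then obtain i where "i \<in> C" "x \<in> cball i (5 * rho (J i))" using C(4) by blast
    then show "x \<in> (\<Union>n. B n)" using aN[of i] by (auto simp: B_def)
  qed
  then have "emeasure lborel E \<le> emeasure lborel (\<Union>n. B n)" by (rule emeasure_mono) auto
  also have "\<dots> \<le> (\<Sum>n. emeasure lborel (B n))" by (rule emeasure_subadditive_countably) auto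
  finally have "ennreal L * emeasure lborel E \<le> ennreal L * (\<Sum>n. emeasure lborel (B n))"
    by (rule mult_left_mono) auto
  also have "\<dots> = (\<Sum>n. ennreal L * emeasure lborel (B n))" by (rule ennreal_suminf_cmult[symmetric])
  also have "\<dots> \<le> (\<Sum>n. ennreal (80*pi) * emeasure \<nu> (A n))"
  proof (intro suminf_le summableI)
    fix n
    show "ennreal L * emeasure lborel (B n) \<le> ennreal (80*pi) * emeasure \<nu> (A n)"
    proof (cases "n \<in> N")
      case True
      define R where "R = rho (J (a n))"
      have "emeasure lborel (B n) = ennreal (10 * R)"
        using True by (simp add: B_def R_def cball_eq_atLeastAtMost)
      then have "ennreal L * emeasure lborel (B n) = ennreal 10 * ennreal (L * R)"
        using lam by (simp add: ennreal_mult[symmetric] R_def mult_ac del: ennreal_numeral)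
      also have "\<dots> \<le> ennreal 10 * (ennreal (8*pi) * I (a n) (J (a n)))"
        unfolding R_def using J C(2) aC[OF True] by (intro mult_left_mono J) auto
      also have "\<dots> = ennreal (80*pi) * emeasure \<nu> (A n)"
        unfolding \<nu> using True by (simp add: mult.assoc[symmetric] ennreal_mult[symmetric] del: ennreal_numeral)
      finally show ?thesis .
    qed (simp add: B_def)
  qed
  also have "\<dots> = ennreal (80*pi) * emeasure \<nu> (\<Union>n. A n)"
    unfolding ennreal_suminf_cmult by (subst suminf_emeasure) (auto simp: \<nu>_def dis)
  \<comment> \<open>Centres lie in [0, 2 pi] and radii are at most pi, so all selected arcs fit into
    two consecutive periods.\<close>
  also have "emeasure \<nu> (\<Union>n. A n) \<le> emeasure \<nu> {-pi..3*pi}"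
  proof (rule emeasure_mono)
    show "(\<Union>n. A n) \<subseteq> {-pi..3*pi}"
    proof
      fix x assume "x \<in> (\<Union>n. A n)"
      then obtain n where n: "n \<in> N" "x \<in> cball (a n) (rho (J (a n)))" by (auto simp: A_def split: if_splits)
      have "a n \<in> {0..2*pi}" using E(2) C(2) aC[OF n(1)] by blast
      then show "x \<in> {-pi..3*pi}" using n(2) rho_le_pi[of "J (a n)"] by (auto simp: cball_eq_atLeastAtMost)
    qed
  qed (auto simp: \<nu>_def)
  also have "emeasure \<nu> {-pi..3*pi} = (\<integral>\<^sup>+t. w t \<partial>arc_meas (-pi) (3*pi))"
    unfolding \<nu>_def by (subst emeasure_density) (auto simp: nn_integral_arc_meas mult.commute)
  also have "\<dots> = (\<integral>\<^sup>+t. w t \<partial>arc_meas (-pi) (-pi + 2*pi)) + (\<integral>\<^sup>+t. w t \<partial>arc_meas pi (pi + 2*pi))"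
    by (subst nn_integral_arc_meas_split[of _ _ pi]) auto
  also have "\<dots> = ennreal 2 * (\<integral>\<^sup>+t. w t \<partial>arc_meas 0 (2*pi))"
  proof -
    have "(\<integral>\<^sup>+t. w t \<partial>arc_meas a (a + 2*pi)) = (\<integral>\<^sup>+t. w t \<partial>arc_meas 0 (2*pi))" for a
      by (rule nn_integral_arc_meas_periodic) (auto simp: w_def cis_mult[symmetric])
    then show ?thesis by (simp only: mult_2[symmetric]) simp
  qed
  finally have "ennreal L * emeasure lborel E \<le> ennreal (80*pi) * (ennreal 2 * (\<integral>\<^sup>+t. w t \<partial>arc_meas 0 (2*pi)))"
    by (simp add: mult_left_mono)
  also have "\<dots> = ennreal (160*pi) * (\<integral>\<^sup>+t. w t \<partial>arc_meas 0 (2*pi))"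
    by (simp add: mult.assoc[symmetric] ennreal_mult[symmetric] del: ennreal_numeral)
  finally show ?thesis unfolding w_def .
qed

subsection \<open>Factorization in H1\<close>

text \<open>With no zeros, u and k are both a holomorphic square root of v. Otherwise a zero is
  divided out with its full multiplicity and restored as a power of a Blaschke factor in u alone.
  Blaschke factors have modulus one on the circle, so |u|^2 = |k|^2 = |v| survives there.\<close>

lemma factor_finite_zeros:
  assumes "finite Z" "v holomorphic_on ball 0 \<rho>" "\<rho> > 1"
    "{z \<in> ball 0 \<rho>. v z = 0} = Z" "Z \<subseteq> ball 0 1"
  shows "\<exists>\<rho>' u k. 1 < \<rho>' \<and> \<rho>' \<le> \<rho> \<and> u holomorphic_on ball 0 \<rho>' \<and> k holomorphic_on ball 0 \<rho>' \<and>
    (\<forall>z \<in> ball 0 \<rho>'. v z = u z * k z) \<and> (\<forall>z. norm z = 1 \<longrightarrow> norm (u z) = norm (k z))"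
  using assms
proof (induction Z arbitrary: v \<rho> rule: finite_induct)
  case empty
  have "contractible (ball (0::complex) \<rho>)" by (intro convex_imp_contractible convex_ball)
  then obtain g where g: "g holomorphic_on ball 0 \<rho>" "\<And>z. z \<in> ball 0 \<rho> \<Longrightarrow> v z = g z ^ 2"
    using contractible_imp_holomorphic_sqrt[OF empty(1)] empty(3) by blast
  then show ?case using empty by (intro exI[of _ \<rho>] exI[of _ g]) (auto simp: power2_eq_square)
next
  case (insert a Z)
  note v = \<open>v holomorphic_on ball 0 \<rho>\<close>
  have a: "a \<in> ball 0 \<rho>" "v a = 0" "norm a < 1" using insert.prems by auto
  have nc: "\<not> v constant_on ball 0 \<rho>"
  proof
    assume "v constant_on ball 0 \<rho>"
    then have "v z = 0" if "z \<in> ball 0 \<rho>" for z using a that unfolding constant_on_def by metis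
    then have "ball (0::complex) \<rho> \<subseteq> insert a Z" using insert.prems by blast
    then have "finite (ball (0::complex) \<rho>)" using insert.hyps(1) finite_subset by blast
    then show False using insert.prems(2) uncountable_ball[of \<rho> "0::complex"] countable_finite by force
  qed
  obtain g r n where g: "0 < n" "0 < r" "ball a r \<subseteq> ball 0 \<rho>" "g holomorphic_on ball a r"
      "\<And>w. w \<in> ball a r \<Longrightarrow> v w = (w - a)^n * g w" "\<And>w. w \<in> ball a r \<Longrightarrow> g w \<noteq> 0"
    using holomorphic_factor_zero_nonconstant[OF v open_ball connected_ball a(1,2) nc] by metis
  define H where "H = (\<lambda>z. if z = a then g a else v z / (z - a)^n)"
  have "H holomorphic_on ball a r \<union> (ball 0 \<rho> - {a})"
  proof (rule holomorphic_on_Un)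
    show "H holomorphic_on ball a r"
      by (rule holomorphic_transform[OF g(4)]) (auto simp: H_def g(5))
    have "(\<lambda>z. v z / (z - a)^n) holomorphic_on (ball 0 \<rho> - {a})"
      by (intro holomorphic_intros holomorphic_on_subset[OF v]) auto
    then show "H holomorphic_on (ball 0 \<rho> - {a})"
      by (rule holomorphic_transform) (auto simp: H_def)
  qed auto
  then have H: "H holomorphic_on ball 0 \<rho>"
    by (rule holomorphic_on_subset) (use g(2) in auto)
  \<comment> \<open>The Blaschke factor of a has its pole at 1 / cnj a; the radius 2 / (1 + |a|)
    exceeds 1 and stays below the modulus of that pole.\<close>
  define \<rho>1 where "\<rho>1 = min \<rho> (2 / (1 + norm a))"
  have \<rho>1: "1 < \<rho>1" "\<rho>1 \<le> \<rho>" 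
  proof -
    have "0 < 1 + norm a" "1 + norm a < 2" using a(3) norm_ge_zero[of a] by linarith+
    then have "1 < 2 / (1 + norm a)" by (simp add: less_divide_eq)
    then show "1 < \<rho>1" "\<rho>1 \<le> \<rho>" using insert.prems(2) by (auto simp: \<rho>1_def)
  qed
  have nz: "1 - cnj a * z \<noteq> 0" if "z \<in> ball 0 \<rho>1" for z
  proof
    assume "1 - cnj a * z = 0"
    then have "norm a * norm z = 1" by (metis complex_mod_cnj eq_iff_diff_eq_0 norm_mult norm_one)
    moreover have "norm z < 2 / (1 + norm a)" using that by (simp add: \<rho>1_def)
    then have "norm a * norm z \<le> norm a * (2 / (1 + norm a))" by (intro mult_left_mono) auto
    moreover have "norm a * (2 / (1 + norm a)) < 1" 
    proof -
      have "0 < 1 + norm a" using norm_ge_zero[of a] by linarith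
      then show ?thesis using a(3) by (simp add: divide_less_eq)
    qed
    ultimately show False by simp
  qed
  \<comment> \<open>\<open>H\<close> is v with the zero at a removed; multiplying by the Blaschke
    denominator makes v equal to the Blaschke power times \<open>G\<close>, without adding zeros in
    the smaller disc.\<close>
  define G where "G = (\<lambda>z. H z * (1 - cnj a * z)^n)"
  have G: "G holomorphic_on ball 0 \<rho>1"
    unfolding G_def by (intro holomorphic_intros holomorphic_on_subset[OF H]) (use \<rho>1 in auto)
  have "{z \<in> ball 0 \<rho>1. G z = 0} = {z \<in> ball 0 \<rho>1. z \<noteq> a \<and> v z = 0}"
    using nz g(2,6) by (auto simp: G_def H_def)
  also have "\<dots> = Z"
  proof -
    have "z \<in> ball 0 \<rho>1 \<and> z \<noteq> a \<and> v z = 0 \<longleftrightarrow> z \<in> Z" for z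
    proof -
      have "z \<in> ball 0 \<rho> \<and> v z = 0 \<longleftrightarrow> z = a \<or> z \<in> Z" using insert.prems(3) by blast
      then show ?thesis using insert.prems(4) insert.hyps(2) \<rho>1 by fastforce
    qed
    then show ?thesis by blast
  qed
  finally obtain \<rho>' u k where uk: "1 < \<rho>'" "\<rho>' \<le> \<rho>1" "u holomorphic_on ball 0 \<rho>'" "k holomorphic_on ball 0 \<rho>'"
     "\<And>z. z \<in> ball 0 \<rho>' \<Longrightarrow> G z = u z * k z" "\<And>z. norm z = 1 \<Longrightarrow> norm (u z) = norm (k z)"
    using insert.IH[OF G \<rho>1(1)] insert.prems(4) by blast
  define B where "B = (\<lambda>z. ((z - a) / (1 - cnj a * z))^n)"
  have "(\<lambda>z. B z * u z) holomorphic_on ball 0 \<rho>'"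
    unfolding B_def by (intro holomorphic_intros uk(3)) (use nz uk(2) in auto)
  moreover have "v z = B z * u z * k z" if "z \<in> ball 0 \<rho>'" for z
  proof -
    have z: "z \<in> ball 0 \<rho>1" using that uk(2) by auto
    have "v z = B z * G z" using nz[OF z] a(2) g(1)
      by (auto simp: B_def G_def H_def power_divide)
    then show ?thesis using uk(5)[OF that] by simp
  qed
  moreover have "norm (B z * u z) = norm (k z)" if "norm z = 1" for z
  proof -
    have "norm (1 - cnj a * z) = norm (z - a)" by (rule norm_one_minus_cnj_mult[OF that])
    moreover have "z - a \<noteq> 0" using that a(3) by auto
    ultimately have "norm (B z) = 1" by (simp add: B_def norm_power norm_divide)
    then show ?thesis using uk(6)[OF that] by (simp add: norm_mult)
  qed
  ultimately show ?case using uk \<rho>1 by (intro exI[of _ \<rho>'] exI[of _ "\<lambda>z. B z * u z"] exI[of _ k]) auto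
qed

lemma factor_no_zeros_on_circle:
  assumes v: "v holomorphic_on ball 0 \<rho>" "\<rho> > 1" and nz: "\<And>z. norm z = 1 \<Longrightarrow> v z \<noteq> 0"
  shows "\<exists>\<rho>' u k. 1 < \<rho>' \<and> \<rho>' \<le> \<rho> \<and> u holomorphic_on ball 0 \<rho>' \<and> k holomorphic_on ball 0 \<rho>' \<and>
    (\<forall>z \<in> ball 0 \<rho>'. v z = u z * k z) \<and> (\<forall>z. norm z = 1 \<longrightarrow> norm (u z) = norm (k z))"
proof -
  define m where "m = (1 + \<rho>) / 2"
  have m: "1 < m" "m < \<rho>" using v(2) by (auto simp: m_def)
  have fin: "finite {z \<in> cball 0 m. v z = 0}"
  proof (cases "v constant_on ball 0 \<rho>")
    case True
    have "v z \<noteq> 0" if "z \<in> ball 0 \<rho>" for z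
    proof -
      have "1 \<in> ball (0::complex) \<rho>" using v(2) by simp
      then have "v z = v 1" using True that unfolding constant_on_def by metis
      then show ?thesis using nz[of 1] by simp
    qed
    then have "{z \<in> cball 0 m. v z = 0} = {}" using m by fastforce
    then show ?thesis by (metis finite.emptyI)
  next
    case False
    show ?thesis
      by (rule holomorphic_compact_finite_zeros[OF v(1) open_ball connected_ball compact_cball _ False]) (use m in auto)
  qed
  \<comment> \<open>The least modulus among the zeros outside the open disc, or m if there are none.
    It exceeds 1 because the circle carries no zeros, and within that radius only zeros of the open
    disc remain.\<close>
  define S where "S = insert m (norm ` ({z \<in> cball 0 m. v z = 0} - ball 0 1))"
  have S: "finite S" "S \<noteq> {}" using fin by (auto simp: S_def)
  have S1: "1 < s" if "s \<in> S" for s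
    using that m nz by (auto simp: S_def not_less order.order_iff_strict)
  define \<rho>2 where "\<rho>2 = Min S"
  have \<rho>2: "1 < \<rho>2" "\<rho>2 \<le> m" unfolding \<rho>2_def using S S1 by (auto simp: S_def intro!: Min_le)
  define Z where "Z = {z \<in> ball 0 \<rho>2. v z = 0}"
  have "Z \<subseteq> ball 0 1"
  proof
    fix z assume z: "z \<in> Z"
    show "z \<in> ball 0 1"
    proof (rule ccontr)
      assume "z \<notin> ball 0 1"
      then have "norm z \<in> S" using z \<rho>2 by (auto simp: Z_def S_def)
      then have "\<rho>2 \<le> norm z" unfolding \<rho>2_def using S by (intro Min_le)
      then show False using z by (simp add: Z_def)
    qed
  qed
  moreover have "finite Z" by (rule finite_subset[OF _ fin]) (use \<rho>2 in \<open>auto simp: Z_def\<close>)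
  moreover have "v holomorphic_on ball 0 \<rho>2" by (rule holomorphic_on_subset[OF v(1)]) (use \<rho>2 m in auto)
  ultimately have "\<exists>\<rho>' u k. 1 < \<rho>' \<and> \<rho>' \<le> \<rho>2 \<and> u holomorphic_on ball 0 \<rho>' \<and> k holomorphic_on ball 0 \<rho>' \<and>
    (\<forall>z \<in> ball 0 \<rho>'. v z = u z * k z) \<and> (\<forall>z. norm z = 1 \<longrightarrow> norm (u z) = norm (k z))"
    using factor_finite_zeros[of Z v \<rho>2] \<rho>2 by (simp add: Z_def)
  then show ?thesis using \<rho>2 m by (meson less_eq_real_def order_trans)
qed

text \<open>Replacing u by u(s z) with 1 < s < \<rho> moves the unit circle to radius 1/s, inside
  the disc where the increment inequality holds.\<close>

lemma circle_L2_mono_closed: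
  assumes u: "u holomorphic_on ball 0 \<rho>" "\<rho> > 1" and r: "0 \<le> r" "r < 1"
  shows "(\<integral>\<^sup>+t. ennreal ((norm (u (of_real r * cis t)))^2) \<partial>arc_meas 0 (2*pi))
    \<le> (\<integral>\<^sup>+t. ennreal ((norm (u (cis t)))^2) \<partial>arc_meas 0 (2*pi))"
proof -
  define s where "s = (1 + \<rho>) / 2"
  have s: "1 < s" "s < \<rho>" using u(2) by (auto simp: s_def)
  define w where "w = (\<lambda>z. u (of_real s * z))"
  have "(u \<circ> (\<lambda>z. of_real s * z)) holomorphic_on ball 0 1"
  proof (rule holomorphic_on_compose_gen[OF _ u(1)])
    show "(*) (complex_of_real s) ` ball 0 1 \<subseteq> ball 0 \<rho>"
    proof clarsimp
      fix z :: complex assume "norm z < 1"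
      then have "s * norm z < s * 1" using s by (intro mult_strict_left_mono) auto
      then have "s * norm z < \<rho>" using s(2) by linarith
      then show "norm (of_real s * z) < \<rho>" using s(1) by (simp add: norm_mult)
    qed
  qed (intro holomorphic_intros)
  then have w: "w holomorphic_on ball 0 1" by (simp add: w_def o_def)
  have wr: "w (of_real (x / s) * cis t) = u (of_real x * cis t)" for x t using s by (simp add: w_def)
  have "(\<integral>\<^sup>+t. ennreal ((norm (w (of_real (r/s) * cis t)))^2) \<partial>arc_meas 0 (2*pi))
      \<le> (\<integral>\<^sup>+t. ennreal ((norm (w (of_real (1/s) * cis t)))^2) \<partial>arc_meas 0 (2*pi))"
    using circle_L2_increment[OF w, of "r/s" "1/s"] r s
    by (intro order_trans[OF _ circle_L2_increment[OF w, of "r/s" "1/s"]]) (auto simp: divide_right_mono)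
  then show ?thesis unfolding wr by simp
qed

lemma nn_integral_limit_le:
  fixes f :: "nat \<Rightarrow> 'a \<Rightarrow> ennreal"
  assumes [measurable]: "\<And>i. f i \<in> borel_measurable M"
    and lim: "AE x in M. (\<lambda>i. f i x) \<longlonglongrightarrow> g x" and le: "\<And>i. (\<integral>\<^sup>+x. f i x \<partial>M) \<le> C"
  shows "(\<integral>\<^sup>+x. g x \<partial>M) \<le> C"
proof -
  have "(\<integral>\<^sup>+x. g x \<partial>M) = (\<integral>\<^sup>+x. liminf (\<lambda>i. f i x) \<partial>M)"
    by (rule nn_integral_cong_AE) (use lim in \<open>eventually_elim, simp add: lim_imp_Liminf\<close>)
  also have "\<dots> \<le> liminf (\<lambda>i. \<integral>\<^sup>+x. f i x \<partial>M)" by (rule nn_integral_liminf) measurable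
  also have "\<dots> \<le> C" by (rule Liminf_le) (use le in auto)
  finally show ?thesis .
qed

text \<open>The Poisson estimate is applied to the holomorphic function u^2. The kernel is bounded
  crudely, since the only purpose is local boundedness of a normal family.\<close>

lemma norm_le_circle_L2:
  assumes u: "u holomorphic_on ball 0 \<rho>" "\<rho> > 1" and z: "norm z < 1" and C0: "C \<ge> 0"
    and C: "(\<integral>\<^sup>+t. ennreal ((norm (u (cis t)))^2) \<partial>arc_meas 0 (2*pi)) \<le> ennreal C"
  shows "(norm (u z))^2 \<le> C / (1 - norm z)^2"
proof -
  have [measurable]: "(\<lambda>t. u (cis t)) \<in> borel_measurable borel"
    by (intro borel_measurable_continuous_onI continuous_on_compose2[OF holomorphic_on_imp_continuous_on[OF u(1)]] continuous_intros) (use u in auto)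
  have "(\<lambda>z. (u z)^2) holomorphic_on ball 0 \<rho>" by (intro holomorphic_intros u)
  from norm_le_poisson[OF this u(2) z]
  have "ennreal (norm ((u z)^2)) \<le> (\<integral>\<^sup>+t. ennreal (norm ((u (cis t))^2) * ((1 - (norm z)^2) / (2*pi * (norm (cis t - z))^2))) \<partial>arc_meas 0 (2*pi))" .
  also have "\<dots> \<le> (\<integral>\<^sup>+t. ennreal ((norm (u (cis t)))^2) * ennreal (1 / (1 - norm z)^2) \<partial>arc_meas 0 (2*pi))"
  proof (intro nn_integral_mono)
    fix t
    have "1 - norm z \<le> norm (cis t - z)" using norm_triangle_ineq2[of "cis t" z] by simp
    then have "(1 - norm z)^2 \<le> (norm (cis t - z))^2" using z by (intro power_mono) auto
    moreover have "1 * (norm (cis t - z))^2 \<le> 2*pi * (norm (cis t - z))^2"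
      using pi_gt3 by (intro mult_right_mono) auto
    ultimately have d: "(1 - norm z)^2 \<le> 2*pi * (norm (cis t - z))^2" by linarith
    have "(1 - (norm z)^2) / (2*pi * (norm (cis t - z))^2) \<le> 1 / (1 - norm z)^2"
    proof (rule frac_le)
      show "0 < (1 - norm z)^2" using z by simp
    qed (use d in auto)
    then have "norm ((u (cis t))^2) * ((1 - (norm z)^2) / (2*pi * (norm (cis t - z))^2)) \<le> (norm (u (cis t)))^2 * (1 / (1 - norm z)^2)"
      unfolding norm_power by (intro mult_left_mono) auto
    then show "ennreal (norm ((u (cis t))^2) * ((1 - (norm z)^2) / (2*pi * (norm (cis t - z))^2))) \<le> ennreal ((norm (u (cis t)))^2) * ennreal (1 / (1 - norm z)^2)"
      by (subst ennreal_mult[symmetric]) (auto intro: ennreal_leI)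
  qed
  also have "\<dots> = (\<integral>\<^sup>+t. ennreal ((norm (u (cis t)))^2) \<partial>arc_meas 0 (2*pi)) * ennreal (1 / (1 - norm z)^2)"
    by (rule nn_integral_multc) measurable
  also have "\<dots> \<le> ennreal C * ennreal (1 / (1 - norm z)^2)" by (intro mult_right_mono C) auto
  also have "\<dots> = ennreal (C / (1 - norm z)^2)" using C0 by (subst ennreal_mult[symmetric]) auto
  finally show ?thesis using C0 by (simp add: norm_power ennreal_le_iff)
qed

text \<open>The pointwise bound gives uniform boundedness on compact sets although the radii \<rho>
  j may shrink to 1; the L2 bound passes to the locally uniform limit by Fatou's lemma.\<close>

lemma Montel_circle_L2:
  assumes u: "\<And>j::nat. u j holomorphic_on ball 0 (\<rho> j)" "\<And>j. \<rho> j > 1" and C0: "C \<ge> 0"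
    and C: "\<And>j. (\<integral>\<^sup>+t. ennreal ((norm (u j (cis t)))^2) \<partial>arc_meas 0 (2*pi)) \<le> ennreal C"
  obtains g \<phi> where "g holomorphic_on ball 0 1" "strict_mono (\<phi> :: nat \<Rightarrow> nat)"
    "\<And>z. z \<in> ball 0 1 \<Longrightarrow> (\<lambda>j. u (\<phi> j) z) \<longlonglongrightarrow> g z"
    "\<And>r. 0 \<le> r \<Longrightarrow> r < 1 \<Longrightarrow> (\<integral>\<^sup>+t. ennreal ((norm (g (of_real r * cis t)))^2) \<partial>arc_meas 0 (2*pi)) \<le> ennreal C"
proof -
  have u1: "u j holomorphic_on ball 0 1" for j
    by (rule holomorphic_on_subset[OF u(1)]) (use u(2)[of j] in auto)
  have bounded: "\<exists>B. \<forall>h \<in> range u. \<forall>z \<in> K. norm (h z) \<le> B" if K: "compact K" "K \<subseteq> ball 0 1" for K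
  proof -
    obtain s where s: "s < 1" "\<And>z. z \<in> K \<Longrightarrow> norm z \<le> s"
    proof (cases "K = {}")
      case True then show ?thesis by (intro that[of 0]) auto
    next
      case False
      then obtain x where "x \<in> K" "\<And>z. z \<in> K \<Longrightarrow> norm z \<le> norm x"
        using continuous_attains_sup[OF K(1), of norm] by (auto intro: continuous_intros)
      then show ?thesis using K(2) by (intro that[of "norm x"]) auto
    qed
    have "norm (u j z) \<le> sqrt (C / (1 - s)^2)" if "z \<in> K" for j z
    proof (rule real_le_rsqrt)
      have z: "norm z < 1" using that s by force
      have "(norm (u j z))^2 \<le> C / (1 - norm z)^2" by (rule norm_le_circle_L2[OF u z C0 C])
      also have "\<dots> \<le> C / (1 - s)^2"
        using s that z C0 by (intro divide_left_mono power_mono mult_pos_pos zero_less_power) auto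
      finally show "(norm (u j z))^2 \<le> C / (1 - s)^2" .
    qed
    then show ?thesis by blast
  qed
  obtain g \<phi> where g: "g holomorphic_on ball 0 1" "strict_mono (\<phi> :: nat \<Rightarrow> nat)"
     "\<And>z. z \<in> ball 0 1 \<Longrightarrow> (\<lambda>j. u (\<phi> j) z) \<longlonglongrightarrow> g z"
    by (rule Montel[OF open_ball[of "0::complex" 1], of "range u" u]) (use u1 bounded in blast)+
  show thesis
  proof (rule that[OF g])
    fix r :: real assume r: "0 \<le> r" "r < 1"
    show "(\<integral>\<^sup>+t. ennreal ((norm (g (of_real r * cis t)))^2) \<partial>arc_meas 0 (2*pi)) \<le> ennreal C"
    proof (rule nn_integral_limit_le)
      have "(\<lambda>t. u (\<phi> i) (of_real r * cis t)) \<in> borel_measurable borel" for i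
        by (rule borel_measurable_circle[OF holomorphic_on_imp_continuous_on[OF u1] r])
      then show "(\<lambda>t. ennreal ((norm (u (\<phi> i) (of_real r * cis t)))^2)) \<in> borel_measurable (arc_meas 0 (2*pi))" for i
        by measurable
      show "AE t in arc_meas 0 (2*pi). (\<lambda>i. ennreal ((norm (u (\<phi> i) (of_real r * cis t)))^2)) \<longlonglongrightarrow> ennreal ((norm (g (of_real r * cis t)))^2)"
        using r by (intro AE_I2 tendsto_ennrealI tendsto_intros g(3)) (auto simp: norm_mult)
      show "(\<integral>\<^sup>+t. ennreal ((norm (u (\<phi> i) (of_real r * cis t)))^2) \<partial>arc_meas 0 (2*pi)) \<le> ennreal C" for i
        by (rule order_trans[OF circle_L2_mono_closed[OF u r] C])
    qed
  qed
qed

lemma hardy1_iff: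
  "f \<in> hardy1 \<longleftrightarrow> f holomorphic_on ball 0 1 \<and> (\<exists>C\<ge>0. \<forall>r. 0 \<le> r \<and> r < 1 \<longrightarrow>
      (\<integral>\<^sup>+t. ennreal (norm (f (of_real r * cis t))) \<partial>arc_meas 0 (2*pi)) \<le> ennreal C)"
proof -
  have *: "(\<integral>\<^sup>+t. ennreal (norm (f (of_real r * cis t))) \<partial>arc_meas 0 (2*pi))
      = (\<integral>\<^sup>+ t. indicator {0..2*pi} t * ennreal (norm (f (complex_of_real r * cis t))) \<partial>lborel)"
    if "f holomorphic_on ball 0 1" "0 \<le> r" "r < 1" for r
    using borel_measurable_circle[OF holomorphic_on_imp_continuous_on[OF that(1)] that(2,3)]
    by (intro nn_integral_arc_meas) measurable
  show ?thesis
  proof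
    assume f: "f \<in> hardy1"
    then obtain C where C: "f holomorphic_on ball 0 1" "\<And>r. 0 \<le> r \<Longrightarrow> r < 1 \<Longrightarrow>
        (\<integral>\<^sup>+ t. indicator {0..2*pi} t * ennreal (norm (f (complex_of_real r * cis t))) \<partial>lborel) \<le> ennreal C"
      unfolding hardy1_def by blast
    have "ennreal C \<le> ennreal (max C 0)" by (rule ennreal_leI) simp
    then show "f holomorphic_on ball 0 1 \<and> (\<exists>C\<ge>0. \<forall>r. 0 \<le> r \<and> r < 1 \<longrightarrow>
      (\<integral>\<^sup>+t. ennreal (norm (f (of_real r * cis t))) \<partial>arc_meas 0 (2*pi)) \<le> ennreal C)"
      using C(1) C(2)[THEN order_trans] *[OF C(1)] by (intro conjI exI[of _ "max C 0"]) auto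
  next
    assume "f holomorphic_on ball 0 1 \<and> (\<exists>C\<ge>0. \<forall>r. 0 \<le> r \<and> r < 1 \<longrightarrow>
      (\<integral>\<^sup>+t. ennreal (norm (f (of_real r * cis t))) \<partial>arc_meas 0 (2*pi)) \<le> ennreal C)"
    then show "f \<in> hardy1" using * unfolding hardy1_def by auto
  qed
qed

lemma fsigma_unit_disc: "fsigma (ball (0::complex) 1)"
proof -
  have "ball (0::complex) 1 = (\<Union>n. cball 0 (1 - 1 / real (Suc n)))"
  proof (intro equalityI subsetI)
    fix z :: complex assume "z \<in> ball 0 1"
    then obtain n where "inverse (real (Suc n)) < 1 - norm z"
      using reals_Archimedean[of "1 - norm z"] by auto
    then have "z \<in> cball 0 (1 - 1 / real (Suc n))" by (simp add: inverse_eq_divide)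
    then show "z \<in> (\<Union>n. cball 0 (1 - 1 / real (Suc n)))" by blast
  next
    fix z :: complex assume "z \<in> (\<Union>n. cball 0 (1 - 1 / real (Suc n)))"
    then obtain n where "norm z \<le> 1 - 1 / real (Suc n)" by auto
    moreover have "1 / real (Suc n) > 0" by simp
    ultimately show "z \<in> ball 0 1" unfolding mem_ball_0 by linarith
  qed
  then show ?thesis unfolding fsigma_Union_compact by (intro exI[of _ "\<lambda>n. cball 0 (1 - 1 / real (Suc n))"]) auto
qed

text \<open>The dilates h(R_j z) are holomorphic beyond the closed disc and can be factored there
  with |u_j|^2 = |k_j|^2 = |h(R_j z)| on the circle, so the H1 bound of h is an L2 bound of both
  factors. Normal families along nested subsequences then produce the factors of h.\<close>

lemma hardy1_factor:
  assumes "h \<in> hardy1"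
  obtains u k C where "u holomorphic_on ball 0 1" "k holomorphic_on ball 0 1" "C \<ge> 0"
    "\<And>z. z \<in> ball 0 1 \<Longrightarrow> h z = u z * k z"
    "\<And>r. 0 \<le> r \<Longrightarrow> r < 1 \<Longrightarrow> (\<integral>\<^sup>+t. ennreal ((norm (u (of_real r * cis t)))^2) \<partial>arc_meas 0 (2*pi)) \<le> ennreal C"
    "\<And>r. 0 \<le> r \<Longrightarrow> r < 1 \<Longrightarrow> (\<integral>\<^sup>+t. ennreal ((norm (k (of_real r * cis t)))^2) \<partial>arc_meas 0 (2*pi)) \<le> ennreal C"
proof (cases "\<forall>z \<in> ball 0 1. h z = 0")
  case True
  then show ?thesis by (intro that[of "\<lambda>_. 0" "\<lambda>_. 0" 0]) auto
next
  case False
  obtain C where h: "h holomorphic_on ball 0 1" and C: "C \<ge> 0" "\<And>r. 0 \<le> r \<Longrightarrow> r < 1 \<Longrightarrow>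
      (\<integral>\<^sup>+t. ennreal (norm (h (of_real r * cis t))) \<partial>arc_meas 0 (2*pi)) \<le> ennreal C"
    using assms unfolding hardy1_iff by blast
  have cz: "countable {z \<in> ball 0 1. h z = 0}"
  proof (cases "h constant_on ball 0 1")
    case True
    then have "{z \<in> ball 0 1. h z = 0} = {}" using False unfolding constant_on_def by auto
    then show ?thesis by (metis countable_empty)
  next
    case nc: False
    show ?thesis
      by (rule holomorphic_countable_zeros[OF h open_ball connected_ball _ nc]) (rule fsigma_unit_disc)
  qed
  have "\<exists>R. 1 - 1 / (real j + 2) < R \<and> R < 1 \<and> (\<forall>z. norm z = R \<longrightarrow> h z \<noteq> 0)" for j
  proof -
    \<comment> \<open>The zeros have countably many moduli and the interval is uncountable, so a
      radius close to 1 with no zero on its circle exists.\<close>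
    have "\<not> {1 - 1 / (real j + 2) <..< 1} \<subseteq> norm ` {z \<in> ball 0 1. h z = 0}"
      using countable_subset[OF _ countable_image[OF cz]] uncountable_open_interval[of "1 - 1 / (real j + 2)" 1] by auto
    then obtain R where "1 - 1 / (real j + 2) < R" "R < 1" "R \<notin> norm ` {z \<in> ball 0 1. h z = 0}"
      unfolding subset_iff greaterThanLessThan_iff by blast
    then show ?thesis by (intro exI[of _ R]) auto
  qed
  then obtain R where R: "\<And>j. 1 - 1 / (real j + 2) < R j" "\<And>j. R j < 1" "\<And>j z. norm z = R j \<Longrightarrow> h z \<noteq> 0" by metis
  have R0: "R j > 0" for j
  proof -
    have "1 / (real j + 2) \<le> 1" by simp
    then show ?thesis using R(1)[of j] by linarith
  qed
  have Rlim: "R \<longlonglongrightarrow> 1"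
  proof (rule tendsto_sandwich)
    show "(\<lambda>j. 1 - 1 / (real j + 2)) \<longlonglongrightarrow> 1" by real_asymp
    show "\<forall>\<^sub>F j in sequentially. 1 - 1 / (real j + 2) \<le> R j" "\<forall>\<^sub>F j in sequentially. R j \<le> 1"
      using R(1,2) by (auto intro!: always_eventually less_imp_le)
  qed (rule tendsto_const)
  define v where "v = (\<lambda>j z. h (of_real (R j) * z))"
  have v: "v j holomorphic_on ball 0 (1 / R j)" "1 / R j > 1" for j
  proof -
    have "(h \<circ> (\<lambda>z. of_real (R j) * z)) holomorphic_on ball 0 (1 / R j)"
    proof (rule holomorphic_on_compose_gen[OF _ h])
      show "(*) (complex_of_real (R j)) ` ball 0 (1 / R j) \<subseteq> ball 0 1"
        using R0[of j] by (auto simp: norm_mult field_simps)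
    qed (intro holomorphic_intros)
    then show "v j holomorphic_on ball 0 (1 / R j)" by (simp add: v_def o_def)
    show "1 / R j > 1" using R0[of j] R(2)[of j] by simp
  qed
  have "\<exists>\<rho>' u k. 1 < \<rho>' \<and> \<rho>' \<le> 1 / R j \<and> u holomorphic_on ball 0 \<rho>' \<and> k holomorphic_on ball 0 \<rho>' \<and>
    (\<forall>z \<in> ball 0 \<rho>'. v j z = u z * k z) \<and> (\<forall>z. norm z = 1 \<longrightarrow> norm (u z) = norm (k z))" for j
    by (rule factor_no_zeros_on_circle[OF v]) (use R(3) R0[of j] in \<open>auto simp: v_def norm_mult\<close>)
  then obtain \<rho> u k where uk: "\<And>j. 1 < \<rho> j" "\<And>j. u j holomorphic_on ball 0 (\<rho> j)" "\<And>j. k j holomorphic_on ball 0 (\<rho> j)"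
    "\<And>j z. z \<in> ball 0 (\<rho> j) \<Longrightarrow> v j z = u j z * k j z" "\<And>j z. norm z = 1 \<Longrightarrow> norm (u j z) = norm (k j z)" by metis
  have nu: "(norm (u j (cis t)))^2 = norm (h (of_real (R j) * cis t))" "(norm (k j (cis t)))^2 = norm (h (of_real (R j) * cis t))" for j t
    using uk(4)[of "cis t" j] uk(5)[of "cis t" j] uk(1)[of j] by (auto simp: v_def norm_mult power2_eq_square)
  have Cu: "(\<integral>\<^sup>+t. ennreal ((norm (u j (cis t)))^2) \<partial>arc_meas 0 (2*pi)) \<le> ennreal C"
    and Ck: "(\<integral>\<^sup>+t. ennreal ((norm (k j (cis t)))^2) \<partial>arc_meas 0 (2*pi)) \<le> ennreal C" for j
    unfolding nu by (rule C(2); use R0[of j] R(2)[of j] in simp)+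
  obtain U \<phi> where U: "U holomorphic_on ball 0 1" "strict_mono \<phi>" "\<And>z. z \<in> ball 0 1 \<Longrightarrow> (\<lambda>j. u (\<phi> j) z) \<longlonglongrightarrow> U z"
      "\<And>r. 0 \<le> r \<Longrightarrow> r < 1 \<Longrightarrow> (\<integral>\<^sup>+t. ennreal ((norm (U (of_real r * cis t)))^2) \<partial>arc_meas 0 (2*pi)) \<le> ennreal C"
    by (rule Montel_circle_L2[of u \<rho> C, OF uk(2,1) C(1) Cu]) (rule that)
  obtain V \<psi> where V: "V holomorphic_on ball 0 1" "strict_mono \<psi>" "\<And>z. z \<in> ball 0 1 \<Longrightarrow> (\<lambda>j. k (\<phi> (\<psi> j)) z) \<longlonglongrightarrow> V z"
      "\<And>r. 0 \<le> r \<Longrightarrow> r < 1 \<Longrightarrow> (\<integral>\<^sup>+t. ennreal ((norm (V (of_real r * cis t)))^2) \<partial>arc_meas 0 (2*pi)) \<le> ennreal C"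
    by (rule Montel_circle_L2[of "\<lambda>j. k (\<phi> j)" "\<lambda>j. \<rho> (\<phi> j)" C, OF uk(3,1) C(1) Ck]) (rule that)
  have "h z = U z * V z" if z: "z \<in> ball 0 1" for z
  proof -
    have 1: "(\<lambda>j. u (\<phi> (\<psi> j)) z * k (\<phi> (\<psi> j)) z) \<longlonglongrightarrow> U z * V z"
      using LIMSEQ_subseq_LIMSEQ[OF U(3)[OF z] V(2)] V(3)[OF z] by (intro tendsto_mult) (auto simp: o_def)
    have "u j z * k j z = h (of_real (R j) * z)" for j
      using uk(4)[of z j] uk(1)[of j] z by (simp add: v_def)
    then have 2: "(\<lambda>j. h (of_real (R (\<phi> (\<psi> j))) * z)) \<longlonglongrightarrow> U z * V z" using 1 by simp
    have "(\<lambda>j. R (\<phi> (\<psi> j))) \<longlonglongrightarrow> 1"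
      using LIMSEQ_subseq_LIMSEQ[OF LIMSEQ_subseq_LIMSEQ[OF Rlim U(2)] V(2)] by (simp add: o_def)
    then have "(\<lambda>j. complex_of_real (R (\<phi> (\<psi> j))) * z) \<longlonglongrightarrow> of_real 1 * z" by (intro tendsto_intros)
    moreover have "isCont h z" using holomorphic_on_imp_continuous_on[OF h] z by (simp add: continuous_on_eq_continuous_at)
    ultimately have "(\<lambda>j. h (of_real (R (\<phi> (\<psi> j))) * z)) \<longlonglongrightarrow> h z"
      using isCont_tendsto_compose[of z h] by simp
    then show ?thesis using 2 LIMSEQ_unique by blast
  qed
  then show ?thesis using U V C(1) by (intro that[of U V C])
qed

subsection \<open>Boundary values in H1\<close>

text \<open>By the increment inequality, the squared distance of two dilates is at most the growth
  of their squared norms. Beyond a radius where the norm is within \<delta> of its supremum A, at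
  most \<delta> of growth is left.\<close>

lemma circle_L2_Cauchy:
  assumes u: "u holomorphic_on ball 0 1" and C: "C \<ge> 0" "\<And>r. 0 \<le> r \<Longrightarrow> r < 1 \<Longrightarrow>
      (\<integral>\<^sup>+t. ennreal ((norm (u (of_real r * cis t)))^2) \<partial>arc_meas 0 (2*pi)) \<le> ennreal C"
    and \<delta>: "\<delta> > 0"
  obtains s0 where "0 \<le> s0" "s0 < 1" "\<And>s r. s0 \<le> s \<Longrightarrow> s \<le> r \<Longrightarrow> r < 1 \<Longrightarrow>
     (\<integral>\<^sup>+t. ennreal ((norm (u (of_real r * cis t) - u (of_real s * cis t)))^2) \<partial>arc_meas 0 (2*pi)) \<le> ennreal \<delta>"
proof -
  define S where "S = (\<lambda>r. \<integral>\<^sup>+t. ennreal ((norm (u (of_real r * cis t)))^2) \<partial>arc_meas 0 (2*pi))"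
  define A where "A = (SUP r\<in>{0..<1}. S r)"
  have SC: "S r \<le> ennreal C" if "0 \<le> r" "r < 1" for r unfolding S_def by (rule C(2)[OF that])
  have "A \<le> ennreal C" unfolding A_def by (rule SUP_least) (use SC in auto)
  then have Afin: "A < top" using order_le_less_trans by fastforce
  have "\<exists>r\<in>{0..<1}. A \<le> S r + ennreal \<delta>"
  \<comment> \<open>Subtraction in \<open>ennreal\<close> is truncated at 0, so A - \<delta> < A is
    available only for A > 0.\<close>
  proof (cases "A = 0")
    case True then show ?thesis by (intro bexI[of _ 0]) auto
  next
    case False
    then have "A - ennreal \<delta> < A" using Afin \<delta> by (intro ennreal_between) (auto simp: zero_less_iff_neq_zero)
    then obtain r where r: "r \<in> {0..<1}" "A - ennreal \<delta> < S r"
      using less_SUP_iff[of "A - ennreal \<delta>" S "{0..<1}"] by (auto simp: A_def)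
    then have "A \<le> S r + ennreal \<delta>" using less_imp_le[OF r(2)] by (simp add: ennreal_minus_le_iff add.commute)
    then show ?thesis using r(1) by blast
  qed
  then obtain s0 where s0: "0 \<le> s0" "s0 < 1" "A \<le> S s0 + ennreal \<delta>" by auto
  show thesis
  proof (rule that[OF s0(1,2)])
    fix s r assume sr: "s0 \<le> s" "s \<le> r" "r < (1::real)"
    define D where "D = (\<lambda>r s. \<integral>\<^sup>+t. ennreal ((norm (u (of_real r * cis t) - u (of_real s * cis t)))^2) \<partial>arc_meas 0 (2*pi))"
    have inc: "D r s + S s \<le> S r" if "0 \<le> s" "s \<le> r" "r < 1" for r s
      unfolding D_def S_def by (rule circle_L2_increment[OF u that])
    have "S s0 \<le> S s" using inc[of s0 s] s0 sr by (auto intro: order_trans[rotated])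
    have "D r s + S s \<le> S r" using inc sr s0 by auto
    also have "\<dots> \<le> A" unfolding A_def using sr s0 by (intro SUP_upper) auto
    also have "\<dots> \<le> S s + ennreal \<delta>" using s0(3) \<open>S s0 \<le> S s\<close> by (auto intro: order_trans add_right_mono)
    finally have "S s + D r s \<le> S s + ennreal \<delta>" by (simp add: add.commute)
    moreover have "S s \<noteq> top" using SC[of s] sr s0 by (auto simp: top_unique)
    ultimately have "D r s \<le> ennreal \<delta>" by (simp add: ennreal_add_left_cancel_le)
    then show "(\<integral>\<^sup>+t. ennreal ((norm (u (of_real r * cis t) - u (of_real s * cis t)))^2) \<partial>arc_meas 0 (2*pi)) \<le> ennreal \<delta>"
      by (simp add: D_def)
  qed
qed

lemma ennreal_le_sqrt:
  assumes "x^2 \<le> ennreal c" "c \<ge> 0" shows "x \<le> ennreal (sqrt c)"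
proof (cases x)
  case (real y)
  then have "ennreal (y^2) \<le> ennreal c" using assms by (simp add: ennreal_power)
  then have "y^2 \<le> c" using assms(2) by (simp add: ennreal_le_iff)
  then show ?thesis using real by (auto intro!: ennreal_leI real_le_rsqrt)
next
  case top
  then show ?thesis using assms by (simp add: power2_eq_square ennreal_top_mult top_unique)
qed

lemma nn_integral_mult_le_sqrt:
  assumes [measurable]: "f \<in> borel_measurable M" "g \<in> borel_measurable M"
    and f: "(\<integral>\<^sup>+x. ennreal ((norm (f x :: complex))^2) \<partial>M) \<le> ennreal a"
    and g: "(\<integral>\<^sup>+x. ennreal ((norm (g x :: complex))^2) \<partial>M) \<le> ennreal b" and ab: "a \<ge> 0" "b \<ge> 0"
  shows "(\<integral>\<^sup>+x. ennreal (norm (f x * g x)) \<partial>M) \<le> ennreal (sqrt (a * b))"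
proof (rule ennreal_le_sqrt)
  have "(\<integral>\<^sup>+x. ennreal (norm (f x * g x)) \<partial>M)^2 = (\<integral>\<^sup>+x. ennreal (norm (f x)) * ennreal (norm (g x)) \<partial>M)^2"
    by (simp add: norm_mult ennreal_mult)
  also have "\<dots> \<le> (\<integral>\<^sup>+x. ennreal (norm (f x)) ^ 2 \<partial>M) * (\<integral>\<^sup>+x. ennreal (norm (g x)) ^ 2 \<partial>M)"
    by (rule Cauchy_Schwarz_nn_integral) measurable
  also have "\<dots> \<le> ennreal a * ennreal b"
    using f g by (intro mult_mono) (auto simp: ennreal_power)
  also have "\<dots> = ennreal (a * b)" using ab by (simp add: ennreal_mult)
  finally show "(\<integral>\<^sup>+x. ennreal (norm (f x * g x)) \<partial>M)^2 \<le> ennreal (a * b)" .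
qed (use ab in simp)

text \<open>With h = u k, the difference of two dilates is (difference of u) * k + u * (difference
  of k); Cauchy--Schwarz and the L2 Cauchy property of the factors bound each summand.\<close>

lemma hardy1_L1_Cauchy:
  assumes h: "h \<in> hardy1" and e: "e > 0"
  obtains s0 where "0 \<le> s0" "s0 < 1" "\<And>s r. s0 \<le> s \<Longrightarrow> s \<le> r \<Longrightarrow> r < 1 \<Longrightarrow>
     (\<integral>\<^sup>+t. ennreal (norm (h (of_real r * cis t) - h (of_real s * cis t))) \<partial>arc_meas 0 (2*pi)) \<le> ennreal e"
proof -
  obtain u k C where uk: "u holomorphic_on ball 0 1" "k holomorphic_on ball 0 1" "C \<ge> 0"
    "\<And>z. z \<in> ball 0 1 \<Longrightarrow> h z = u z * k z"
    and Cu: "\<And>r. 0 \<le> r \<Longrightarrow> r < 1 \<Longrightarrow> (\<integral>\<^sup>+t. ennreal ((norm (u (of_real r * cis t)))^2) \<partial>arc_meas 0 (2*pi)) \<le> ennreal C"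
    and Ck: "\<And>r. 0 \<le> r \<Longrightarrow> r < 1 \<Longrightarrow> (\<integral>\<^sup>+t. ennreal ((norm (k (of_real r * cis t)))^2) \<partial>arc_meas 0 (2*pi)) \<le> ennreal C"
    by (rule hardy1_factor[OF h]) (rule that)
  \<comment> \<open>Chosen so that sqrt (\<delta> C) is at most e/2; the summand 1 keeps the
    denominator positive when C = 0.\<close>
  define \<delta> where "\<delta> = e^2 / (4 * (C + 1))"
  have \<delta>: "\<delta> > 0" "\<delta> \<ge> 0" using e uk(3) by (auto simp: \<delta>_def)
  obtain s1 where s1: "0 \<le> s1" "s1 < 1" "\<And>s r. s1 \<le> s \<Longrightarrow> s \<le> r \<Longrightarrow> r < 1 \<Longrightarrow>
     (\<integral>\<^sup>+t. ennreal ((norm (u (of_real r * cis t) - u (of_real s * cis t)))^2) \<partial>arc_meas 0 (2*pi)) \<le> ennreal \<delta>"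
    by (rule circle_L2_Cauchy[OF uk(1,3) Cu \<delta>(1)]; (assumption | rule that))
  obtain s2 where s2: "0 \<le> s2" "s2 < 1" "\<And>s r. s2 \<le> s \<Longrightarrow> s \<le> r \<Longrightarrow> r < 1 \<Longrightarrow>
     (\<integral>\<^sup>+t. ennreal ((norm (k (of_real r * cis t) - k (of_real s * cis t)))^2) \<partial>arc_meas 0 (2*pi)) \<le> ennreal \<delta>"
    by (rule circle_L2_Cauchy[OF uk(2,3) Ck \<delta>(1)]; (assumption | rule that))
  have sq: "sqrt (\<delta> * C) \<le> e / 2"
  proof (rule real_le_lsqrt)
    have "\<delta> * C = e^2 / 4 * (C / (C + 1))" using uk(3) by (simp add: \<delta>_def field_simps)
    also have "\<dots> \<le> e^2 / 4 * 1" using uk(3) by (intro mult_left_mono) auto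
    finally show "\<delta> * C \<le> (e/2)^2" by (simp add: power_divide)
  qed (use e \<delta> uk(3) in auto)
  show thesis
  proof (rule that[of "max s1 s2"])
    fix s r assume sr: "max s1 s2 \<le> s" "s \<le> r" "r < (1::real)"
    have s01: "0 \<le> s" "s < 1" "0 \<le> r" using sr s1 by auto
    note m = borel_measurable_circle[OF holomorphic_on_imp_continuous_on[OF uk(1)]] borel_measurable_circle[OF holomorphic_on_imp_continuous_on[OF uk(2)]]
    note [measurable] = m(1)[OF s01(3) sr(3)] m(2)[OF s01(3) sr(3)] m(1)[OF s01(1,2)] m(2)[OF s01(1,2)]
    have "(\<integral>\<^sup>+t. ennreal (norm (h (of_real r * cis t) - h (of_real s * cis t))) \<partial>arc_meas 0 (2*pi))
      \<le> (\<integral>\<^sup>+t. ennreal (norm ((u (of_real r * cis t) - u (of_real s * cis t)) * k (of_real r * cis t)))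
            + ennreal (norm (u (of_real s * cis t) * (k (of_real r * cis t) - k (of_real s * cis t)))) \<partial>arc_meas 0 (2*pi))"
    proof (rule nn_integral_mono)
      fix t
      have "h (of_real r * cis t) - h (of_real s * cis t) = (u (of_real r * cis t) - u (of_real s * cis t)) * k (of_real r * cis t)
          + u (of_real s * cis t) * (k (of_real r * cis t) - k (of_real s * cis t))"
        using uk(4)[of "of_real r * cis t"] uk(4)[of "of_real s * cis t"] s01 sr by (simp add: norm_mult algebra_simps)
      then have "norm (h (of_real r * cis t) - h (of_real s * cis t)) \<le> norm ((u (of_real r * cis t) - u (of_real s * cis t)) * k (of_real r * cis t))
          + norm (u (of_real s * cis t) * (k (of_real r * cis t) - k (of_real s * cis t)))"
        by (metis norm_triangle_ineq)
      then show "ennreal (norm (h (of_real r * cis t) - h (of_real s * cis t))) \<le> ennreal (norm ((u (of_real r * cis t) - u (of_real s * cis t)) * k (of_real r * cis t)))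
          + ennreal (norm (u (of_real s * cis t) * (k (of_real r * cis t) - k (of_real s * cis t))))"
        by (subst ennreal_plus[symmetric]) (auto intro!: ennreal_leI simp del: ennreal_plus)
    qed
    also have "\<dots> = (\<integral>\<^sup>+t. ennreal (norm ((u (of_real r * cis t) - u (of_real s * cis t)) * k (of_real r * cis t))) \<partial>arc_meas 0 (2*pi))
            + (\<integral>\<^sup>+t. ennreal (norm (u (of_real s * cis t) * (k (of_real r * cis t) - k (of_real s * cis t)))) \<partial>arc_meas 0 (2*pi))"
      by (rule nn_integral_add) measurable
    also have "\<dots> \<le> ennreal (sqrt (\<delta> * C)) + ennreal (sqrt (C * \<delta>))"
      using sr s01 by (intro add_mono nn_integral_mult_le_sqrt s1 s2 Cu Ck \<delta> uk(3)) auto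
    also have "\<dots> \<le> ennreal (e/2) + ennreal (e/2)"
      using sq by (intro add_mono ennreal_leI) (auto simp: mult.commute)
    also have "\<dots> = ennreal e" using e by (subst ennreal_plus[symmetric]) auto
    finally show "(\<integral>\<^sup>+t. ennreal (norm (h (of_real r * cis t) - h (of_real s * cis t))) \<partial>arc_meas 0 (2*pi)) \<le> ennreal e" .
  qed (use s1 s2 in auto)
qed

text \<open>A Cauchy criterion with two natural-number quantifiers, so that the set of angles with a
  radial limit is built by countable set operations. The offset 2 keeps all radii in the window at
  least 1/2.\<close>

lemma at_left_limit_iff_Cauchy:
  fixes f :: "real \<Rightarrow> complex"
  shows "(\<exists>l. (f \<longlongrightarrow> l) (at_left 1)) \<longleftrightarrow>
    (\<forall>m::nat. \<exists>n::nat. \<forall>r r'. 1 - 1 / real (n + 2) \<le> r \<and> r < 1 \<and> 1 - 1 / real (n + 2) \<le> r' \<and> r' < 1 \<longrightarrow> norm (f r - f r') \<le> 1 / real (m + 1))"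
    (is "?L \<longleftrightarrow> ?R")
proof
  assume ?L
  then obtain l where l: "(f \<longlongrightarrow> l) (at_left 1)" by blast
  show ?R
  proof
    fix m :: nat
    have "eventually (\<lambda>r. dist (f r) l < 1 / real (m + 1) / 2) (at_left 1)"
      by (rule tendstoD[OF l]) simp
    then obtain b where b: "b < 1" "\<And>r. b < r \<Longrightarrow> r < 1 \<Longrightarrow> dist (f r) l < 1 / real (m + 1) / 2"
      unfolding eventually_at_left_field by blast
    obtain n where n: "inverse (real (Suc n)) < 1 - b" using reals_Archimedean[of "1 - b"] b(1) by auto
    have "1 / real (n + 2) \<le> inverse (real (Suc n))" by (simp add: inverse_eq_divide frac_le)
    then have n': "b < 1 - 1 / real (n + 2)" using n by linarith
    show "\<exists>n::nat. \<forall>r r'. 1 - 1 / real (n + 2) \<le> r \<and> r < 1 \<and> 1 - 1 / real (n + 2) \<le> r' \<and> r' < 1 \<longrightarrow> norm (f r - f r') \<le> 1 / real (m + 1)"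
    proof (intro exI[of _ n] allI impI)
      fix r r' assume "1 - 1 / real (n + 2) \<le> r \<and> r < 1 \<and> 1 - 1 / real (n + 2) \<le> r' \<and> r' < 1"
      then have "dist (f r) l < 1 / real (m + 1) / 2" "dist (f r') l < 1 / real (m + 1) / 2" using b(2) n' by force+
      moreover have "norm (f r - f r') \<le> dist (f r) l + dist (f r') l"
        using dist_triangle2[of "f r" "f r'" l] by (simp add: dist_norm)
      ultimately show "norm (f r - f r') \<le> 1 / real (m + 1)" by linarith
    qed
  qed
next
  assume R: ?R
  define X where "X = (\<lambda>j::nat. f (1 - 1 / real (j + 2)))"
  have key: "\<exists>n. \<forall>j\<ge>n. \<forall>r. 1 - 1 / real (n + 2) \<le> r \<and> r < 1 \<longrightarrow> norm (X j - f r) < e" if e: "e > 0" for e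
  proof -
    obtain m where m: "inverse (real (Suc m)) < e" using reals_Archimedean[OF e] by auto
    obtain n where n: "\<And>r r'. 1 - 1 / real (n + 2) \<le> r \<and> r < 1 \<and> 1 - 1 / real (n + 2) \<le> r' \<and> r' < 1 \<Longrightarrow> norm (f r - f r') \<le> 1 / real (m + 1)"
      using R by blast
    have "norm (X j - f r) < e" if "j \<ge> n" "1 - 1 / real (n + 2) \<le> r" "r < 1" for j r
    proof -
      have "1 / real (j + 2) \<le> 1 / real (n + 2)" "1 / real (j + 2) > 0" using that by (auto intro!: divide_left_mono)
      then have "norm (X j - f r) \<le> 1 / real (m + 1)" unfolding X_def using that by (intro n) auto
      then show ?thesis using m by (simp add: inverse_eq_divide add.commute)
    qed
    then show ?thesis by blast
  qed
  have "Cauchy X"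
  proof (rule CauchyI)
    fix e :: real assume "e > 0"
    then obtain n where n: "\<And>j r. j \<ge> n \<Longrightarrow> 1 - 1 / real (n + 2) \<le> r \<Longrightarrow> r < 1 \<Longrightarrow> norm (X j - f r) < e" using key by blast
    have "norm (X j - X i) < e" if "j \<ge> n" "i \<ge> n" for i j
    proof -
      have "1 / real (i + 2) \<le> 1 / real (n + 2)" "1 / real (i + 2) > 0" using that by (auto intro!: divide_left_mono)
      then show ?thesis using n[OF that(1), of "1 - 1 / real (i + 2)"] by (simp add: X_def)
    qed
    then show "\<exists>M. \<forall>m\<ge>M. \<forall>n\<ge>M. norm (X m - X n) < e" by blast
  qed
  then obtain l where l: "X \<longlonglongrightarrow> l" using Cauchy_convergent convergent_def by blast
  have "(f \<longlongrightarrow> l) (at_left 1)"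
  proof (rule tendstoI)
    fix e :: real assume e: "e > 0"
    then obtain n where n: "\<And>j r. j \<ge> n \<Longrightarrow> 1 - 1 / real (n + 2) \<le> r \<Longrightarrow> r < 1 \<Longrightarrow> norm (X j - f r) < e/2" using key[of "e/2"] by auto
    have "dist (f r) l < e" if "1 - 1 / real (n + 2) < r" "r < 1" for r
    proof -
      have "(\<lambda>j. norm (X j - f r)) \<longlonglongrightarrow> norm (l - f r)" by (intro tendsto_intros l)
      moreover have "eventually (\<lambda>j. norm (X j - f r) \<le> e/2) sequentially"
        unfolding eventually_sequentially using n that by (intro exI[of _ n]) (auto intro: less_imp_le)
      ultimately have "norm (l - f r) \<le> e/2" by (rule tendsto_upperbound) simp
      then show ?thesis using e by (simp add: dist_norm norm_minus_commute)
    qed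
    moreover have "1 - 1 / real (n + 2) < 1" by simp
    ultimately show "eventually (\<lambda>r. dist (f r) l < e) (at_left 1)"
      unfolding eventually_at_left_field by blast
  qed
  then show ?L by blast
qed

text \<open>The inequality between values is non-strict, which makes the set an intersection of
  closed conditions on t, over uncountably many pairs of radii.\<close>

definition radial_osc :: "(complex \<Rightarrow> complex) \<Rightarrow> nat \<Rightarrow> nat \<Rightarrow> real set" where
  "radial_osc h m n = {t. \<forall>r r'. 1 - 1 / real (n + 2) \<le> r \<and> r < 1 \<and> 1 - 1 / real (n + 2) \<le> r' \<and> r' < 1 \<longrightarrow>
     norm (h (of_real r * cis t) - h (of_real r' * cis t)) \<le> 1 / real (m + 1)}"

definition radial_limit_set :: "(complex \<Rightarrow> complex) \<Rightarrow> real set" where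
  "radial_limit_set h = {t. \<exists>l. ((\<lambda>r::real. h (of_real r * cis t)) \<longlongrightarrow> l) (at_left 1)}"

lemma radial_limit_set_eq: "radial_limit_set h = (\<Inter>m. \<Union>n. radial_osc h m n)"
  unfolding radial_limit_set_def radial_osc_def by (subst at_left_limit_iff_Cauchy) auto

lemma closed_radial_osc:
  assumes "continuous_on (ball 0 1) h" shows "closed (radial_osc h m n)"
proof -
  have c: "continuous_on UNIV (\<lambda>t. h (of_real r * cis t))" if "0 \<le> r" "r < 1" for r
    by (intro continuous_on_compose2[OF assms] continuous_intros) (use that in \<open>auto simp: norm_mult\<close>)
  have "1 / real (n + 2) \<le> 1" by simp
  then have "closed {t. norm (h (of_real r * cis t) - h (of_real r' * cis t)) \<le> 1 / real (m + 1)}"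
    if "1 - 1 / real (n + 2) \<le> r \<and> r < 1 \<and> 1 - 1 / real (n + 2) \<le> r' \<and> r' < 1" for r r'
    using that by (intro closed_Collect_le continuous_intros c) linarith+
  moreover have "radial_osc h m n = \<Inter> ((\<lambda>(r, r'). {t. norm (h (of_real r * cis t) - h (of_real r' * cis t)) \<le> 1 / real (m + 1)})
     ` {(r, r'). 1 - 1 / real (n + 2) \<le> r \<and> r < 1 \<and> 1 - 1 / real (n + 2) \<le> r' \<and> r' < 1})"
    unfolding radial_osc_def by auto
  ultimately show ?thesis by (auto intro!: closed_Inter)
qed

lemma sets_radial_limit_set:
  assumes "continuous_on (ball 0 1) h" shows "radial_limit_set h \<in> sets borel"
  unfolding radial_limit_set_eq using closed_radial_osc[OF assms]
  by (intro sets.countable_INT sets.countable_UN) auto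

lemma boundary_fn_tendsto:
  assumes "((\<lambda>r::real. h (of_real r * cis t)) \<longlongrightarrow> l) (at_left 1)" shows "boundary_fn h t = l"
  unfolding boundary_fn_def using assms by (intro tendsto_Lim) auto

lemma tendsto_boundary_fn:
  assumes "t \<in> radial_limit_set h" shows "((\<lambda>r::real. h (of_real r * cis t)) \<longlongrightarrow> boundary_fn h t) (at_left 1)"
  using assms boundary_fn_tendsto unfolding radial_limit_set_def by blast

text \<open>A concrete sequence of radii tending to 1, since Fatou's lemma and measurability of
  limits work along sequences.\<close>

definition rad :: "nat \<Rightarrow> real" where "rad j = 1 - 1 / real (j + 2)"

lemma rad_bounds: "0 \<le> rad j" "rad j < 1" "rad j > 0"
  by (auto simp: rad_def)

lemma filterlim_rad: "filterlim rad (at_left 1) sequentially"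
  unfolding rad_def by real_asymp

lemma rad_tendsto: "rad \<longlonglongrightarrow> 1"
  unfolding rad_def by real_asymp

lemma borel_measurable_boundary_fn:
  assumes h: "continuous_on (ball 0 1) h" shows "boundary_fn h \<in> borel_measurable borel"
proof -
  have [measurable]: "radial_limit_set h \<in> sets borel" by (rule sets_radial_limit_set[OF h])
  have [measurable]: "(\<lambda>t. h (of_real (rad j) * cis t)) \<in> borel_measurable borel" for j
    by (rule borel_measurable_circle[OF h]) (auto simp: rad_bounds)
  \<comment> \<open>Where no radial limit exists, \<open>Lim\<close> is a description with an
    unsatisfiable predicate, hence the same unspecified constant for all such t. The function is
    therefore Borel on the whole line.\<close>
  have "boundary_fn h = (\<lambda>t. if t \<in> radial_limit_set h then lim (\<lambda>j. h (of_real (rad j) * cis t)) else (THE l::complex. False))"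
  proof
    fix t
    show "boundary_fn h t = (if t \<in> radial_limit_set h then lim (\<lambda>j. h (of_real (rad j) * cis t)) else (THE l::complex. False))"
    proof (cases "t \<in> radial_limit_set h")
      case True
      have "(\<lambda>j. h (of_real (rad j) * cis t)) \<longlonglongrightarrow> boundary_fn h t"
        using filterlim_compose[OF tendsto_boundary_fn[OF True] filterlim_rad] .
      then show ?thesis using True by (simp add: limI)
    next
      case False
      then have "((\<lambda>r::real. h (of_real r * cis t)) \<longlongrightarrow> l) (at_left 1) = False" for l
        by (auto simp: radial_limit_set_def)
      then show ?thesis using False by (simp add: boundary_fn_def Topological_Spaces.Lim_def)
    qed
  qed
  also have "\<dots> \<in> borel_measurable borel" by measurable
  finally show ?thesis .
qed

lemma emeasure_arc_meas_eq:
  assumes [measurable]: "A \<in> sets borel" shows "emeasure (arc_meas a b) A = emeasure lborel (A \<inter> {a..b})"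
  unfolding arc_meas_def
  by (subst emeasure_density) (auto simp: indicator_inter_arith[symmetric] Int_commute)

text \<open>The weak type estimate is applied to \<open>w(z) = h(z) - h(s z)\<close>, whose \<open>L\<^sup>1\<close> norms are small, while \<open>h(s z)\<close>
  is continuous up to the circle.\<close>

lemma maximal_oscillation:
  assumes h: "h \<in> hardy1" and L: "L > 0" and e: "e > 0"
  obtains A where "A \<in> sets borel" "ennreal L * emeasure (arc_meas 0 (2*pi)) A \<le> ennreal (160*pi*e)"
    "\<And>t m. t \<in> {0..2*pi} \<Longrightarrow> t \<notin> A \<Longrightarrow> 3 * L \<le> 1 / real (m + 1) \<Longrightarrow> \<exists>n. t \<in> radial_osc h m n"
proof -
  have hol: "h holomorphic_on ball 0 1" using h by (simp add: hardy1_iff)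
  then have hc: "continuous_on (ball 0 1) h" by (rule holomorphic_on_imp_continuous_on)
  obtain s0 where s0: "0 \<le> s0" "s0 < 1" "\<And>s r. s0 \<le> s \<Longrightarrow> s \<le> r \<Longrightarrow> r < 1 \<Longrightarrow>
     (\<integral>\<^sup>+t. ennreal (norm (h (of_real r * cis t) - h (of_real s * cis t))) \<partial>arc_meas 0 (2*pi)) \<le> ennreal e"
    by (rule hardy1_L1_Cauchy[OF h e]) (rule that)
  \<comment> \<open>Taken strictly above s0, so that s * \<open>rad n\<close> still exceeds s0 for
    large n and both radii fall in the Cauchy range.\<close>
  define s where "s = (1 + s0) / 2"
  have s: "s0 < s" "s < 1" "0 < s" using s0 by (auto simp: s_def)
  define w where "w = (\<lambda>z. h z - h (of_real s * z))"
  have sball: "of_real s * z \<in> ball 0 1" if "z \<in> ball 0 1" for z :: complex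
  proof -
    have "s * norm z \<le> 1 * norm z" using s by (intro mult_right_mono) auto
    then show ?thesis using that s by (simp add: norm_mult)
  qed
  have w: "w holomorphic_on ball 0 1"
  proof -
    have "(h \<circ> (\<lambda>z. of_real s * z)) holomorphic_on ball 0 1"
      by (rule holomorphic_on_compose_gen[OF _ hol]) (use sball in \<open>auto intro!: holomorphic_intros\<close>)
    then show ?thesis unfolding w_def o_def by (intro holomorphic_intros hol)
  qed
  have wc: "continuous_on (ball 0 1) w" by (rule holomorphic_on_imp_continuous_on[OF w])
  \<comment> \<open>The angles where the maximal function of w, restricted to radii below
    \<open>rad n\<close>, exceeds L. The truncation gives functions holomorphic beyond the closed
    disc, as the weak type estimate requires; these open conditions increase with n.\<close>
  define E where "E = (\<lambda>n. {0..2*pi} \<inter> (\<Union>r\<in>{0..<1}. {t. L < norm (w (of_real (rad n) * (of_real r * cis t)))}))"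
  have rr: "rad n * r < 1" "0 \<le> rad n * r" if "0 \<le> r" "r < 1" for n r
  proof -
    have "rad n * r \<le> 1 * r" using that rad_bounds[of n] by (intro mult_right_mono) auto
    then show "rad n * r < 1" using that by simp
    show "0 \<le> rad n * r" using that rad_bounds[of n] by simp
  qed
  have opn: "open (\<Union>r\<in>{0..<1}. {t. L < norm (w (of_real (rad n) * (of_real r * cis t)))})" for n
  proof (intro open_UN ballI open_Collect_less continuous_intros)
    fix r :: real assume r: "r \<in> {0..<1}"
    show "continuous_on UNIV (\<lambda>t. w (of_real (rad n) * (of_real r * cis t)))"
      by (intro continuous_on_compose2[OF wc] continuous_intros)
         (use r rr[of r n] rad_bounds[of n] in \<open>auto simp: norm_mult\<close>)
  qed
  have [measurable]: "E n \<in> sets borel" for n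
    unfolding E_def using opn[of n] by auto
  have inc: "incseq E"
  proof (rule incseq_SucI)
    fix n
    show "E n \<subseteq> E (Suc n)"
    proof
      fix t assume t: "t \<in> E n"
      then obtain r where r: "0 \<le> r" "r < 1" "L < norm (w (of_real (rad n) * (of_real r * cis t)))" "t \<in> {0..2*pi}"
        by (auto simp: E_def)
      have rs: "rad n \<le> rad (Suc n)" by (auto simp: rad_def intro!: divide_left_mono)
      \<comment> \<open>The same point of the disc, written relative to the larger dilation
        factor.\<close>
      define r' where "r' = rad n * r / rad (Suc n)"
      have "rad n * r \<le> rad (Suc n) * r" using r rs by (intro mult_right_mono) auto
      then have "r' \<le> r" unfolding r'_def using rad_bounds[of "Suc n"] by (simp add: divide_le_eq mult.commute)
      moreover have "0 \<le> r'" unfolding r'_def using r rad_bounds[of "Suc n"] rad_bounds[of n] by simp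
      moreover have eq: "of_real (rad (Suc n)) * (of_real r' * cis t) = of_real (rad n) * (of_real r * cis t)"
        using rad_bounds[of "Suc n"] by (simp add: r'_def)
      ultimately show "t \<in> E (Suc n)" using r unfolding E_def by (intro IntI UN_I[of r'] CollectI) (simp_all only: eq, auto)
    qed
  qed
  have "eventually (\<lambda>n. rad n > s0 / s) sequentially"
    by (rule order_tendstoD(1)[OF rad_tendsto]) (use s in simp)
  then obtain N where N: "\<And>n. n \<ge> N \<Longrightarrow> rad n > s0 / s" by (auto simp: eventually_sequentially)
  have bound: "ennreal L * emeasure lborel (E n) \<le> ennreal (160*pi*e)" for n
  proof -
    define n' where "n' = max n N"
    define v where "v = (\<lambda>z. w (of_real (rad n') * z))"
    have R: "0 < rad n'" "rad n' < 1" using rad_bounds by auto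
    have "(w \<circ> (\<lambda>z. of_real (rad n') * z)) holomorphic_on ball 0 (1 / rad n')"
    proof (rule holomorphic_on_compose_gen[OF _ w])
      show "(*) (complex_of_real (rad n')) ` ball 0 (1 / rad n') \<subseteq> ball 0 1"
        using R by (auto simp: norm_mult field_simps)
    qed (intro holomorphic_intros)
    then have v: "v holomorphic_on ball 0 (1 / rad n')" "1 / rad n' > 1" using R by (auto simp: v_def o_def)
    have "ennreal L * emeasure lborel (E n') \<le> ennreal (160*pi) * (\<integral>\<^sup>+t. ennreal (norm (v (cis t))) \<partial>arc_meas 0 (2*pi))"
    proof (rule maximal_weak_type[OF v L])
      fix t assume "t \<in> E n'"
      then show "t \<in> {0..2*pi} \<and> (\<exists>r. 0 \<le> r \<and> r < 1 \<and> norm (v (of_real r * cis t)) > L)"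
        by (auto simp: E_def v_def)
    qed simp
    also have "(\<integral>\<^sup>+t. ennreal (norm (v (cis t))) \<partial>arc_meas 0 (2*pi))
       = (\<integral>\<^sup>+t. ennreal (norm (h (of_real (rad n') * cis t) - h (of_real (s * rad n') * cis t))) \<partial>arc_meas 0 (2*pi))"
      by (simp add: v_def w_def mult.assoc)
    also have "\<dots> \<le> ennreal e"
    proof (rule s0(3))
      show "s0 \<le> s * rad n'" using N[of n'] s by (simp add: n'_def divide_less_eq mult.commute less_imp_le)
      show "s * rad n' \<le> rad n'" using s R by simp
    qed (rule R)
    finally have "ennreal L * emeasure lborel (E n') \<le> ennreal (160*pi) * ennreal e"
      by (simp add: mult_left_mono)
    also have "\<dots> = ennreal (160*pi*e)" using e by (simp add: ennreal_mult)
    finally have b: "ennreal L * emeasure lborel (E n') \<le> ennreal (160*pi*e)" .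
    have "E n \<subseteq> E n'" using inc by (auto simp: incseq_def n'_def)
    then have "emeasure lborel (E n) \<le> emeasure lborel (E n')" by (intro emeasure_mono) auto
    then have "ennreal L * emeasure lborel (E n) \<le> ennreal L * emeasure lborel (E n')" by (intro mult_left_mono) auto
    then show ?thesis using b by (rule order_trans)
  qed
  define A where "A = (\<Union>n. E n)"
  have [measurable]: "A \<in> sets borel" by (simp add: A_def)
  have "emeasure lborel A = (SUP n. emeasure lborel (E n))"
    unfolding A_def by (rule SUP_emeasure_incseq[symmetric]) (use inc in auto)
  then have "ennreal L * emeasure lborel A = (SUP n. ennreal L * emeasure lborel (E n))"
    by (simp add: SUP_mult_left_ennreal)
  also have "\<dots> \<le> ennreal (160*pi*e)" by (rule SUP_least) (rule bound)
  finally have "ennreal L * emeasure lborel A \<le> ennreal (160*pi*e)" .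
  moreover have "emeasure (arc_meas 0 (2*pi)) A \<le> emeasure lborel A"
    by (subst emeasure_arc_meas_eq) (auto intro!: emeasure_mono)
  ultimately have 1: "ennreal L * emeasure (arc_meas 0 (2*pi)) A \<le> ennreal (160*pi*e)"
    by (meson mult_left_mono order_trans zero_le)
  show thesis
  proof (rule that[OF _ 1])
    fix t m assume t: "t \<in> {0..2*pi}" "t \<notin> A" "3 * L \<le> 1 / real (m + 1)"
    have near: "norm (h (of_real r * cis t) - h (of_real (s * r) * cis t)) \<le> L" if r: "0 \<le> r" "r < 1" for r
    proof -
      have "eventually (\<lambda>n. rad n > r) sequentially" by (rule order_tendstoD(1)[OF rad_tendsto]) (use r in simp)
      then obtain n where n: "rad n > r" by (auto simp: eventually_sequentially)
      have "r / rad n \<in> {0..<1}" using n r rad_bounds[of n] by auto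
      moreover have "t \<notin> E n" using t by (auto simp: A_def)
      ultimately have "\<not> L < norm (w (of_real (rad n) * (of_real (r / rad n) * cis t)))" using t(1) unfolding E_def by blast
      moreover have "of_real (rad n) * (of_real (r / rad n) * cis t) = of_real r * cis t" using rad_bounds[of n] by simp
      ultimately show ?thesis by (simp add: w_def mult.assoc)
    qed
    have "isCont h (of_real (s * 1) * cis t)"
      using hc s by (simp add: continuous_on_eq_continuous_at norm_mult)
    moreover have "((\<lambda>r::real. of_real (s * r) * cis t) \<longlongrightarrow> of_real (s * 1) * cis t) (at_left 1)"
      by (intro tendsto_intros)
    ultimately have "((\<lambda>r::real. h (of_real (s * r) * cis t)) \<longlongrightarrow> h (of_real (s * 1) * cis t)) (at_left 1)"
      by (rule isCont_tendsto_compose)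
    then have "((\<lambda>r::real. h (of_real (s * r) * cis t)) \<longlongrightarrow> h (of_real s * cis t)) (at_left 1)" by simp
    then have "eventually (\<lambda>r. dist (h (of_real (s * r) * cis t)) (h (of_real s * cis t)) < L/2) (at_left 1)"
      using L by (intro tendstoD) auto
    then obtain b where b: "b < 1" "\<And>r. b < r \<Longrightarrow> r < 1 \<Longrightarrow> dist (h (of_real (s * r) * cis t)) (h (of_real s * cis t)) < L/2"
      unfolding eventually_at_left_field by blast
    obtain n where n: "inverse (real (Suc n)) < 1 - b" using reals_Archimedean[of "1 - b"] b(1) by auto
    have "1 / real (n + 2) \<le> inverse (real (Suc n))" by (simp add: inverse_eq_divide frac_le)
    then have n': "b < 1 - 1 / real (n + 2)" using n by linarith
    have "t \<in> radial_osc h m n"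
      unfolding radial_osc_def
    proof (intro CollectI allI impI)
      fix r r' assume rr': "1 - 1 / real (n + 2) \<le> r \<and> r < 1 \<and> 1 - 1 / real (n + 2) \<le> r' \<and> r' < 1"
      have "1 / real (n + 2) \<le> 1" by simp
      then have r0: "0 \<le> r" "0 \<le> r'" using rr' by linarith+
      let ?a = "h (of_real r * cis t)" and ?b = "h (of_real (s * r) * cis t)" and ?c = "h (of_real s * cis t)"
        and ?d = "h (of_real (s * r') * cis t)" and ?f = "h (of_real r' * cis t)"
      have 1: "norm (?a - ?b) \<le> L" "norm (?f - ?d) \<le> L" using near r0 rr' by auto
      have 2: "dist ?b ?c < L/2" "dist ?d ?c < L/2" using b(2) rr' n' by auto
      \<comment> \<open>Two outer differences of at most L come from the bound on w, and two inner
        ones below L/2 from continuity of h at the interior point s * cis t; together at most 3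
        L.\<close>
      have "norm (?a - ?f) \<le> norm (?a - ?b) + norm (?b - ?c) + norm (?c - ?d) + norm (?d - ?f)"
        by norm
      then show "norm (?a - ?f) \<le> 1 / real (m + 1)"
        using 1 2 t(3) by (simp add: dist_norm norm_minus_commute)
    qed
    then show "\<exists>n. t \<in> radial_osc h m n" by blast
  qed simp
qed

text \<open>For fixed m the level L stays fixed while e = 1 / (j + 1) tends to 0. The exceptional
  sets have measure O(e / L), so their intersection is null, and off it the oscillation is
  eventually at most 1 / (m + 1).\<close>

lemma hardy1_radial_limit_AE:
  assumes h: "h \<in> hardy1" shows "AE t in arc_meas 0 (2*pi). t \<in> radial_limit_set h"
proof -
  have hc: "continuous_on (ball 0 1) h" using h by (auto simp: hardy1_iff intro: holomorphic_on_imp_continuous_on)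
  have supp: "AE t in arc_meas 0 (2*pi). t \<in> {0..2*pi}"
    unfolding arc_meas_def by (subst AE_density) (auto simp: indicator_def)
  have "AE t in arc_meas 0 (2*pi). \<exists>n. t \<in> radial_osc h m n" for m
  proof -
    define L where "L = 1 / (3 * real (m + 1))"
    have L: "L > 0" "3 * L \<le> 1 / real (m + 1)" by (auto simp: L_def field_simps)
    have "\<exists>A. A \<in> sets borel \<and> ennreal L * emeasure (arc_meas 0 (2*pi)) A \<le> ennreal (160*pi*(1 / real (j + 1))) \<and>
      (\<forall>t. t \<in> {0..2*pi} \<longrightarrow> t \<notin> A \<longrightarrow> (\<exists>n. t \<in> radial_osc h m n))" for j
      by (rule maximal_oscillation[OF h L(1), of "1 / real (j + 1)"]) (use L(2) in auto)
    then obtain A where A: "\<And>j. A j \<in> sets borel" "\<And>j. ennreal L * emeasure (arc_meas 0 (2*pi)) (A j) \<le> ennreal (160*pi*(1 / real (j + 1)))"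
      "\<And>j t. t \<in> {0..2*pi} \<Longrightarrow> t \<notin> A j \<Longrightarrow> \<exists>n. t \<in> radial_osc h m n" by metis
    define B where "B = (\<Inter>j. A j)"
    have B: "B \<in> sets borel" using A(1) by (auto simp: B_def)
    have "ennreal L * emeasure (arc_meas 0 (2*pi)) B \<le> 0"
    proof (rule tendsto_lowerbound)
      show "(\<lambda>j. ennreal (160*pi*(1 / real (j + 1)))) \<longlonglongrightarrow> 0"
        unfolding ennreal_0[symmetric] by (intro tendsto_ennrealI) real_asymp
      show "\<forall>\<^sub>F j in sequentially. ennreal L * emeasure (arc_meas 0 (2*pi)) B \<le> ennreal (160*pi*(1 / real (j + 1)))"
      proof (intro always_eventually allI)
        fix j
        have "emeasure (arc_meas 0 (2*pi)) B \<le> emeasure (arc_meas 0 (2*pi)) (A j)"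
          by (rule emeasure_mono) (auto simp: B_def A(1))
        then have "ennreal L * emeasure (arc_meas 0 (2*pi)) B \<le> ennreal L * emeasure (arc_meas 0 (2*pi)) (A j)"
          by (intro mult_left_mono) auto
        then show "ennreal L * emeasure (arc_meas 0 (2*pi)) B \<le> ennreal (160*pi*(1 / real (j + 1)))"
          using A(2)[of j] by (rule order_trans)
      qed
    qed simp
    then have "emeasure (arc_meas 0 (2*pi)) B = 0" using L(1) by simp
    then have "AE t in arc_meas 0 (2*pi). t \<notin> B" using B by (intro AE_not_in null_setsI) auto
    with supp show ?thesis by eventually_elim (use A(3) in \<open>auto simp: B_def\<close>)
  qed
  then have "AE t in arc_meas 0 (2*pi). \<forall>m. \<exists>n. t \<in> radial_osc h m n" by (simp add: AE_all_countable)
  then show ?thesis by eventually_elim (auto simp: radial_limit_set_eq)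
qed

lemma radial_limit_set_periodic: "t + 2*pi \<in> radial_limit_set h \<longleftrightarrow> t \<in> radial_limit_set h"
  by (simp add: radial_limit_set_def cis_mult[symmetric])

lemma boundary_fn_periodic: "boundary_fn h (t + 2*pi) = boundary_fn h t"
  by (simp add: boundary_fn_def cis_mult[symmetric])

lemma hardy1_radial_limit_AE_arc:
  assumes h: "h \<in> hardy1" and ab: "b - a \<le> 2*pi" shows "AE t in arc_meas a b. t \<in> radial_limit_set h"
proof -
  have [measurable]: "radial_limit_set h \<in> sets borel"
    using h by (intro sets_radial_limit_set) (auto simp: hardy1_iff intro: holomorphic_on_imp_continuous_on)
  have "(\<integral>\<^sup>+t. indicator (- radial_limit_set h) t \<partial>arc_meas a b) \<le> (\<integral>\<^sup>+t. indicator (- radial_limit_set h) t \<partial>arc_meas a (a + 2*pi))"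
    using ab by (intro nn_integral_arc_meas_mono_set) auto
  also have "\<dots> = (\<integral>\<^sup>+t. indicator (- radial_limit_set h) t \<partial>arc_meas 0 (2*pi))"
    by (rule nn_integral_arc_meas_periodic) (auto simp: indicator_def radial_limit_set_periodic)
  also have "\<dots> = 0"
    using hardy1_radial_limit_AE[OF h] by (subst nn_integral_0_iff_AE) (auto simp: indicator_def)
  finally have "AE t in arc_meas a b. indicator (- radial_limit_set h) t = (0::ennreal)"
    by (subst (asm) le_zero_eq, subst (asm) nn_integral_0_iff_AE) auto
  then show ?thesis by eventually_elim (auto simp: indicator_def split: if_splits)
qed

text \<open>In the L1 Cauchy estimate the outer radius runs to 1 along \<open>rad\<close>; Fatou's
  lemma and the radial limits replace it by the boundary function.\<close>

lemma hardy1_L1_boundary: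
  assumes h: "h \<in> hardy1" and e: "e > 0"
  obtains s0 where "0 \<le> s0" "s0 < 1" "\<And>s. s0 \<le> s \<Longrightarrow> s < 1 \<Longrightarrow>
     (\<integral>\<^sup>+t. ennreal (norm (h (of_real s * cis t) - boundary_fn h t)) \<partial>arc_meas 0 (2*pi)) \<le> ennreal e"
proof -
  have hc: "continuous_on (ball 0 1) h" using h by (auto simp: hardy1_iff intro: holomorphic_on_imp_continuous_on)
  obtain s0 where s0: "0 \<le> s0" "s0 < 1" "\<And>s r. s0 \<le> s \<Longrightarrow> s \<le> r \<Longrightarrow> r < 1 \<Longrightarrow>
     (\<integral>\<^sup>+t. ennreal (norm (h (of_real r * cis t) - h (of_real s * cis t))) \<partial>arc_meas 0 (2*pi)) \<le> ennreal e"
    by (rule hardy1_L1_Cauchy[OF h e]) (rule that)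
  show thesis
  proof (rule that[OF s0(1,2)])
    fix s assume s: "s0 \<le> s" "s < 1"
    have "eventually (\<lambda>j. rad j > s) sequentially" by (rule order_tendstoD(1)[OF rad_tendsto s(2)])
    then obtain N where N: "\<And>j. j \<ge> N \<Longrightarrow> rad j > s" by (auto simp: eventually_sequentially)
    have m: "(\<lambda>t. h (of_real r * cis t)) \<in> borel_measurable borel" if "0 \<le> r" "r < 1" for r
      by (rule borel_measurable_circle[OF hc that])
    show "(\<integral>\<^sup>+t. ennreal (norm (h (of_real s * cis t) - boundary_fn h t)) \<partial>arc_meas 0 (2*pi)) \<le> ennreal e"
    proof (rule nn_integral_limit_le[where f = "\<lambda>j t. ennreal (norm (h (of_real s * cis t) - h (of_real (rad (j + N)) * cis t)))"])
      fix j
      have "0 \<le> s" using s s0 by simp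
      note [measurable] = m[OF rad_bounds(1,2), of "j + N"] m[OF this s(2)]
      show "(\<lambda>t. ennreal (norm (h (of_real s * cis t) - h (of_real (rad (j + N)) * cis t)))) \<in> borel_measurable (arc_meas 0 (2*pi))"
        by measurable
      show "(\<integral>\<^sup>+t. ennreal (norm (h (of_real s * cis t) - h (of_real (rad (j + N)) * cis t))) \<partial>arc_meas 0 (2*pi)) \<le> ennreal e"
        using s0(3)[OF s(1), of "rad (j + N)"] N[of "j + N"] rad_bounds by (simp add: norm_minus_commute less_imp_le)
    next
      show "AE t in arc_meas 0 (2*pi). (\<lambda>j. ennreal (norm (h (of_real s * cis t) - h (of_real (rad (j + N)) * cis t))))
           \<longlonglongrightarrow> ennreal (norm (h (of_real s * cis t) - boundary_fn h t))"
        using hardy1_radial_limit_AE[OF h]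
      proof eventually_elim
        case (elim t)
        have "(\<lambda>j. h (of_real (rad j) * cis t)) \<longlonglongrightarrow> boundary_fn h t"
          using filterlim_compose[OF tendsto_boundary_fn[OF elim] filterlim_rad] .
        then have "(\<lambda>j. h (of_real (rad (j + N)) * cis t)) \<longlonglongrightarrow> boundary_fn h t" by (rule LIMSEQ_ignore_initial_segment)
        then show ?case by (intro tendsto_ennrealI tendsto_intros)
      qed
    qed
  qed
qed

text \<open>The estimate on the circle holds for the dilates h(r z). Replacing their boundary values
  by those of h costs an L1 error times a kernel bounded by 1 / (1 - |z|)^2, and this error vanishes
  as r tends to 1.\<close>

lemma norm_deriv_le_boundary:
  assumes h: "h \<in> hardy1" and z: "norm z < 1"
  shows "ennreal (norm (deriv h z)) \<le>
    (\<integral>\<^sup>+t. ennreal (norm (boundary_fn h t - c) / (2*pi * (norm (cis t - z))^2)) \<partial>arc_meas 0 (2*pi))" (is "_ \<le> ?I")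
proof -
  have hol: "h holomorphic_on ball 0 1" using h by (simp add: hardy1_iff)
  then have hc: "continuous_on (ball 0 1) h" by (rule holomorphic_on_imp_continuous_on)
  have mz: "(\<lambda>t. 1 / (2*pi * (norm (cis t - z))^2)) \<in> borel_measurable borel"
    by (intro borel_measurable_continuous_onI continuous_intros) (use z in auto)
  note [measurable] = borel_measurable_boundary_fn[OF hc] mz
  have meas_b: "(\<lambda>t. norm (boundary_fn h t - c) * (1 / (2*pi * (norm (cis t - z))^2))) \<in> borel_measurable borel"
    by measurable
  then have "(\<lambda>t. norm (boundary_fn h t - c) / (2*pi * (norm (cis t - z))^2)) \<in> borel_measurable borel" by simp
  then have meas_b': "(\<lambda>t. norm (boundary_fn h t - c) / (2*pi * (norm (cis t - z))^2)) \<in> borel_measurable (arc_meas 0 (2*pi))"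
    by (simp add: measurable_cong_sets[OF sets_arc_meas refl])
  have le: "ennreal (r * norm (deriv h (of_real r * z))) \<le> ?I + ennreal (1 / (1 - norm z)^2) *
      (\<integral>\<^sup>+t. ennreal (norm (h (of_real r * cis t) - boundary_fn h t)) \<partial>arc_meas 0 (2*pi))" if r: "0 < r" "r < 1" for r
  proof -
    note [measurable] = borel_measurable_circle[OF hc less_imp_le[OF r(1)] r(2)]
    define v where "v = (\<lambda>z. h (of_real r * z))"
    have "(h \<circ> (\<lambda>z. of_real r * z)) holomorphic_on ball 0 (1 / r)"
    proof (rule holomorphic_on_compose_gen[OF _ hol])
      show "(*) (complex_of_real r) ` ball 0 (1 / r) \<subseteq> ball 0 1"
        using r by (auto simp: norm_mult field_simps)
    qed (intro holomorphic_intros)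
    then have v: "v holomorphic_on ball 0 (1 / r)" "1 / r > 1" using r by (auto simp: v_def o_def)
    have rz: "of_real r * z \<in> ball 0 1" using r z by (simp add: norm_mult mult_strict_mono[of r 1 "norm z" 1, simplified])
    have "(v has_field_derivative (deriv h (of_real r * z) * of_real r)) (at z)"
      unfolding v_def by (rule DERIV_chain2[where f = h and g = "\<lambda>z. of_real r * z"]) (auto intro: holomorphic_derivI[OF hol open_ball rz] intro!: derivative_eq_intros)
    then have "deriv v z = deriv h (of_real r * z) * of_real r" by (rule DERIV_imp_deriv)
    then have "ennreal (r * norm (deriv h (of_real r * z))) = ennreal (norm (deriv v z))"
      using r by (simp add: norm_mult mult.commute)
    also have "\<dots> \<le> (\<integral>\<^sup>+t. ennreal (norm (v (cis t) - c) / (2*pi * (norm (cis t - z))^2)) \<partial>arc_meas 0 (2*pi))"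
      by (rule norm_deriv_le_circle[OF v z])
    also have "\<dots> \<le> (\<integral>\<^sup>+t. ennreal (norm (boundary_fn h t - c) / (2*pi * (norm (cis t - z))^2))
        + ennreal (1 / (1 - norm z)^2) * ennreal (norm (h (of_real r * cis t) - boundary_fn h t)) \<partial>arc_meas 0 (2*pi))"
    proof (rule nn_integral_mono)
      fix t
      have "1 - norm z \<le> norm (cis t - z)" using norm_triangle_ineq2[of "cis t" z] by simp
      then have "(1 - norm z)^2 \<le> (norm (cis t - z))^2" using z by (intro power_mono) auto
      moreover have "1 * (norm (cis t - z))^2 \<le> 2*pi * (norm (cis t - z))^2"
        using pi_gt3 by (intro mult_right_mono) auto
      ultimately have d: "(1 - norm z)^2 \<le> 2*pi * (norm (cis t - z))^2" by linarith
      define D where "D = 2*pi * (norm (cis t - z))^2"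
      have D: "(1 - norm z)^2 \<le> D" "0 < (1 - norm z)^2" using d z by (auto simp: D_def)
      have "norm (v (cis t) - c) \<le> norm (boundary_fn h t - c) + norm (h (of_real r * cis t) - boundary_fn h t)"
        unfolding v_def by norm
      then have "norm (v (cis t) - c) / D \<le> (norm (boundary_fn h t - c) + norm (h (of_real r * cis t) - boundary_fn h t)) / D"
        using order_trans[OF less_imp_le[OF D(2)] D(1)] by (rule divide_right_mono)
      also have "\<dots> = norm (boundary_fn h t - c) / D + norm (h (of_real r * cis t) - boundary_fn h t) / D" by (rule add_divide_distrib)
      also have "norm (h (of_real r * cis t) - boundary_fn h t) / D \<le> norm (h (of_real r * cis t) - boundary_fn h t) / (1 - norm z)^2"
        using D less_le_trans[OF D(2) D(1)] by (intro divide_left_mono mult_pos_pos) auto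
      finally have *: "norm (v (cis t) - c) / D \<le> norm (boundary_fn h t - c) / D + 1 / (1 - norm z)^2 * norm (h (of_real r * cis t) - boundary_fn h t)"
        by simp
      have "D > 0" using D by linarith
      then show "ennreal (norm (v (cis t) - c) / (2*pi * (norm (cis t - z))^2)) \<le> ennreal (norm (boundary_fn h t - c) / (2*pi * (norm (cis t - z))^2))
        + ennreal (1 / (1 - norm z)^2) * ennreal (norm (h (of_real r * cis t) - boundary_fn h t))"
        unfolding D_def[symmetric] using *
        by (subst ennreal_mult[symmetric], simp, simp, subst ennreal_plus[symmetric]) (auto intro!: ennreal_leI simp del: ennreal_plus)
    qed
    finally have main: "ennreal (r * norm (deriv h (of_real r * z))) \<le> (\<integral>\<^sup>+t. ennreal (norm (boundary_fn h t - c) / (2*pi * (norm (cis t - z))^2))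
        + ennreal (1 / (1 - norm z)^2) * ennreal (norm (h (of_real r * cis t) - boundary_fn h t)) \<partial>arc_meas 0 (2*pi))" .
    have m1: "(\<lambda>t. ennreal (norm (boundary_fn h t - c) / (2*pi * (norm (cis t - z))^2))) \<in> borel_measurable (arc_meas 0 (2*pi))"
      by (rule measurable_compose[OF meas_b' measurable_ennreal])
    have m2: "(\<lambda>t. ennreal (1 / (1 - norm z)^2) * ennreal (norm (h (of_real r * cis t) - boundary_fn h t))) \<in> borel_measurable (arc_meas 0 (2*pi))"
      by measurable
    have "(\<integral>\<^sup>+t. ennreal (norm (boundary_fn h t - c) / (2*pi * (norm (cis t - z))^2))
        + ennreal (1 / (1 - norm z)^2) * ennreal (norm (h (of_real r * cis t) - boundary_fn h t)) \<partial>arc_meas 0 (2*pi)) = ?I + (\<integral>\<^sup>+t. ennreal (1 / (1 - norm z)^2) * ennreal (norm (h (of_real r * cis t) - boundary_fn h t)) \<partial>arc_meas 0 (2*pi))"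
      by (rule nn_integral_add[OF m1 m2])
    also have "(\<integral>\<^sup>+t. ennreal (1 / (1 - norm z)^2) * ennreal (norm (h (of_real r * cis t) - boundary_fn h t)) \<partial>arc_meas 0 (2*pi))
      = ennreal (1 / (1 - norm z)^2) * (\<integral>\<^sup>+t. ennreal (norm (h (of_real r * cis t) - boundary_fn h t)) \<partial>arc_meas 0 (2*pi))"
      by (rule nn_integral_cmult) measurable
    finally show ?thesis using main by simp
  qed
  show ?thesis
  proof (rule ennreal_le_epsilon)
    fix e :: real assume e: "e > 0"
    \<comment> \<open>The factor cancels the bound 1 / (1 - |z|)^2 of the kernel at the fixed point
      z.\<close>
    define e' where "e' = e * (1 - norm z)^2"
    have e': "e' > 0" using e z by (simp add: e'_def)
    obtain s0 where s0: "0 \<le> s0" "s0 < 1" "\<And>s. s0 \<le> s \<Longrightarrow> s < 1 \<Longrightarrow>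
     (\<integral>\<^sup>+t. ennreal (norm (h (of_real s * cis t) - boundary_fn h t)) \<partial>arc_meas 0 (2*pi)) \<le> ennreal e'"
      by (rule hardy1_L1_boundary[OF h e']) (rule that)
    have "eventually (\<lambda>j. rad j > s0) sequentially" by (rule order_tendstoD(1)[OF rad_tendsto s0(2)])
    then have ev: "eventually (\<lambda>j. ennreal (rad j * norm (deriv h (of_real (rad j) * z))) \<le> ?I + ennreal e) sequentially"
    proof eventually_elim
      case (elim j)
      have "ennreal (rad j * norm (deriv h (of_real (rad j) * z))) \<le> ?I + ennreal (1 / (1 - norm z)^2) *
        (\<integral>\<^sup>+t. ennreal (norm (h (of_real (rad j) * cis t) - boundary_fn h t)) \<partial>arc_meas 0 (2*pi))"
        by (rule le) (auto simp: rad_bounds)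
      also have "\<dots> \<le> ?I + ennreal (1 / (1 - norm z)^2) * ennreal e'"
        using elim by (intro add_left_mono mult_left_mono s0) (auto simp: rad_bounds)
      also have "ennreal (1 / (1 - norm z)^2) * ennreal e' = ennreal e"
        using z e by (subst ennreal_mult[symmetric]) (auto simp: e'_def)
      finally show ?case .
    qed
    have "deriv h holomorphic_on ball 0 1" by (rule holomorphic_deriv[OF hol open_ball])
    then have "continuous_on (ball 0 1) (deriv h)" by (rule holomorphic_on_imp_continuous_on)
    then have "isCont (deriv h) z" using z by (simp add: continuous_on_eq_continuous_at)
    moreover have "(\<lambda>j. of_real (rad j) * z) \<longlonglongrightarrow> of_real 1 * z" by (intro tendsto_intros rad_tendsto)
    ultimately have "(\<lambda>j. deriv h (of_real (rad j) * z)) \<longlonglongrightarrow> deriv h z"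
      using isCont_tendsto_compose[of z "deriv h"] by simp
    then have "(\<lambda>j. rad j * norm (deriv h (of_real (rad j) * z))) \<longlonglongrightarrow> 1 * norm (deriv h z)"
      by (intro tendsto_intros rad_tendsto)
    then have "(\<lambda>j. ennreal (rad j * norm (deriv h (of_real (rad j) * z)))) \<longlonglongrightarrow> ennreal (norm (deriv h z))"
      by (intro tendsto_ennrealI) simp
    then show "ennreal (norm (deriv h z)) \<le> ?I + ennreal e"
      using ev by (rule tendsto_upperbound) simp
  qed
qed

subsection \<open>Bounded mean oscillation\<close>

definition arc_avg :: "(real \<Rightarrow> complex) \<Rightarrow> real \<Rightarrow> real \<Rightarrow> complex" where
  "arc_avg g a b = (LINT s:{a..b}|lborel. g s) / complex_of_real (b - a)"

lemma nn_integral_const_arc: "a \<le> b \<Longrightarrow> (\<integral>\<^sup>+t. c \<partial>arc_meas a b) = c * ennreal (b - a)"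
  using emeasure_arc_meas[of a b] by simp

lemma arc_avg_diff_le:
  assumes m: "g \<in> borel_measurable borel" and g: "set_integrable lborel {a..b} g" and ab: "a < b"
  shows "ennreal (norm (arc_avg g a b - c) * (b - a)) \<le> (\<integral>\<^sup>+t. ennreal (norm (g t - c)) \<partial>arc_meas a b)"
proof -
  interpret finite_measure "arc_meas a b" by simp
  have gi: "integrable (arc_meas a b) g" using g m by (simp add: integrable_arc_meas)
  have "(\<integral>t. g t - c \<partial>arc_meas a b) = (\<integral>t. g t \<partial>arc_meas a b) - (\<integral>t. c \<partial>arc_meas a b)"
    by (rule Bochner_Integration.integral_diff[OF gi]) simp
  also have "(\<integral>t. c \<partial>arc_meas a b) = of_real (b - a) * c"
    using emeasure_arc_meas[of a b] ab by (simp add: measure_def scaleR_conv_of_real)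
  also have "(\<integral>t. g t \<partial>arc_meas a b) = of_real (b - a) * arc_avg g a b"
    using ab by (simp add: integral_arc_meas[OF m] arc_avg_def)
  finally have "norm (\<integral>t. g t - c \<partial>arc_meas a b) = norm (arc_avg g a b - c) * (b - a)"
    using ab by (simp add: right_diff_distrib[symmetric] norm_mult del: of_real_diff)
  then show ?thesis
    using integral_norm_bound_ennreal[of "arc_meas a b" "\<lambda>t. g t - c"] gi by simp
qed

lemma bmo_circleE:
  assumes "bmo_circle g" and m: "g \<in> borel_measurable borel"
  obtains C where "C \<ge> 0" "\<And>a b. a < b \<Longrightarrow> b - a \<le> 2*pi \<Longrightarrow> set_integrable lborel {a..b} g"
    "\<And>a b. a < b \<Longrightarrow> b - a \<le> 2*pi \<Longrightarrow> (\<integral>\<^sup>+t. ennreal (norm (g t - arc_avg g a b)) \<partial>arc_meas a b) \<le> ennreal (C * (b - a))"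
proof -
  obtain C where C: "\<And>a b. a < b \<Longrightarrow> b - a \<le> 2*pi \<Longrightarrow> set_integrable lborel {a..b} g \<and>
      (\<integral>\<^sup>+ t. indicator {a..b} t * ennreal (norm (g t - arc_avg g a b)) \<partial>lborel) \<le> ennreal (C * (b - a))"
    using assms(1) unfolding bmo_circle_def arc_avg_def by blast
  have *: "(\<integral>\<^sup>+t. ennreal (norm (g t - arc_avg g a b)) \<partial>arc_meas a b) = (\<integral>\<^sup>+ t. indicator {a..b} t * ennreal (norm (g t - arc_avg g a b)) \<partial>lborel)" for a b
    by (rule nn_integral_arc_meas) (use m in measurable)
  show thesis
  proof (rule that[of "max C 0"])
    fix a b :: real assume ab: "a < b" "b - a \<le> 2*pi"
    have "(\<integral>\<^sup>+t. ennreal (norm (g t - arc_avg g a b)) \<partial>arc_meas a b) \<le> ennreal (C * (b - a))"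
      unfolding * using C[OF ab] by blast
    also have "\<dots> \<le> ennreal (max C 0 * (b - a))" using ab by (intro ennreal_leI mult_right_mono) auto
    finally show "(\<integral>\<^sup>+t. ennreal (norm (g t - arc_avg g a b)) \<partial>arc_meas a b) \<le> ennreal (max C 0 * (b - a))" .
  qed (use C in auto)
qed

text \<open>Up to the factor 2 the mean is the best constant, by the triangle inequality through c.
  BMO bounds may thus be proved with whatever constant is convenient on each arc.\<close>

lemma arc_avg_optimal:
  assumes m [measurable]: "g \<in> borel_measurable borel" and g: "set_integrable lborel {a..b} g" and ab: "a < b"
  shows "(\<integral>\<^sup>+t. ennreal (norm (g t - arc_avg g a b)) \<partial>arc_meas a b) \<le> 2 * (\<integral>\<^sup>+t. ennreal (norm (g t - c)) \<partial>arc_meas a b)"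
proof -
  have "(\<integral>\<^sup>+t. ennreal (norm (g t - arc_avg g a b)) \<partial>arc_meas a b)
      \<le> (\<integral>\<^sup>+t. ennreal (norm (g t - c)) + ennreal (norm (arc_avg g a b - c)) \<partial>arc_meas a b)"
  proof (rule nn_integral_mono)
    fix t
    have "norm (g t - arc_avg g a b) \<le> norm (g t - c) + norm (arc_avg g a b - c)" by norm
    then show "ennreal (norm (g t - arc_avg g a b)) \<le> ennreal (norm (g t - c)) + ennreal (norm (arc_avg g a b - c))"
      by (subst ennreal_plus[symmetric]) (auto intro!: ennreal_leI simp del: ennreal_plus)
  qed
  also have "\<dots> = (\<integral>\<^sup>+t. ennreal (norm (g t - c)) \<partial>arc_meas a b) + ennreal (norm (arc_avg g a b - c) * (b - a))"
    using ab by (subst nn_integral_add) (auto simp: nn_integral_const_arc ennreal_mult simp del: nn_integral_const)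
  also have "\<dots> \<le> (\<integral>\<^sup>+t. ennreal (norm (g t - c)) \<partial>arc_meas a b) + (\<integral>\<^sup>+t. ennreal (norm (g t - c)) \<partial>arc_meas a b)"
    by (intro add_left_mono arc_avg_diff_le assms)
  finally show ?thesis by (simp add: mult_2)
qed

locale bmo_fn =
  fixes g :: "real \<Rightarrow> complex" and C :: real
  assumes meas [measurable]: "g \<in> borel_measurable borel" and C0: "C \<ge> 0"
    and int: "\<And>a b. a < b \<Longrightarrow> b - a \<le> 2*pi \<Longrightarrow> set_integrable lborel {a..b} g"
    and osc: "\<And>a b. a < b \<Longrightarrow> b - a \<le> 2*pi \<Longrightarrow> (\<integral>\<^sup>+t. ennreal (norm (g t - arc_avg g a b)) \<partial>arc_meas a b) \<le> ennreal (C * (b - a))"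
    and per: "\<And>t. g (t + 2*pi) = g t"
begin

definition mean :: "real \<Rightarrow> nat \<Rightarrow> complex" where "mean \<theta> j = arc_avg g (\<theta> - rho j) (\<theta> + rho j)"

lemma arc_size: "\<theta> - rho j < \<theta> + rho j" "(\<theta> + rho j) - (\<theta> - rho j) \<le> 2*pi" "(\<theta> + rho j) - (\<theta> - rho j) = 2 * rho j"
  using rho_pos[of j] rho_le_pi[of j] by auto

lemma osc_mean: "(\<integral>\<^sup>+t. ennreal (norm (g t - mean \<theta> j)) \<partial>arc_meas (\<theta> - rho j) (\<theta> + rho j)) \<le> ennreal (C * (2 * rho j))"
  using osc[OF arc_size(1,2), of \<theta> j] unfolding mean_def arc_size(3) .

text \<open>The inner arc is half as long as the outer one, so the oscillation about the outer mean
  doubles at most when averaged over the inner arc.\<close>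

lemma mean_Suc: "norm (mean \<theta> (Suc j) - mean \<theta> j) \<le> 2 * C"
proof -
  have "ennreal (norm (mean \<theta> (Suc j) - mean \<theta> j) * (2 * rho (Suc j)))
     \<le> (\<integral>\<^sup>+t. ennreal (norm (g t - mean \<theta> j)) \<partial>arc_meas (\<theta> - rho (Suc j)) (\<theta> + rho (Suc j)))"
    using arc_avg_diff_le[OF meas int[OF arc_size(1,2)] arc_size(1), of \<theta> "Suc j" "mean \<theta> j"]
    unfolding arc_size(3) by (simp add: mean_def)
  also have "\<dots> \<le> (\<integral>\<^sup>+t. ennreal (norm (g t - mean \<theta> j)) \<partial>arc_meas (\<theta> - rho j) (\<theta> + rho j))"
    by (rule nn_integral_arc_meas_mono_set) (use rho_mono[of j "Suc j"] in auto)
  also have "\<dots> \<le> ennreal (C * (2 * rho j))" by (rule osc_mean)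
  finally have "norm (mean \<theta> (Suc j) - mean \<theta> j) * (2 * rho (Suc j)) \<le> C * (2 * rho j)"
    using C0 by (simp add: ennreal_le_iff)
  then have "norm (mean \<theta> (Suc j) - mean \<theta> j) * rho j \<le> (2 * C) * rho j" by (simp add: rho_Suc)
  then show ?thesis by (rule mult_right_le_imp_le) simp
qed

text \<open>Telescoping over scales. As \<open>rho j\<close> is pi / 2^j, linear growth in j is the
  logarithmic growth of BMO means.\<close>

lemma mean_diff: "norm (mean \<theta> (j + i) - mean \<theta> j) \<le> 2 * C * real i"
proof (induction i)
  case (Suc i)
  have "norm (mean \<theta> (j + Suc i) - mean \<theta> j) \<le> norm (mean \<theta> (Suc (j + i)) - mean \<theta> (j + i)) + norm (mean \<theta> (j + i) - mean \<theta> j)"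
    using norm_triangle_ineq[of "mean \<theta> (Suc (j + i)) - mean \<theta> (j + i)" "mean \<theta> (j + i) - mean \<theta> j"] by simp
  then show ?case using Suc mean_Suc[of \<theta> "j + i"] by (simp add: algebra_simps)
qed simp

lemma osc_deep_mean:
  "(\<integral>\<^sup>+t. ennreal (norm (g t - mean \<theta> (j + i))) \<partial>arc_meas (\<theta> - rho j) (\<theta> + rho j)) \<le> ennreal (2 * C * rho j * (1 + 2 * real i))"
proof -
  have "(\<integral>\<^sup>+t. ennreal (norm (g t - mean \<theta> (j + i))) \<partial>arc_meas (\<theta> - rho j) (\<theta> + rho j))
    \<le> (\<integral>\<^sup>+t. ennreal (norm (g t - mean \<theta> j)) + ennreal (2 * C * real i) \<partial>arc_meas (\<theta> - rho j) (\<theta> + rho j))"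
  proof (rule nn_integral_mono)
    fix t
    have "norm (g t - mean \<theta> (j + i)) \<le> norm (g t - mean \<theta> j) + norm (mean \<theta> (j + i) - mean \<theta> j)" by norm
    also have "\<dots> \<le> norm (g t - mean \<theta> j) + 2 * C * real i" using mean_diff by simp
    finally show "ennreal (norm (g t - mean \<theta> (j + i))) \<le> ennreal (norm (g t - mean \<theta> j)) + ennreal (2 * C * real i)"
      using C0 by (subst ennreal_plus[symmetric]) (auto intro!: ennreal_leI simp del: ennreal_plus)
  qed
  also have "\<dots> = (\<integral>\<^sup>+t. ennreal (norm (g t - mean \<theta> j)) \<partial>arc_meas (\<theta> - rho j) (\<theta> + rho j)) + ennreal (2 * C * real i) * ennreal (2 * rho j)"
    using nn_integral_const_arc[OF less_imp_le[OF arc_size(1)[of \<theta> j]], where c = "ennreal (2 * C * real i)"] unfolding arc_size(3)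
    by (subst nn_integral_add) auto
  also have "\<dots> \<le> ennreal (C * (2 * rho j)) + ennreal (2 * C * real i * (2 * rho j))"
    using C0 by (intro add_mono osc_mean eq_refl[OF ennreal_mult[symmetric]]) auto
  also have "\<dots> = ennreal (2 * C * rho j * (1 + 2 * real i))"
    using C0 by (subst ennreal_plus[symmetric]) (auto simp: algebra_simps simp del: ennreal_plus)
  finally show ?thesis .
qed

text \<open>An arc of radius \<open>rho 0\<close> = pi is a full period, so one bound holds for all
  centres; it is the starting value of the telescoping.\<close>

lemma mean_0_bound: "norm (mean \<theta> 0) \<le> enn2real (\<integral>\<^sup>+t. ennreal (norm (g t)) \<partial>arc_meas 0 (2*pi)) / (2*pi)"
proof -
  have fin: "(\<integral>\<^sup>+t. ennreal (norm (g t)) \<partial>arc_meas 0 (2*pi)) < \<infinity>"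
    using int[of 0 "2*pi"] integrable_arc_meas[OF meas, of 0 "2*pi"] by (auto simp: integrable_iff_bounded)
  have "ennreal (norm (mean \<theta> 0 - 0) * (2*pi)) \<le> (\<integral>\<^sup>+t. ennreal (norm (g t - 0)) \<partial>arc_meas (\<theta> - pi) (\<theta> + pi))"
    using arc_avg_diff_le[OF meas int[OF arc_size(1,2)] arc_size(1), of \<theta> 0 0]
    unfolding arc_size(3) by (simp add: mean_def rho_def)
  also have "(\<integral>\<^sup>+t. ennreal (norm (g t - 0)) \<partial>arc_meas (\<theta> - pi) (\<theta> + pi)) = (\<integral>\<^sup>+t. ennreal (norm (g t)) \<partial>arc_meas (\<theta> - pi) ((\<theta> - pi) + 2*pi))"
    by (simp add: algebra_simps)
  also have "\<dots> = (\<integral>\<^sup>+t. ennreal (norm (g t)) \<partial>arc_meas 0 (2*pi))"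
    by (rule nn_integral_arc_meas_periodic) (auto simp: per)
  also have "\<dots> = ennreal (enn2real (\<integral>\<^sup>+t. ennreal (norm (g t)) \<partial>arc_meas 0 (2*pi)))" using fin by simp
  finally have "norm (mean \<theta> 0) * (2*pi) \<le> enn2real (\<integral>\<^sup>+t. ennreal (norm (g t)) \<partial>arc_meas 0 (2*pi))"
    by (simp add: ennreal_le_iff)
  then show ?thesis by (simp add: pos_le_divide_eq)
qed

text \<open>The constant c is the mean at the scale K comparable to 1 - r. The arc at scale K - i
  contributes 8 pi^2 C / \<open>rho K\<close> times (1 + 2 i) / 2^i: the drift of the means is
  linear in i and the kernel decays geometrically. The weights sum to at most 6, whence 48.\<close>

lemma kernel_osc_bound:
  assumes r: "0 \<le> r" "r < 1"
  shows "\<exists>c. (\<integral>\<^sup>+t. ennreal (norm (g t - c)) * ennreal (1 / (norm (cis t - of_real r * cis \<theta>))^2) \<partial>arc_meas 0 (2*pi))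
    \<le> ennreal (48 * pi^2 * C / (1 - r))"
proof -
  have "1 - r > 0" "1 - r \<le> pi" using r pi_gt3 by auto
  then obtain K where K: "1 - r \<le> rho K" "rho K < 2 * (1 - r)" by (rule rho_scale_exists)
  have "(\<integral>\<^sup>+t. ennreal (norm (g t - mean \<theta> K)) * ennreal (1 / (norm (cis t - of_real r * cis \<theta>))^2) \<partial>arc_meas 0 (2*pi))
     \<le> (\<Sum>j\<le>K. ennreal (4 * pi^2 / (rho j)^2) * (\<integral>\<^sup>+t. ennreal (norm (g t - mean \<theta> K)) \<partial>arc_meas (\<theta> - rho j) (\<theta> + rho j)))"
    by (rule nn_integral_kernel_le[OF _ _ r K]) (auto simp: per)
  also have "\<dots> \<le> (\<Sum>j\<le>K. ennreal (4 * pi^2 / (rho j)^2) * ennreal (2 * C * rho j * (1 + 2 * real (K - j))))"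
  proof (intro sum_mono mult_left_mono)
    fix j assume "j \<in> {..K}"
    then show "(\<integral>\<^sup>+t. ennreal (norm (g t - mean \<theta> K)) \<partial>arc_meas (\<theta> - rho j) (\<theta> + rho j)) \<le> ennreal (2 * C * rho j * (1 + 2 * real (K - j)))"
      using osc_deep_mean[of \<theta> j "K - j"] by simp
  qed auto
  also have "\<dots> = ennreal (\<Sum>j\<le>K. 4 * pi^2 / (rho j)^2 * (2 * C * rho j * (1 + 2 * real (K - j))))"
    using C0 by (subst sum_ennreal[symmetric]) (auto intro!: sum.cong simp: ennreal_mult[symmetric])
  also have "(\<Sum>j\<le>K. 4 * pi^2 / (rho j)^2 * (2 * C * rho j * (1 + 2 * real (K - j))))
      = (\<Sum>j\<le>K. 8 * pi^2 * C / rho K * ((1 + 2 * real (K - j)) / 2 ^ (K - j)))"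
  proof (rule sum.cong[OF refl])
    fix j assume j: "j \<in> {..K}"
    have "rho j = rho K * 2 ^ (K - j)" using j by (simp add: rho_def power_diff)
    moreover have "rho K \<noteq> 0" using rho_pos[of K] by linarith
    ultimately show "4 * pi^2 / (rho j)^2 * (2 * C * rho j * (1 + 2 * real (K - j))) = 8 * pi^2 * C / rho K * ((1 + 2 * real (K - j)) / 2 ^ (K - j))"
      by (simp add: power2_eq_square)
  qed
  also have "\<dots> = 8 * pi^2 * C / rho K * (\<Sum>i\<le>K. (1 + 2 * real i) / 2 ^ i)"
    unfolding sum_distrib_left[symmetric]
    by (rule arg_cong[of _ _ "\<lambda>s. 8 * pi^2 * C / rho K * s"], rule sum.reindex_bij_witness[of _ "\<lambda>i. K - i" "\<lambda>i. K - i"]) auto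
  also have "ennreal \<dots> \<le> ennreal (48 * pi^2 * C / (1 - r))"
  proof (rule ennreal_leI)
    have "(\<Sum>i\<le>K. (1 + 2 * real i) / 2 ^ i) = 6 - (2 * real K + 5) / 2 ^ K"
      by (induction K) (auto simp: field_simps)
    then have "(\<Sum>i\<le>K. (1 + 2 * real i) / 2 ^ i) \<le> 6" by simp
    then have "8 * pi^2 * C / rho K * (\<Sum>i\<le>K. (1 + 2 * real i) / 2 ^ i) \<le> 8 * pi^2 * C / rho K * 6"
      using C0 by (intro mult_left_mono) auto
    also have "\<dots> \<le> 8 * pi^2 * C / (1 - r) * 6"
      using C0 K(1) r by (intro mult_right_mono divide_left_mono) auto
    finally show "8 * pi^2 * C / rho K * (\<Sum>i\<le>K. (1 + 2 * real i) / 2 ^ i) \<le> 48 * pi^2 * C / (1 - r)" by simp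
  qed
  finally show ?thesis by blast
qed

text \<open>On an arc at scale j with centre \<theta>, F g is compared with F(\<theta>) times the
  mean m of g, through F (g - m) + (F - F(\<theta>)) m. The first part is M times the oscillation of
  g. In the second, the modulus B / (j + 1) cancels the growth A0 + 2 C j of the mean.\<close>

lemma log_Lipschitz_mult:
  assumes F [measurable]: "F \<in> borel_measurable borel" and M: "\<And>t. norm (F t) \<le> M" and B: "B \<ge> 0"
    and mod: "\<And>s t j. \<bar>s - t\<bar> \<le> rho j \<Longrightarrow> norm (F s - F t) \<le> B / (real j + 1)"
  obtains c K where "K \<ge> 0" "\<And>a b. a < b \<Longrightarrow> b - a \<le> 2*pi \<Longrightarrow>
    (\<integral>\<^sup>+t. ennreal (norm (F t * g t - c a b)) \<partial>arc_meas a b) \<le> ennreal (K * (b - a))"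
proof -
  define A0 where "A0 = enn2real (\<integral>\<^sup>+t. ennreal (norm (g t)) \<partial>arc_meas 0 (2*pi)) / (2*pi)"
  have A0: "A0 \<ge> 0" "\<And>\<theta>. norm (mean \<theta> 0) \<le> A0" using mean_0_bound by (auto simp: A0_def)
  have M0: "M \<ge> 0" using M[of 0] norm_ge_zero order_trans by blast
  \<comment> \<open>The factor 2 is the ratio of the dyadic arc of length 2 \<open>rho j\<close> to
    the given arc, since \<open>rho j\<close> < b - a.\<close>
  define K where "K = 2 * (M * C + B * (A0 + 2 * C))"
  have K0: "K \<ge> 0" using M0 C0 B A0 by (simp add: K_def)
  have "\<exists>c. (\<integral>\<^sup>+t. ennreal (norm (F t * g t - c)) \<partial>arc_meas a b) \<le> ennreal (K * (b - a))"
    if ab: "a < b" "b - a \<le> 2*pi" for a b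
  proof -
    define \<theta> where "\<theta> = (a + b) / 2"
    have "(b - a) / 2 > 0" "(b - a) / 2 \<le> pi" using ab by auto
    then obtain j where j: "(b - a) / 2 \<le> rho j" "rho j < 2 * ((b - a) / 2)" by (rule rho_scale_exists)
    define N where "N = norm (mean \<theta> j)"
    have N: "N \<le> A0 + 2 * C * real j" "N \<ge> 0"
      using mean_diff[of \<theta> 0 j] A0(2)[of \<theta>] norm_triangle_ineq[of "mean \<theta> j - mean \<theta> 0" "mean \<theta> 0"]
      by (auto simp: N_def)
    define P where "P = B / (real j + 1) * N"
    have P0: "P \<ge> 0" using B N by (simp add: P_def)
    have P: "P \<le> B * (A0 + 2 * C)"
    proof -
      have "P \<le> B / (real j + 1) * (A0 + 2 * C * real j)" unfolding P_def using N B by (intro mult_left_mono) auto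
      also have "\<dots> \<le> B / (real j + 1) * ((A0 + 2 * C) * (real j + 1))"
        using A0(1) C0 B by (intro mult_left_mono) (auto simp: algebra_simps)
      finally show ?thesis by simp
    qed
    have "(\<integral>\<^sup>+t. ennreal (norm (F t * g t - F \<theta> * mean \<theta> j)) \<partial>arc_meas a b)
      \<le> (\<integral>\<^sup>+t. ennreal (norm (F t * g t - F \<theta> * mean \<theta> j)) \<partial>arc_meas (\<theta> - rho j) (\<theta> + rho j))"
      by (rule nn_integral_arc_meas_mono_set) (use j in \<open>auto simp: \<theta>_def field_simps\<close>)
    also have "\<dots> \<le> (\<integral>\<^sup>+t. ennreal M * ennreal (norm (g t - mean \<theta> j)) + ennreal P \<partial>arc_meas (\<theta> - rho j) (\<theta> + rho j))"
    proof (rule nn_integral_mono_AE)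
      have "AE t in arc_meas (\<theta> - rho j) (\<theta> + rho j). t \<in> {\<theta> - rho j..\<theta> + rho j}"
        unfolding arc_meas_def by (subst AE_density) (auto simp: indicator_def)
      then show "AE t in arc_meas (\<theta> - rho j) (\<theta> + rho j). ennreal (norm (F t * g t - F \<theta> * mean \<theta> j)) \<le> ennreal M * ennreal (norm (g t - mean \<theta> j)) + ennreal P"
      proof eventually_elim
        case (elim t)
        have "F t * g t - F \<theta> * mean \<theta> j = F t * (g t - mean \<theta> j) + (F t - F \<theta>) * mean \<theta> j" by (simp add: algebra_simps)
        then have "norm (F t * g t - F \<theta> * mean \<theta> j) \<le> norm (F t) * norm (g t - mean \<theta> j) + norm (F t - F \<theta>) * N"
          unfolding N_def by (metis norm_mult norm_triangle_ineq)
        also have "\<dots> \<le> M * norm (g t - mean \<theta> j) + P"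
          unfolding P_def using elim by (intro add_mono mult_right_mono M mod N(2)) auto
        finally show ?case using M0 P0
          by (subst ennreal_mult[symmetric], simp, simp, subst ennreal_plus[symmetric]) (auto intro!: ennreal_leI simp del: ennreal_plus)
      qed
    qed
    also have "\<dots> = ennreal M * (\<integral>\<^sup>+t. ennreal (norm (g t - mean \<theta> j)) \<partial>arc_meas (\<theta> - rho j) (\<theta> + rho j)) + ennreal P * ennreal (2 * rho j)"
      using nn_integral_const_arc[OF less_imp_le[OF arc_size(1)[of \<theta> j]], where c = "ennreal P"] unfolding arc_size(3)
      by (subst nn_integral_add) (auto simp: nn_integral_cmult)
    also have "\<dots> \<le> ennreal M * ennreal (C * (2 * rho j)) + ennreal P * ennreal (2 * rho j)"
      by (intro add_mono mult_left_mono osc_mean) auto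
    also have "\<dots> = ennreal (2 * rho j * (M * C + P))"
      using M0 C0 P0 by (simp add: ennreal_mult[symmetric] ennreal_plus[symmetric] algebra_simps del: ennreal_plus)
    also have "\<dots> \<le> ennreal (2 * (b - a) * (M * C + B * (A0 + 2 * C)))"
      using j P M0 C0 P0 ab by (intro ennreal_leI mult_mono) auto
    also have "\<dots> = ennreal (K * (b - a))" by (simp add: K_def algebra_simps)
    finally show ?thesis by blast
  qed
  then obtain c where "\<And>a b. a < b \<Longrightarrow> b - a \<le> 2*pi \<Longrightarrow>
    (\<integral>\<^sup>+t. ennreal (norm (F t * g t - c a b)) \<partial>arc_meas a b) \<le> ennreal (K * (b - a))" by metis
  then show thesis using K0 by (intro that[of K c])
qed

end

lemma BMOA_bmo_fn:
  assumes "h \<in> BMOA" obtains C where "bmo_fn (boundary_fn h) C"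
proof -
  have h: "h \<in> hardy1" "bmo_circle (boundary_fn h)" using assms by (auto simp: BMOA_def)
  then have m: "boundary_fn h \<in> borel_measurable borel"
    by (intro borel_measurable_boundary_fn holomorphic_on_imp_continuous_on) (simp add: hardy1_iff)
  obtain C where C: "C \<ge> 0" "\<And>a b. a < b \<Longrightarrow> b - a \<le> 2*pi \<Longrightarrow> set_integrable lborel {a..b} (boundary_fn h)"
    "\<And>a b. a < b \<Longrightarrow> b - a \<le> 2*pi \<Longrightarrow> (\<integral>\<^sup>+t. ennreal (norm (boundary_fn h t - arc_avg (boundary_fn h) a b)) \<partial>arc_meas a b) \<le> ennreal (C * (b - a))"
    by (rule bmo_circleE[OF h(2) m]) (rule that)
  show thesis by (rule that[of C], unfold_locales) (use m C boundary_fn_periodic in auto)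
qed

text \<open>The free constant in the derivative estimate is chosen as a mean of the boundary
  function near z at scale 1 - |z|, so that the dyadic oscillation bound applies; 24 pi is 48 pi^2
  divided by 2 pi.\<close>

lemma BMOA_imp_Bloch:
  assumes h: "h \<in> BMOA"
  obtains B where "B \<ge> 0" "\<And>z. norm z < 1 \<Longrightarrow> (1 - norm z) * norm (deriv h z) \<le> B"
proof -
  obtain C where "bmo_fn (boundary_fn h) C" by (rule BMOA_bmo_fn[OF h]) (rule that)
  then interpret bmo_fn "boundary_fn h" C .
  have h1: "h \<in> hardy1" using h by (simp add: BMOA_def)
  show thesis
  proof (rule that[of "24 * pi * C"])
    fix z :: complex assume z: "norm z < 1"
    define r where "r = norm z"
    have r: "0 \<le> r" "r < 1" using z by (auto simp: r_def)
    have zr: "z = of_real r * cis (Arg z)" using rcis_cmod_Arg[of z] by (simp add: r_def rcis_def)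
    obtain c where c: "(\<integral>\<^sup>+t. ennreal (norm (boundary_fn h t - c)) * ennreal (1 / (norm (cis t - of_real r * cis (Arg z)))^2) \<partial>arc_meas 0 (2*pi))
       \<le> ennreal (48 * pi^2 * C / (1 - r))" using kernel_osc_bound[OF r] by blast
    note [measurable] = borel_measurable_circle_kernel[OF r, of "Arg z"]
    have "ennreal (norm (deriv h z)) \<le> (\<integral>\<^sup>+t. ennreal (norm (boundary_fn h t - c) / (2*pi * (norm (cis t - z))^2)) \<partial>arc_meas 0 (2*pi))"
      by (rule norm_deriv_le_boundary[OF h1 z])
    also have "\<dots> = (\<integral>\<^sup>+t. ennreal (1 / (2*pi)) * (ennreal (norm (boundary_fn h t - c)) * ennreal (1 / (norm (cis t - z))^2)) \<partial>arc_meas 0 (2*pi))"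
      by (intro nn_integral_cong) (simp add: ennreal_mult[symmetric])
    also have "\<dots> = (\<integral>\<^sup>+t. ennreal (1 / (2*pi)) * (ennreal (norm (boundary_fn h t - c)) * ennreal (1 / (norm (cis t - of_real r * cis (Arg z)))^2)) \<partial>arc_meas 0 (2*pi))"
      using zr by simp
    also have "\<dots> = ennreal (1 / (2*pi)) * (\<integral>\<^sup>+t. ennreal (norm (boundary_fn h t - c)) * ennreal (1 / (norm (cis t - of_real r * cis (Arg z)))^2) \<partial>arc_meas 0 (2*pi))"
      by (rule nn_integral_cmult) measurable
    also have "\<dots> \<le> ennreal (1 / (2*pi)) * ennreal (48 * pi^2 * C / (1 - r))" by (intro mult_left_mono c) auto
    also have "\<dots> = ennreal (24 * pi * C / (1 - r))"
      using C0 r by (subst ennreal_mult[symmetric]) (auto simp: power2_eq_square)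
    finally have "norm (deriv h z) \<le> 24 * pi * C / (1 - r)" using C0 r by (simp add: ennreal_le_iff)
    then show "(1 - norm z) * norm (deriv h z) \<le> 24 * pi * C" using r by (simp add: r_def pos_le_divide_eq mult.commute)
  qed (use C0 in auto)
qed

subsection \<open>Lacunary coefficients\<close>

text \<open>A discrete form of integrating 1/t^3: for points at least \<delta> apart, inverse cubes
  are dominated by telescoping differences of inverse squares.\<close>

lemma inverse_cube_telescope:
  fixes x y \<delta> :: real
  assumes "x > 0" "\<delta> > 0" "y \<ge> x + \<delta>"
  shows "\<delta> / y^3 \<le> 1 / x^2 - 1 / y^2"
proof -
  have y: "y > 0" using assms by simp
  have "\<delta> * x^2 \<le> (y - x) * x^2" using assms by (intro mult_right_mono) auto
  also have "\<dots> \<le> (y - x) * (y * (y + x))"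
  proof (rule mult_left_mono)
    have "x * x \<le> y * y" using assms y by (intro mult_mono) auto
    moreover have "0 \<le> x * y" using assms y by simp
    ultimately show "x^2 \<le> y * (y + x)" by (simp add: power2_eq_square algebra_simps)
  qed (use assms in auto)
  finally have "\<delta> * x^2 \<le> y * (y^2 - x^2)" by (simp add: power2_eq_square algebra_simps)
  then have "\<delta> * x^2 / (x^2 * y^3) \<le> y * (y^2 - x^2) / (x^2 * y^3)"
    using assms y by (intro divide_right_mono) auto
  also have "\<dots> = 1 / x^2 - 1 / y^2"
    using assms y by (simp add: field_simps power2_eq_square power3_eq_cube)
  finally show ?thesis using assms y by simp
qed

lemma tail_sum_inverse_cube:
  fixes l :: "nat \<Rightarrow> real"
  assumes pos: "\<And>k. l k > 0" and \<delta>: "\<delta> > 0" and step: "\<And>k. l (Suc k) \<ge> l k + \<delta>"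
  shows "(\<Sum>k<n. 1 / (l (k + m))^3) \<le> 1 / (l m)^3 + 1 / (\<delta> * (l m)^2)"
proof -
  \<comment> \<open>For n > 0 the right side collapses to \<delta> / (l m)^3 + 1 / (l m)^2 minus the
    inverse square at the last index n + m - 1; the conditional takes care of n = 0. The term
    \<delta> / (l m)^3 is the first summand, which has no predecessor to telescope with.\<close>
  have "\<delta> * (\<Sum>k<n. 1 / (l (k + m))^3) \<le> \<delta> / (l m)^3 + 1 / (l m)^2 - 1 / (l (n + m))^2 + (if n = 0 then 0 else 1 / (l (n+m))^2 - 1 / (l (n + m - 1))^2)"
    for n
  proof (induction n)
    case 0 then show ?case using pos[of m] \<delta> by simp
  next
    case (Suc n)
    show ?case
    proof (cases n)
      case 0 then show ?thesis by simp
    next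
      case (Suc k)
      have "\<delta> / (l (n + m))^3 \<le> 1 / (l (k + m))^2 - 1 / (l (n + m))^2"
        using inverse_cube_telescope[OF pos \<delta>, of "k + m" "l (n + m)"] step[of "k + m"] by (simp add: Suc)
      then show ?thesis using Suc.IH Suc by (simp add: distrib_left)
    qed
  qed
  note main = this[of n]
  have le: "\<delta> * (\<Sum>k<n. 1 / (l (k + m))^3) \<le> \<delta> / (l m)^3 + 1 / (l m)^2"
  proof (cases "n = 0")
    case True
    then show ?thesis using pos[of m] \<delta> by simp
  next
    case False
    have "1 / (l (n + m - 1))^2 \<ge> 0" by simp
    then show ?thesis using main[unfolded if_not_P[OF False]] by linarith
  qed
  have "(\<Sum>k<n. 1 / (l (k + m))^3) \<le> (\<delta> / (l m)^3 + 1 / (l m)^2) / \<delta>" using \<delta> le by (simp add: pos_le_divide_eq mult.commute)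
  also have "\<dots> = 1 / (l m)^3 + 1 / (\<delta> * (l m)^2)" using \<delta> by (simp add: add_divide_distrib mult.commute)
  finally show ?thesis .
qed

text \<open>Here x k stands for |a_k| and l k for ln n_k. The lacunary ratio becomes an additive
  step, with \<delta> = ln lam.\<close>

locale log_weights =
  fixes x l :: "nat \<Rightarrow> real" and \<delta> :: real
  assumes x0: "\<And>k. x k \<ge> 0" and lpos: "\<And>k. l k > 0" and \<delta>: "\<delta> > 0"
    and step: "\<And>k. l (Suc k) \<ge> l k + \<delta>"
    and sm: "summable (\<lambda>k. (x k)^2 * (l k)^3)"
begin

definition A :: real where "A = (\<Sum>k. (x k)^2 * (l k)^3)"
definition D :: real where "D = 1 / l 0 + 1 / \<delta>"

lemma l_mono: "i \<le> j \<Longrightarrow> l i \<le> l j"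
proof (rule lift_Suc_mono_le[of l])
  show "l n \<le> l (Suc n)" for n using step[of n] \<delta> by linarith
qed

lemma l_ge: "l k \<ge> l 0 + real k * \<delta>"
proof (induction k)
  case (Suc k)
  then show ?case using step[of k] by (simp add: distrib_right)
qed simp

lemma term_nonneg: "0 \<le> (x k)^2 * (l k)^3"
  using lpos[of k] by simp

lemma A_nonneg: "A \<ge> 0" unfolding A_def by (rule suminf_nonneg[OF sm term_nonneg])
lemma D_nonneg: "D \<ge> 0" unfolding D_def using lpos[of 0] \<delta> by auto

text \<open>Cauchy--Schwarz with the weight (l k)^(3/2) and its inverse. The inverse cubes add up to
  at most D / (l m)^2, and the square root of this gives the factor 1 / l m.\<close>

lemma tail_sum: "(\<Sum>k<n. x (k + m)) \<le> sqrt (A * D) / l m"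
proof -
  have "(\<Sum>k<n. x (k + m))^2 = (\<Sum>k<n. (x (k + m) * sqrt ((l (k + m))^3)) * (1 / sqrt ((l (k + m))^3)))^2"
  proof -
    have "sqrt ((l k)^3) \<noteq> 0" for k using lpos[of k] by simp
    then show ?thesis by simp
  qed
  also have "\<dots> \<le> (\<Sum>k<n. (x (k + m) * sqrt ((l (k + m))^3))^2) * (\<Sum>k<n. (1 / sqrt ((l (k + m))^3))^2)"
    by (rule Cauchy_Schwarz_ineq_sum)
  also have "\<dots> = (\<Sum>k<n. (x (k + m))^2 * (l (k + m))^3) * (\<Sum>k<n. 1 / (l (k + m))^3)"
  proof -
    have "(sqrt ((l k)^3))^2 = (l k)^3" for k using lpos[of k] by simp
    then show ?thesis by (simp add: power_mult_distrib power_divide)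
  qed
  also have "\<dots> \<le> A * (1 / (l m)^3 + 1 / (\<delta> * (l m)^2))"
  proof (rule mult_mono)
    have "(\<Sum>k<n. (x (k + m))^2 * (l (k + m))^3) = (\<Sum>k\<in>{m..<n+m}. (x k)^2 * (l k)^3)"
      using sum.shift_bounds_nat_ivl[of "\<lambda>k. (x k)^2 * (l k)^3" 0 m n] by (simp only: lessThan_atLeast0 add_0)
    also have "\<dots> \<le> A" unfolding A_def by (rule sum_le_suminf[OF sm]) (simp_all only: term_nonneg finite_atLeastLessThan)
    finally show "(\<Sum>k<n. (x (k + m))^2 * (l (k + m))^3) \<le> A" .
    show "(\<Sum>k<n. 1 / (l (k + m))^3) \<le> 1 / (l m)^3 + 1 / (\<delta> * (l m)^2)"
      by (rule tail_sum_inverse_cube) (use lpos \<delta> step in auto)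
    show "0 \<le> A" by (rule A_nonneg)
    have "0 \<le> 1 / (l k)^3" for k using lpos[of k] by simp
    then show "0 \<le> (\<Sum>k<n. 1 / (l (k + m))^3)" by (intro sum_nonneg)
  qed
  also have "\<dots> \<le> A * (D / (l m)^2)"
  proof (rule mult_left_mono[OF _ A_nonneg])
    have "1 / (l m)^3 = 1 / l m * (1 / (l m)^2)" by (simp add: power2_eq_square power3_eq_cube)
    also have "\<dots> \<le> 1 / l 0 * (1 / (l m)^2)"
      using l_mono[of 0 m] lpos by (intro mult_right_mono divide_left_mono) auto
    finally show "1 / (l m)^3 + 1 / (\<delta> * (l m)^2) \<le> D / (l m)^2" by (simp add: D_def add_divide_distrib)
  qed
  also have "\<dots> = (sqrt (A * D) / l m)^2" using A_nonneg D_nonneg by (simp add: power_divide)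
  finally show ?thesis
    by (rule power2_le_imp_le) (use A_nonneg D_nonneg lpos[of m] in \<open>auto intro!: divide_nonneg_pos\<close>)
qed

lemma summable_x: "summable x"
proof (rule bounded_imp_summable)
  show "(\<Sum>k\<le>n. x k) \<le> sqrt (A * D) / l 0" for n using tail_sum[where n = "Suc n" and m = 0] by (simp add: lessThan_Suc_atMost)
qed (use x0 in auto)

text \<open>Either x^q is at most x^2 l^3, which is summable, or x^(2-q) < l^-3 and hence x^q \<le>
  l^-s with s = 3 q / (2 - q). Since l grows at least linearly, the second bound is summable when s
  > 1, that is for q > 1/2.\<close>

lemma summable_x_powr:
  assumes q: "1/2 < q" "q \<le> 1" shows "summable (\<lambda>k. x k powr q)"
proof -
  define s where "s = 3 * q / (2 - q)"
  have s: "s > 1" using q by (simp add: s_def field_simps)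
  have bd: "x k powr q \<le> (x k)^2 * (l k)^3 + (l k) powr (-s)" for k
  proof (cases "x k powr q \<le> (x k)^2 * (l k)^3")
    case True then show ?thesis by (simp add: add_increasing2)
  next
    case False
    have xp: "x k > 0" using False x0[of k] lpos[of k] by (cases "x k = 0") auto
    have "(x k)^2 * (l k)^3 = x k powr q * (x k powr (2 - q) * l k powr 3)"
      using xp lpos[of k] by (simp add: powr_add[symmetric] powr_numeral)
    then have "x k powr (2 - q) * l k powr 3 < 1" using False xp by (simp add: not_le mult_less_cancel_left1)
    then have "x k powr (2 - q) \<le> l k powr (-3)" using lpos[of k] by (simp add: powr_minus field_simps)
    then have "(x k powr (2 - q)) powr (q / (2 - q)) \<le> (l k powr (-3)) powr (q / (2 - q))"
      using q by (intro powr_mono2) auto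
    then have "x k powr q \<le> l k powr (-s)" using q by (simp add: powr_powr s_def)
    then show ?thesis using lpos[of k] by (simp add: add_increasing less_imp_le)
  qed
  have sp: "summable (\<lambda>k. (l k) powr (-s))"
  proof (rule summable_comparison_test_ev)
    show "summable (\<lambda>k. \<delta> powr (-s) * real k powr (-s))"
      using s by (intro summable_mult) (simp add: summable_real_powr_iff)
    show "\<forall>\<^sub>F k in sequentially. norm (l k powr (-s)) \<le> \<delta> powr (-s) * real k powr (-s)"
    proof (rule eventually_sequentiallyI[of 1])
      fix k :: nat assume k: "1 \<le> k"
      have "l k powr (-s) \<le> (real k * \<delta>) powr (-s)"
        using l_ge[of k] lpos[of 0] s k \<delta> by (intro powr_mono2') auto
      then show "norm (l k powr (-s)) \<le> \<delta> powr (-s) * real k powr (-s)" using \<delta> by (simp add: powr_mult mult.commute)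
    qed
  qed
  show ?thesis
    by (rule summable_comparison_test'[OF summable_add[OF sm sp], of 0]) (use bd in simp)
qed

text \<open>The sum is cut where n k reaches 1 / sqrt h. Below the cut n k * h \<le> sqrt h; above
  it l k is at least ln (1/h) / 2, and the tail estimate gives the logarithmic term.\<close>

lemma suminf_min_le:
  assumes h: "0 < h" "h < 1" and n: "\<And>k. l k = ln (n k)" "\<And>k. n k > 0"
  shows "(\<Sum>k. x k * min 1 (n k * h)) \<le> sqrt h * suminf x + 2 * sqrt (A * D) / ln (1 / h)"
proof -
  have sumx: "summable (\<lambda>k. x k * min 1 (n k * h))"
    by (rule summable_comparison_test[OF _ summable_x]) (use x0 h n in \<open>auto simp: abs_mult mult_left_le less_imp_le\<close>)
  have L: "ln (1 / h) > 0" using h by simp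
  have AD: "sqrt (A * D) \<ge> 0" using A_nonneg D_nonneg by simp
  have sx: "suminf x \<ge> 0" by (rule suminf_nonneg[OF summable_x x0])
  have "(\<Sum>k<N. x k * min 1 (n k * h)) \<le> sqrt h * suminf x + 2 * sqrt (A * D) / ln (1 / h)" for N
  proof -
    define S where "S = {k. k < N \<and> n k * sqrt h > 1}"
    have S: "finite S" "S \<subseteq> {..<N}" by (auto simp: S_def)
    have "(\<Sum>k<N. x k * min 1 (n k * h)) = (\<Sum>k\<in>{..<N} - S. x k * min 1 (n k * h)) + (\<Sum>k\<in>S. x k * min 1 (n k * h))"
      by (rule sum.subset_diff[OF S(2)]) simp
    also have "(\<Sum>k\<in>{..<N} - S. x k * min 1 (n k * h)) \<le> (\<Sum>k\<in>{..<N} - S. x k * sqrt h)"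
    proof (intro sum_mono mult_left_mono x0)
      fix k assume "k \<in> {..<N} - S"
      then have "n k * sqrt h \<le> 1" by (auto simp: S_def)
      then have "n k * sqrt h * sqrt h \<le> 1 * sqrt h" using h by (intro mult_right_mono) auto
      then have "n k * (sqrt h * sqrt h) \<le> sqrt h" by (simp only: mult.assoc mult_1)
      then have "n k * h \<le> sqrt h" using h by simp
      then show "min 1 (n k * h) \<le> sqrt h" by (rule min.coboundedI2)
    qed
    also have "\<dots> = sqrt h * (\<Sum>k\<in>{..<N} - S. x k)" by (simp add: sum_distrib_left mult.commute)
    also have "\<dots> \<le> sqrt h * suminf x"
      using h by (intro mult_left_mono sum_le_suminf[OF summable_x]) (auto simp: x0)
    also have "(\<Sum>k\<in>S. x k * min 1 (n k * h)) \<le> (\<Sum>k\<in>S. x k)"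
      by (intro sum_mono) (use x0 in \<open>auto intro!: mult_left_le\<close>)
    also have "(\<Sum>k\<in>S. x k) \<le> 2 * sqrt (A * D) / ln (1 / h)"
    proof (cases "S = {}")
      case True then show ?thesis using AD L by simp
    next
      case False
      define m where "m = Min S"
      have m: "m \<in> S" "\<And>k. k \<in> S \<Longrightarrow> m \<le> k" using S False by (auto simp: m_def)
      have "(\<Sum>k\<in>S. x k) \<le> (\<Sum>k\<in>{m..<N+m}. x k)" by (rule sum_mono2) (use m S x0 in auto)
      also have "\<dots> = (\<Sum>k<N. x (k + m))"
        using sum.shift_bounds_nat_ivl[of x 0 m N] by (simp only: lessThan_atLeast0 add_0)
      also have "\<dots> \<le> sqrt (A * D) / l m" by (rule tail_sum)
      also have "\<dots> \<le> sqrt (A * D) / (ln (1 / h) / 2)"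
      proof (intro divide_left_mono AD)
        have "1 < n m * sqrt h" using m(1) by (simp add: S_def)
        then have "0 < ln (n m * sqrt h)" by simp
        also have "\<dots> = l m + ln h / 2" using n(1)[of m] n(2)[of m] h by (simp add: ln_mult ln_sqrt)
        finally show "ln (1 / h) / 2 \<le> l m" using h by (simp add: ln_div)
        show "0 < l m * (ln (1 / h) / 2)" using lpos L by simp
      qed
      finally show ?thesis by (simp add: mult.commute)
    qed
    finally show ?thesis by simp
  qed
  then show ?thesis by (rule suminf_le_const[OF sumx])
qed

end

text \<open>The consequences of lacunarity from which both multiplier statements follow: the third
  conjunct becomes the modulus of continuity of the boundary function at dyadic scales, the fourth
  the area estimate. The pair (b, m) may differ from the given representation.\<close>

definition lacunary_mult_series :: "(complex \<Rightarrow> complex) \<Rightarrow> (nat \<Rightarrow> complex) \<Rightarrow> (nat \<Rightarrow> nat) \<Rightarrow> bool" where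
  "lacunary_mult_series f b m \<longleftrightarrow> (\<forall>z\<in>ball 0 1. (\<lambda>k. b k * z ^ m k) sums f z) \<and>
     summable (\<lambda>k. norm (b k)) \<and>
     (\<exists>B\<ge>0. \<forall>j. (\<Sum>k. norm (b k) * min 1 (real (m k) * rho j)) \<le> B / (real j + 1)) \<and>
     (\<forall>q. 1/2 < q \<longrightarrow> q \<le> 1 \<longrightarrow> summable (\<lambda>k. norm (b k) powr q))"

lemma lacunary_reprD:
  assumes "lacunary_repr f a n lam"
  shows "\<exists>b m. lacunary_mult_series f b m"
proof -
  have lam: "lam > 1" and gap: "\<And>k. real (n (Suc k)) \<ge> lam * real (n k)"
    and sums: "\<And>z. z \<in> ball 0 1 \<Longrightarrow> (\<lambda>k. a k * z ^ n k) sums f z"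
    and sm: "summable (\<lambda>k. norm (a (Suc k)) ^ 2 * (ln (real (n (Suc k)))) ^ 3)"
    using assms unfolding lacunary_repr_def by auto
  show ?thesis
  proof (cases "\<forall>k. n k = 0")
    case True
    \<comment> \<open>With all exponents 0 the convention ln 0 = 0 empties the weighted condition,
      and the coefficients need not be absolutely summable. But f is then constant, so a series with
      one nonzero term replaces them.\<close>
    have f0: "f z = f 0" if "z \<in> ball 0 1" for z
      using sums[OF that] sums[of 0] True by (simp add: sums_iff)
    define b :: "nat \<Rightarrow> complex" where "b = (\<lambda>k. if k = 0 then f 0 else 0)"
    have fin: "summable (\<lambda>k. g (b k))" if "g 0 = (0::real)" for g
      by (rule summable_finite[of "{0}"]) (auto simp: b_def that)
    have "(\<lambda>k. b k * z ^ 0) sums f z" if "z \<in> ball 0 1" for z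
      using sums_finite[of "{0}" b] f0[OF that] by (simp add: b_def)
    then have "lacunary_mult_series f b (\<lambda>_. 0)"
      unfolding lacunary_mult_series_def using fin[of norm] fin[of "\<lambda>x. norm x powr _"]
      by (auto intro!: exI[of _ 0])
    then show ?thesis by blast
  next
    case False
    then obtain K where K: "n K \<ge> 1" by (metis less_one not_le)
    \<comment> \<open>At K the exponent may be 1, with logarithm 0; one step later all exponents
      exceed 1 and the weights are positive.\<close>
    define K' where "K' = Suc K"
    have big: "real (n (k + K)) \<ge> lam ^ k" for k
    proof (induction k)
      case 0 then show ?case using K by simp
    next
      case (Suc k)
      have "lam ^ Suc k \<le> lam * real (n (k + K))" using Suc lam by simp
      also have "\<dots> \<le> real (n (Suc k + K))" using gap[of "k + K"] by simp
      finally show ?case .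
    qed
    define N where "N = (\<lambda>k. real (n (k + K')))"
    define x where "x = (\<lambda>k. norm (a (k + K')))"
    define l where "l = (\<lambda>k. ln (N k))"
    have N1: "N k > 1" for k
    proof -
      have "1 < lam ^ Suc k" using lam by (rule one_less_power) simp
      also have "\<dots> \<le> N k" using big[of "Suc k"] by (simp add: N_def K'_def)
      finally show ?thesis .
    qed
    interpret log_weights x l "ln lam"
    proof
      show "x k \<ge> 0" for k by (simp add: x_def)
      show "l k > 0" for k using N1[of k] by (simp add: l_def)
      show "ln lam > 0" using lam by simp
      show "l (Suc k) \<ge> l k + ln lam" for k
      proof -
        have "lam * N k \<le> N (Suc k)" using gap[of "k + K'"] by (simp add: N_def)
        then have "ln (lam * N k) \<le> ln (N (Suc k))" using lam N1[of k] by (intro ln_mono) auto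
        moreover have "ln (lam * N k) = ln lam + ln (N k)" using lam N1[of k] by (intro ln_mult_pos) auto
        ultimately show ?thesis by (simp add: l_def)
      qed
      have "summable (\<lambda>k. norm (a (Suc (k + K))) ^ 2 * (ln (real (n (Suc (k + K))))) ^ 3)"
        using summable_iff_shift[of "\<lambda>k. norm (a (Suc k)) ^ 2 * (ln (real (n (Suc k)))) ^ 3" K] sm by simp
      then show "summable (\<lambda>k. (x k)^2 * (l k)^3)" by (simp add: x_def l_def N_def K'_def)
    qed
    have sa: "summable (\<lambda>k. norm (a k))"
      using summable_x summable_iff_shift[of "\<lambda>k. norm (a k)" K'] by (simp add: x_def)
    have sq: "summable (\<lambda>k. norm (a k) powr q)" if "1/2 < q" "q \<le> 1" for q
      using summable_x_powr[OF that] summable_iff_shift[of "\<lambda>k. norm (a k) powr q" K'] by (simp add: x_def)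
    define U where "U = (\<lambda>j. \<Sum>k. norm (a k) * min 1 (real (n k) * rho j))"
    define S where "S = (\<Sum>k. norm (a k))"
    have S0: "S \<ge> 0" unfolding S_def by (rule suminf_nonneg[OF sa]) auto
    have sU: "summable (\<lambda>k. norm (a k) * min 1 (real (n k) * rho j))" for j
      by (rule summable_comparison_test'[OF sa, of 0]) (auto simp: abs_mult intro!: mult_left_le)
    have US: "U j \<le> S" for j unfolding U_def S_def
      by (rule suminf_le[OF _ sU sa]) (auto intro!: mult_left_le)
    define C1 where "C1 = (\<Sum>k<K'. norm (a k) * real (n k))"
    \<comment> \<open>Three contributions, each multiplied by j + 1: the finitely many initial
      terms, the exponents below the cut, and the tail. The first two tend to 0 and the third has a
      finite limit, so V is bounded.\<close>
    define V where "V = (\<lambda>j::nat. C1 * ((real j + 1) * (pi / 2 ^ j)) + (real j + 1) * sqrt (pi / 2 ^ j) * suminf x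
        + 2 * sqrt (A * D) * ((real j + 1) / ln (2 ^ j / pi)))"
    have t1: "(\<lambda>j. (real j + 1) * (pi / 2 ^ j)) \<longlonglongrightarrow> 0" and t2: "(\<lambda>j. (real j + 1) * sqrt (pi / 2 ^ j)) \<longlonglongrightarrow> 0"
      by real_asymp+
    have t3: "(\<lambda>j. (real j + 1) / ln (2 ^ j / pi)) \<longlonglongrightarrow> inverse (ln 2)" by real_asymp
    have "V \<longlonglongrightarrow> C1 * 0 + 0 * suminf x + 2 * sqrt (A * D) * inverse (ln 2)"
      unfolding V_def
      by (rule tendsto_add[OF tendsto_add[OF tendsto_mult[OF tendsto_const t1] tendsto_mult[OF t2 tendsto_const]] tendsto_mult[OF tendsto_const t3]])
    then have "Bseq V" by (intro convergent_imp_Bseq) (auto simp: convergent_def)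
    then obtain M where M: "\<And>j. norm (V j) \<le> M" by (auto simp: Bseq_def)
    \<comment> \<open>From j = 2 on \<open>rho j\<close> \<le> pi/4 < 1, so the logarithm of 1 /
      \<open>rho j\<close> is positive.\<close>
    have UV: "(real j + 1) * U j \<le> V j" if j: "j \<ge> 2" for j
    proof -
      have r1: "rho j < 1"
      proof -
        have "rho j \<le> rho 2" by (rule rho_mono[OF j])
        also have "rho 2 < 1" using pi_less_4 by (simp add: rho_def)
        finally show ?thesis .
      qed
      have "U j = (\<Sum>k. norm (a (k + K')) * min 1 (real (n (k + K')) * rho j)) + (\<Sum>k<K'. norm (a k) * min 1 (real (n k) * rho j))"
        unfolding U_def by (rule suminf_split_initial_segment[OF sU])
      also have "(\<Sum>k<K'. norm (a k) * min 1 (real (n k) * rho j)) \<le> (\<Sum>k<K'. norm (a k) * (real (n k) * rho j))"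
        by (intro sum_mono mult_left_mono) auto
      also have "\<dots> = C1 * rho j" by (simp add: C1_def sum_distrib_right mult.assoc)
      also have "(\<Sum>k. norm (a (k + K')) * min 1 (real (n (k + K')) * rho j)) = (\<Sum>k. x k * min 1 (N k * rho j))"
        by (simp add: x_def N_def)
      also have "\<dots> \<le> sqrt (rho j) * suminf x + 2 * sqrt (A * D) / ln (1 / rho j)"
      proof (rule suminf_min_le)
        show "N k > 0" for k using N1[of k] by simp
      qed (use r1 in \<open>auto simp: l_def\<close>)
      finally have "U j \<le> sqrt (rho j) * suminf x + 2 * sqrt (A * D) / ln (1 / rho j) + C1 * rho j" by simp
      then have "(real j + 1) * U j \<le> (real j + 1) * (sqrt (rho j) * suminf x + 2 * sqrt (A * D) / ln (1 / rho j) + C1 * rho j)"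
        by (intro mult_left_mono) auto
      also have "\<dots> = V j" by (simp add: V_def rho_def algebra_simps)
      finally show ?thesis .
    qed
    define B where "B = max M (2 * S)"
    have "U j \<le> B / (real j + 1)" for j
    proof -
      have "(real j + 1) * U j \<le> B"
      proof (cases "j \<ge> 2")
        case True
        then have "(real j + 1) * U j \<le> M" using UV[OF True] M[of j] by simp
        then show ?thesis unfolding B_def by (rule max.coboundedI1)
      next
        case False
        then have "real j + 1 \<le> 2" by linarith
        then have "(real j + 1) * S \<le> 2 * S" using S0 by (intro mult_right_mono) auto
        moreover have "(real j + 1) * U j \<le> (real j + 1) * S" using US by (intro mult_left_mono) auto
        ultimately show ?thesis unfolding B_def by (intro max.coboundedI2) linarith
      qed
      then show ?thesis by (simp add: pos_le_divide_eq mult.commute)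
    qed
    moreover have "B \<ge> 0" using S0 by (simp add: B_def)
    ultimately have "lacunary_mult_series f a n"
      unfolding lacunary_mult_series_def U_def using sums sa sq by auto
    then show ?thesis by blast
  qed
qed

subsection \<open>Multiplication of BMOA by a lacunary series\<close>

lemma norm_cis_diff_le: "norm (cis a - cis b) \<le> \<bar>a - b\<bar>"
proof -
  define x where "x = a - b"
  have "cis a - cis b = cis b * (cis x - 1)" by (simp add: x_def right_diff_distrib cis_mult)
  then have "norm (cis a - cis b) = norm (cis x - 1)" by (simp add: norm_mult)
  also have "\<dots> \<le> \<bar>x\<bar>"
  proof (rule power2_le_imp_le)
    have "cos x = 1 - 2 * (sin (x/2))^2" using cos_double_sin[of "x/2"] by simp
    moreover have "(norm (cis x - 1))^2 = ((cos x)^2 + (sin x)^2) - 2 * cos x + 1"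
      by (simp add: cmod_power2 power2_diff)
    ultimately have "(norm (cis x - 1))^2 = (2 * sin (x/2))^2"
      unfolding sin_cos_squared_add2 by (simp add: power2_eq_square)
    also have "\<dots> = (2 * \<bar>sin (x/2)\<bar>)^2" by (simp add: power2_eq_square)
    also have "\<dots> \<le> \<bar>x\<bar>^2"
      using abs_sin_x_le_abs_x[of "x/2"] by (intro power_mono) auto
    finally show "(norm (cis x - 1))^2 \<le> \<bar>x\<bar>^2" .
  qed simp
  finally show ?thesis by (simp add: x_def)
qed

locale mult_series =
  fixes f :: "complex \<Rightarrow> complex" and b :: "nat \<Rightarrow> complex" and m :: "nat \<Rightarrow> nat"
  assumes hol: "f holomorphic_on ball 0 1" and lms: "lacunary_mult_series f b m"
begin

lemma sums: "z \<in> ball 0 1 \<Longrightarrow> (\<lambda>k. b k * z ^ m k) sums f z"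
  and sb: "summable (\<lambda>k. norm (b k))"
  using lms by (auto simp: lacunary_mult_series_def)

definition S :: real where "S = (\<Sum>k. norm (b k))"
text \<open>Only values of f in the open disc are constrained; the series itself supplies the
  continuous extension to the closed disc, whose boundary function is \<open>F\<close>.\<close>

definition \<Phi> :: "complex \<Rightarrow> complex" where "\<Phi> z = (\<Sum>k. b k * z ^ m k)"
definition F :: "real \<Rightarrow> complex" where "F t = \<Phi> (cis t)"

lemma term_le: "norm z \<le> 1 \<Longrightarrow> norm (b k * z ^ m k) \<le> norm (b k)"
  by (simp add: norm_mult norm_power mult_left_le power_le_one)

lemma summable_terms: "norm z \<le> 1 \<Longrightarrow> summable (\<lambda>k. b k * z ^ m k)"
  by (rule summable_comparison_test'[OF sb, of 0]) (use term_le in auto)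

lemma S_nonneg: "S \<ge> 0" unfolding S_def by (rule suminf_nonneg[OF sb]) auto

lemma norm_\<Phi>_le: "norm z \<le> 1 \<Longrightarrow> norm (\<Phi> z) \<le> S"
  unfolding \<Phi>_def S_def by (rule norm_suminf_le[OF term_le sb])

lemma \<Phi>_eq: "z \<in> ball 0 1 \<Longrightarrow> \<Phi> z = f z"
  using sums[of z] by (simp add: \<Phi>_def sums_iff)

lemma norm_f_le: "z \<in> ball 0 1 \<Longrightarrow> norm (f z) \<le> S"
  using norm_\<Phi>_le[of z] \<Phi>_eq[of z] by simp

lemma continuous_\<Phi>: "continuous_on (cball 0 1) \<Phi>"
proof (rule uniform_limit_theorem)
  show "uniform_limit (cball 0 1) (\<lambda>n z. \<Sum>k<n. b k * z ^ m k) \<Phi> sequentially"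
    unfolding \<Phi>_def by (rule Weierstrass_m_test[OF _ sb]) (use term_le in auto)
qed (auto intro!: always_eventually continuous_intros)

lemma norm_F_le: "norm (F t) \<le> S" unfolding F_def by (rule norm_\<Phi>_le) simp

lemma F_measurable: "F \<in> borel_measurable borel"
  unfolding F_def
  by (intro borel_measurable_continuous_onI continuous_on_compose2[OF continuous_\<Phi>] continuous_intros) auto

lemma f_radial_limit: "((\<lambda>r::real. f (of_real r * cis t)) \<longlongrightarrow> F t) (at_left 1)"
proof -
  have "((\<lambda>r::real. of_real r * cis t) \<longlongrightarrow> of_real 1 * cis t) (at_left 1)" by (intro tendsto_intros)
  moreover have ev: "eventually (\<lambda>r::real. 0 < r \<and> r < 1) (at_left 1)"
    using eventually_at_left_field[of _ "1::real"] zero_less_one by blast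
  moreover have "eventually (\<lambda>r::real. of_real r * cis t \<in> cball (0::complex) 1) (at_left 1)"
    using ev by eventually_elim (auto simp: norm_mult)
  ultimately have "((\<lambda>r::real. \<Phi> (of_real r * cis t)) \<longlongrightarrow> \<Phi> (of_real 1 * cis t)) (at_left 1)"
    by (intro continuous_on_tendsto_compose[OF continuous_\<Phi>]) auto
  moreover have "eventually (\<lambda>r::real. \<Phi> (of_real r * cis t) = f (of_real r * cis t)) (at_left 1)"
    using ev by eventually_elim (auto simp: norm_mult intro!: \<Phi>_eq)
  ultimately show ?thesis by (simp add: F_def tendsto_cong)
qed

text \<open>A monomial changes by at most 2 between any two points of the circle and by at most m k
  times the difference of the angles; summing the smaller bound gives the third conjunct of
  \<open>lacunary_mult_series\<close>.\<close>

lemma F_modulus: "\<exists>B\<ge>0. \<forall>s t j. \<bar>s - t\<bar> \<le> rho j \<longrightarrow> norm (F s - F t) \<le> B / (real j + 1)"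
proof -
  obtain B where B: "B \<ge> 0" "\<And>j. (\<Sum>k. norm (b k) * min 1 (real (m k) * rho j)) \<le> B / (real j + 1)"
    using lms by (auto simp: lacunary_mult_series_def)
  have "norm (F s - F t) \<le> 2 * B / (real j + 1)" if st: "\<bar>s - t\<bar> \<le> rho j" for s t j
  proof -
    have sm: "summable (\<lambda>k. norm (b k) * min 1 (real (m k) * rho j))"
      by (rule summable_comparison_test'[OF sb, of 0]) (auto simp: abs_mult intro!: mult_left_le)
    have le: "norm (b k * cis s ^ m k - b k * cis t ^ m k) \<le> 2 * (norm (b k) * min 1 (real (m k) * rho j))" for k
    proof -
      have "norm (cis s ^ m k - cis t ^ m k) \<le> 2 * min 1 (real (m k) * rho j)"
      proof -
        have "norm (cis s ^ m k - cis t ^ m k) \<le> \<bar>real (m k) * s - real (m k) * t\<bar>"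
          unfolding Complex.DeMoivre by (rule norm_cis_diff_le)
        also have "\<dots> = real (m k) * \<bar>s - t\<bar>" by (simp add: right_diff_distrib[symmetric] abs_mult)
        also have "\<dots> \<le> real (m k) * rho j" using st by (intro mult_left_mono) auto
        finally have "norm (cis s ^ m k - cis t ^ m k) \<le> real (m k) * rho j" .
        moreover have "0 \<le> real (m k) * rho j" by simp
        moreover have "norm (cis s ^ m k - cis t ^ m k) \<le> 2"
          using norm_triangle_ineq4[of "cis s ^ m k" "cis t ^ m k"] by (simp add: norm_power)
        ultimately show ?thesis unfolding min_def by (simp only: split: if_split) linarith
      qed
      then have "norm (b k) * norm (cis s ^ m k - cis t ^ m k) \<le> norm (b k) * (2 * min 1 (real (m k) * rho j))"
        by (rule mult_left_mono) simp
      then show ?thesis by (simp add: right_diff_distrib[symmetric] norm_mult mult.left_commute)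
    qed
    have "F s - F t = (\<Sum>k. b k * cis s ^ m k - b k * cis t ^ m k)"
      unfolding F_def \<Phi>_def by (rule suminf_diff) (auto intro: summable_terms)
    also have "norm \<dots> \<le> (\<Sum>k. 2 * (norm (b k) * min 1 (real (m k) * rho j)))"
      by (rule norm_suminf_le[OF le]) (intro summable_mult sm)
    also have "\<dots> = 2 * (\<Sum>k. norm (b k) * min 1 (real (m k) * rho j))" by (rule suminf_mult[OF sm])
    also have "\<dots> \<le> 2 * (B / (real j + 1))" by (intro mult_left_mono B(2)) auto
    finally show ?thesis by simp
  qed
  then show ?thesis using B(1) by (intro exI[of _ "2 * B"]) auto
qed

lemma mult_hardy1:
  assumes h: "h \<in> hardy1" shows "(\<lambda>z. h z * f z) \<in> hardy1"
proof -
  obtain C where hh: "h holomorphic_on ball 0 1" and C: "C \<ge> 0" "\<And>r. 0 \<le> r \<Longrightarrow> r < 1 \<Longrightarrow>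
      (\<integral>\<^sup>+t. ennreal (norm (h (of_real r * cis t))) \<partial>arc_meas 0 (2*pi)) \<le> ennreal C"
    using h unfolding hardy1_iff by blast
  show ?thesis unfolding hardy1_iff
  proof (intro conjI exI[of _ "S * C"] allI impI)
    show "(\<lambda>z. h z * f z) holomorphic_on ball 0 1" by (intro holomorphic_intros hh hol)
    fix r :: real assume r: "0 \<le> r \<and> r < 1"
    have [measurable]: "(\<lambda>t. h (of_real r * cis t)) \<in> borel_measurable borel"
      by (rule borel_measurable_circle[OF holomorphic_on_imp_continuous_on[OF hh]]) (use r in auto)
    have "(\<integral>\<^sup>+t. ennreal (norm (h (of_real r * cis t) * f (of_real r * cis t))) \<partial>arc_meas 0 (2*pi))
       \<le> (\<integral>\<^sup>+t. ennreal S * ennreal (norm (h (of_real r * cis t))) \<partial>arc_meas 0 (2*pi))"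
    proof (rule nn_integral_mono)
      fix t
      have "norm (f (of_real r * cis t)) \<le> S" by (rule norm_f_le) (use r in \<open>auto simp: norm_mult\<close>)
      then have "norm (h (of_real r * cis t) * f (of_real r * cis t)) \<le> S * norm (h (of_real r * cis t))"
        unfolding norm_mult mult.commute[of S] by (rule mult_left_mono) simp
      then show "ennreal (norm (h (of_real r * cis t) * f (of_real r * cis t))) \<le> ennreal S * ennreal (norm (h (of_real r * cis t)))"
        using S_nonneg by (subst ennreal_mult[symmetric]) (auto intro: ennreal_leI)
    qed
    also have "\<dots> = ennreal S * (\<integral>\<^sup>+t. ennreal (norm (h (of_real r * cis t))) \<partial>arc_meas 0 (2*pi))"
      by (rule nn_integral_cmult) measurable
    also have "\<dots> \<le> ennreal S * ennreal C" by (intro mult_left_mono C) (use r in auto)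
    also have "\<dots> = ennreal (S * C)" using S_nonneg C by (simp add: ennreal_mult)
    finally show "(\<integral>\<^sup>+t. ennreal (norm (h (of_real r * cis t) * f (of_real r * cis t))) \<partial>arc_meas 0 (2*pi)) \<le> ennreal (S * C)" .
  qed (use S_nonneg C in auto)
qed

text \<open>Almost everywhere the boundary function of h f is \<open>F\<close> times that of h, and
  mean oscillation sees functions only up to null sets. The product estimate supplies a constant for
  each arc, which is exchanged for the mean at the price of a factor 2.\<close>

lemma mult_BMOA:
  assumes h: "h \<in> BMOA" shows "(\<lambda>z. h z * f z) \<in> BMOA"
proof -
  have h1: "h \<in> hardy1" using h by (simp add: BMOA_def)
  have hf1: "(\<lambda>z. h z * f z) \<in> hardy1" by (rule mult_hardy1[OF h1])
  obtain C where "bmo_fn (boundary_fn h) C" by (rule BMOA_bmo_fn[OF h]) (rule that)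
  then interpret G: bmo_fn "boundary_fn h" C .
  define W where "W = boundary_fn (\<lambda>z. h z * f z)"
  have W [measurable]: "W \<in> borel_measurable borel" unfolding W_def
    by (intro borel_measurable_boundary_fn holomorphic_on_imp_continuous_on) (use hf1 in \<open>simp add: hardy1_iff\<close>)
  obtain B where B: "B \<ge> 0" "\<And>s t j. \<bar>s - t\<bar> \<le> rho j \<Longrightarrow> norm (F s - F t) \<le> B / (real j + 1)"
    using F_modulus by blast
  obtain c K where K: "K \<ge> 0" "\<And>x y. x < y \<Longrightarrow> y - x \<le> 2*pi \<Longrightarrow>
    (\<integral>\<^sup>+t. ennreal (norm (F t * boundary_fn h t - c x y)) \<partial>arc_meas x y) \<le> ennreal (K * (y - x))"
    by (rule G.log_Lipschitz_mult[OF F_measurable norm_F_le B]) (auto intro: that)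
  have ae: "AE t in arc_meas x y. W t = F t * boundary_fn h t" if "y - x \<le> 2*pi" for x y
    using hardy1_radial_limit_AE_arc[OF h1 that]
  proof eventually_elim
    case (elim t)
    have "((\<lambda>r::real. h (of_real r * cis t) * f (of_real r * cis t)) \<longlongrightarrow> boundary_fn h t * F t) (at_left 1)"
      by (intro tendsto_mult tendsto_boundary_fn[OF elim] f_radial_limit)
    then show ?case unfolding W_def
      using boundary_fn_tendsto[of "\<lambda>z. h z * f z" t] by (simp add: mult.commute)
  qed
  have "bmo_circle W"
    unfolding bmo_circle_def
  proof (intro exI[of _ "2 * K"] allI impI conjI)
    fix x y :: real assume xy: "x < y \<and> y - x \<le> 2*pi"
    then have aexy: "AE t in arc_meas x y. W t = F t * boundary_fn h t" by (intro ae) simp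
    have gi: "integrable (arc_meas x y) (boundary_fn h)"
      using G.int[of x y] xy by (simp add: integrable_arc_meas[OF G.meas])
    have "integrable (arc_meas x y) W"
    proof (rule Bochner_Integration.integrable_bound)
      show "integrable (arc_meas x y) (\<lambda>t. of_real S * boundary_fn h t)" using gi by simp
      show "AE t in arc_meas x y. norm (W t) \<le> norm (of_real S * boundary_fn h t)"
        using aexy
      proof eventually_elim
        case (elim t)
        then show ?case using S_nonneg norm_F_le[of t] by (auto simp: norm_mult intro!: mult_right_mono)
      qed
    qed simp
    then show si: "set_integrable lborel {x..y} W" by (simp add: integrable_arc_meas[OF W])
    have "(\<integral>\<^sup>+ t. indicator {x..y} t * ennreal (norm (W t - (LINT s:{x..y}|lborel. W s) / complex_of_real (y - x))) \<partial>lborel)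
        = (\<integral>\<^sup>+t. ennreal (norm (W t - arc_avg W x y)) \<partial>arc_meas x y)"
      unfolding arc_avg_def by (subst nn_integral_arc_meas) auto
    also have "\<dots> \<le> 2 * (\<integral>\<^sup>+t. ennreal (norm (W t - c x y)) \<partial>arc_meas x y)"
      by (rule arc_avg_optimal[OF W si]) (use xy in simp)
    also have "(\<integral>\<^sup>+t. ennreal (norm (W t - c x y)) \<partial>arc_meas x y) = (\<integral>\<^sup>+t. ennreal (norm (F t * boundary_fn h t - c x y)) \<partial>arc_meas x y)"
      by (rule nn_integral_cong_AE) (use aexy in \<open>auto elim!: eventually_mono\<close>)
    also have "2 * \<dots> \<le> 2 * ennreal (K * (y - x))" by (intro mult_left_mono K) (use xy in auto)
    also have "\<dots> = ennreal (2 * K * (y - x))"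
      using ennreal_mult[of 2 "K * (y - x)"] K(1) xy by (simp add: mult.assoc)
    finally show "(\<integral>\<^sup>+ t. indicator {x..y} t * ennreal (norm (W t - (LINT s:{x..y}|lborel. W s) / complex_of_real (y - x))) \<partial>lborel)
       \<le> ennreal (2 * K * (y - x))" .
  qed
  then show ?thesis using hf1 by (simp add: BMOA_def W_def)
qed

lemma multiplier_BMOA: "f \<in> multipliers BMOA BMOA"
  using hol mult_BMOA by (auto simp: multipliers_def)

end

subsection \<open>Area integrals\<close>

lemma borel_measurable_disc:
  fixes h :: "complex \<Rightarrow> 'b::real_normed_vector"
  assumes "continuous_on (ball 0 1) h"
  shows "(\<lambda>z. indicator (ball 0 1) z *\<^sub>R h z) \<in> borel_measurable borel"
  by (rule borel_measurable_continuous_on_indicator[OF _ assms]) simp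

lemma borel_measurable_disc_nn:
  fixes h :: "complex \<Rightarrow> real"
  assumes "continuous_on (ball 0 1) h"
  shows "(\<lambda>z. indicator (ball 0 1) z * ennreal (h z)) \<in> borel_measurable borel"
proof -
  have "(\<lambda>z. ennreal (indicator (ball 0 1) z *\<^sub>R h z)) \<in> borel_measurable borel"
    using borel_measurable_disc[OF assms] by measurable
  also have "(\<lambda>z. ennreal (indicator (ball 0 1) z *\<^sub>R h z)) = (\<lambda>z. indicator (ball 0 1) z * ennreal (h z))"
    by (auto simp: indicator_def)
  finally show ?thesis .
qed

text \<open>Rotations preserve area and the radial weight, so the disc integral equals its average
  over all rotations. By Fubini |h| is then integrated over circles first, where the H1 bound
  applies.\<close>

lemma hardy1_radial_area:
  assumes h: "h holomorphic_on ball 0 1" and C: "\<And>r. 0 \<le> r \<Longrightarrow> r < 1 \<Longrightarrow>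
      (\<integral>\<^sup>+t. ennreal (norm (h (of_real r * cis t))) \<partial>arc_meas 0 (2*pi)) \<le> ennreal C"
    and \<phi> [measurable]: "\<phi> \<in> borel_measurable borel"
  shows "ennreal (2*pi) * (\<integral>\<^sup>+z. indicator (ball 0 1) z * (\<phi> (norm z) * ennreal (norm (h z))) \<partial>lborel)
    \<le> ennreal C * (\<integral>\<^sup>+z. indicator (ball (0::complex) 1) z * \<phi> (norm z) \<partial>lborel)"
proof -
  define H where "H = (\<lambda>z. indicator (ball 0 1) z * ennreal (norm (h z)))"
  have hc: "continuous_on (ball 0 1) h" by (rule holomorphic_on_imp_continuous_on[OF h])
  have H [measurable]: "H \<in> borel_measurable borel"
    unfolding H_def by (rule borel_measurable_disc_nn) (intro continuous_intros hc)
  have [measurable]: "cis \<in> borel_measurable borel" by (intro borel_measurable_continuous_onI continuous_intros)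
  have m\<phi> [measurable]: "(\<lambda>z::complex. \<phi> (norm z)) \<in> borel_measurable borel" by measurable
  have mI: "(\<lambda>z::complex. indicator (ball 0 1) z * \<phi> (norm z)) \<in> borel_measurable borel"
    by (intro borel_measurable_times_ennreal borel_measurable_indicator m\<phi>) simp
  define I where "I = (\<integral>\<^sup>+z. \<phi> (norm z) * H z \<partial>lborel)"
  have I: "I = (\<integral>\<^sup>+z. indicator (ball 0 1) z * (\<phi> (norm z) * ennreal (norm (h z))) \<partial>lborel)"
    unfolding I_def H_def by (simp add: mult_ac)
  interpret A: finite_measure "arc_meas 0 (2*pi)" by simp
  interpret P: pair_sigma_finite "arc_meas 0 (2*pi)" "lborel :: complex measure" ..
  have "ennreal (2*pi) * I = (\<integral>\<^sup>+t. I \<partial>arc_meas 0 (2*pi))"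
    using nn_integral_const_arc[of 0 "2*pi" I] by (simp add: mult.commute)
  also have "\<dots> = (\<integral>\<^sup>+t. (\<integral>\<^sup>+z. \<phi> (norm z) * H (cis t * z) \<partial>lborel) \<partial>arc_meas 0 (2*pi))"
  proof (rule nn_integral_cong)
    fix t
    have "I = (\<integral>\<^sup>+z. \<phi> (norm (cis t * z)) * H (cis t * z) \<partial>lborel)"
      unfolding I_def by (rule nn_integral_rotate[symmetric, where f = "\<lambda>z. \<phi> (norm z) * H z"]) measurable
    then show "I = (\<integral>\<^sup>+z. \<phi> (norm z) * H (cis t * z) \<partial>lborel)" by (simp add: norm_mult)
  qed
  also have "\<dots> = (\<integral>\<^sup>+z. (\<integral>\<^sup>+t. \<phi> (norm z) * H (cis t * z) \<partial>arc_meas 0 (2*pi)) \<partial>lborel)"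
    by (rule P.Fubini'[symmetric]) measurable
  also have "\<dots> \<le> (\<integral>\<^sup>+z. ennreal C * (indicator (ball (0::complex) 1) z * \<phi> (norm z)) \<partial>lborel)"
  proof (rule nn_integral_mono)
    fix z :: complex
    show "(\<integral>\<^sup>+t. \<phi> (norm z) * H (cis t * z) \<partial>arc_meas 0 (2*pi)) \<le> ennreal C * (indicator (ball (0::complex) 1) z * \<phi> (norm z))"
    proof (cases "norm z < 1")
      case False
      then show ?thesis by (simp add: H_def norm_mult)
    next
      case True
      define r where "r = norm z"
      have r: "0 \<le> r" "r < 1" using True by (auto simp: r_def)
      have zr: "z = of_real r * cis (Arg z)" using rcis_cmod_Arg[of z] by (simp add: r_def rcis_def)
      have rot: "cis t * z = of_real r * cis (t + Arg z)" for t
        by (subst zr) (simp add: cis_mult[symmetric] mult_ac)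
      have m: "(\<lambda>t. ennreal (norm (h (of_real r * cis t)))) \<in> borel_measurable borel"
        using borel_measurable_circle[OF hc r] by measurable
      have "(\<integral>\<^sup>+t. \<phi> (norm z) * H (cis t * z) \<partial>arc_meas 0 (2*pi)) = \<phi> r * (\<integral>\<^sup>+t. H (cis t * z) \<partial>arc_meas 0 (2*pi))"
        unfolding r_def by (rule nn_integral_cmult) measurable
      also have "(\<integral>\<^sup>+t. H (cis t * z) \<partial>arc_meas 0 (2*pi)) = (\<integral>\<^sup>+t. ennreal (norm (h (of_real r * cis (t + Arg z)))) \<partial>arc_meas 0 (2*pi))"
        unfolding rot H_def using r by (intro nn_integral_cong) (simp add: norm_mult)
      also have "\<dots> = (\<integral>\<^sup>+t. ennreal (norm (h (of_real r * cis t))) \<partial>arc_meas (Arg z) (Arg z + 2*pi))"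
        using nn_integral_arc_meas_shift[OF m, where a = 0 and b = "2*pi" and c = "Arg z"] by (simp add: add.commute)
      also have "\<dots> = (\<integral>\<^sup>+t. ennreal (norm (h (of_real r * cis t))) \<partial>arc_meas 0 (2*pi))"
        by (rule nn_integral_arc_meas_periodic[OF m]) (simp add: cis_mult[symmetric])
      also have "\<phi> r * \<dots> \<le> \<phi> r * ennreal C" by (intro mult_left_mono C r) auto
      finally show ?thesis using True by (simp add: r_def mult.commute)
    qed
  qed
  also have "\<dots> = ennreal C * (\<integral>\<^sup>+z. indicator (ball (0::complex) 1) z * \<phi> (norm z) \<partial>lborel)"
    by (rule nn_integral_cmult) (simp add: mI)
  finally show ?thesis unfolding I .
qed

text \<open>The radius is split at 1 - 1/m. Outside, the power of r is dropped and (1-r)^(q-1)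
  integrated; inside, (1-r)^(q-1) is at most m^(1-q) and the power of r is integrated. Each part is
  at most m^-q / q, and the resulting m^-q cancels the m^q from differentiating z^m.\<close>

lemma radial_weight_bound:
  fixes q :: real and m :: nat
  assumes q: "0 < q" "q \<le> 1" and m: "m \<ge> 1"
  shows "(\<integral>\<^sup>+z. indicator (ball (0::complex) 1) z * ennreal ((1 - norm z) powr (q - 1) * (norm z ^ (m - 1)) powr q) \<partial>lborel)
    \<le> ennreal (4 * pi / q * real m powr (- q))"
proof -
  have [measurable]: "(\<lambda>r::real. (1 - r) powr (q - 1) * (r ^ (m - 1)) powr q) \<in> borel_measurable borel" by measurable
  define s where "s = q * (real m - 1)"
  have s: "s \<ge> 0" "s + 1 \<ge> q * real m" using q m by (auto simp: s_def algebra_simps)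
  have near: "(\<integral>\<^sup>+r. indicator {1 - 1 / real m..1} r * ennreal ((1 - r) powr (q - 1)) \<partial>lborel) = ennreal (real m powr (- q) / q)"
  proof -
    have "(\<integral>\<^sup>+r. indicator {1 - 1 / real m..1} r * ennreal ((1 - r) powr (q - 1)) \<partial>lborel)
      = ennreal \<bar>-1\<bar> * (\<integral>\<^sup>+x. indicator {1 - 1 / real m..1} (1 + (-1) * x) * ennreal ((1 - (1 + (-1) * x)) powr (q - 1)) \<partial>lborel)"
      by (rule nn_integral_real_affine) auto
    also have "\<dots> = (\<integral>\<^sup>+x. ennreal (indicator {0..1 / real m} x * x powr (q - 1)) \<partial>lborel)"
      unfolding abs_minus_cancel abs_one ennreal_1 mult_1 by (auto intro!: nn_integral_cong simp: indicator_def)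
    also have "\<dots> = ennreal ((1 / real m) powr (q - 1 + 1) / (q - 1 + 1))"
      by (rule nn_integral_has_integral_lebesgue[OF _ has_integral_powr_from_0]) (use q in auto)
    also have "(1 / real m) powr (q - 1 + 1) / (q - 1 + 1) = real m powr (- q) / q"
      using m by (simp add: powr_minus powr_divide inverse_eq_divide)
    finally show ?thesis .
  qed
  have far: "(\<integral>\<^sup>+r. indicator {0..1} r * ennreal (real m powr (1 - q) * r powr s) \<partial>lborel) \<le> ennreal (real m powr (- q) / q)"
  proof -
    have "(\<integral>\<^sup>+r. indicator {0..1} r * ennreal (real m powr (1 - q) * r powr s) \<partial>lborel)
      = (\<integral>\<^sup>+r. ennreal (real m powr (1 - q)) * ennreal (indicator {0..1} r * r powr s) \<partial>lborel)"
      by (auto intro!: nn_integral_cong simp: indicator_def ennreal_mult)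
    also have "\<dots> = ennreal (real m powr (1 - q)) * (\<integral>\<^sup>+r. ennreal (indicator {0..1} r * r powr s) \<partial>lborel)"
      by (rule nn_integral_cmult) measurable
    also have "(\<integral>\<^sup>+r. ennreal (indicator {0..1} r * r powr s) \<partial>lborel) = ennreal (1 powr (s + 1) / (s + 1))"
      by (rule nn_integral_has_integral_lebesgue[OF _ has_integral_powr_from_0]) (use s in auto)
    also have "ennreal (real m powr (1 - q)) * \<dots> = ennreal (real m powr (1 - q) * (1 / (s + 1)))"
      using s by (simp add: ennreal_mult[symmetric])
    also have "\<dots> \<le> ennreal (real m powr (1 - q) * (1 / (q * real m)))"
      using s q m by (intro ennreal_leI mult_left_mono divide_left_mono) auto
    also have "real m powr (1 - q) * (1 / (q * real m)) = real m powr (- q) / q"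
      using m q powr_add[of "real m" 1 "- q"] by (simp add: field_simps)
    finally show ?thesis .
  qed
  have "(\<integral>\<^sup>+z. indicator (ball (0::complex) 1) z * ennreal ((1 - norm z) powr (q - 1) * (norm z ^ (m - 1)) powr q) \<partial>lborel)
     = (\<integral>\<^sup>+r. indicator {0..1} r * ennreal (2 * pi * r) * ennreal ((1 - r) powr (q - 1) * (r ^ (m - 1)) powr q) \<partial>lborel)"
    by (rule nn_integral_unit_disc_radial) measurable
  also have "\<dots> \<le> (\<integral>\<^sup>+r. ennreal (2*pi) * (indicator {1 - 1 / real m..1} r * ennreal ((1 - r) powr (q - 1))
        + indicator {0..1} r * ennreal (real m powr (1 - q) * r powr s)) \<partial>lborel)"
  proof (rule nn_integral_mono_AE)
    \<comment> \<open>The origin is excluded because \<open>0 powr 0\<close> is 0, so that for m = 1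
      the power of r below would not agree with \<open>r powr s\<close> there.\<close>
    have "AE r in lborel. r \<noteq> (0::real) \<and> r \<noteq> 1" by (auto intro: AE_lborel_singleton)
    then show "AE r in lborel. indicator {0..1} r * ennreal (2 * pi * r) * ennreal ((1 - r) powr (q - 1) * (r ^ (m - 1)) powr q)
        \<le> ennreal (2*pi) * (indicator {1 - 1 / real m..1} r * ennreal ((1 - r) powr (q - 1))
        + indicator {0..1} r * ennreal (real m powr (1 - q) * r powr s))"
    proof eventually_elim
      case (elim r)
      show ?case
      proof (cases "0 < r \<and> r < 1")
        case False
        then have "indicator {0..1} r = (0::ennreal)" using elim by (auto simp: indicator_def)
        then show ?thesis by simp
      next
        case True
        have rs: "(r ^ (m - 1)) powr q = r powr s"
          using True m by (simp add: powr_realpow[symmetric] powr_powr s_def mult.commute of_nat_diff)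
        have A: "(1 - r) powr (q - 1) * (r ^ (m - 1)) powr q \<le> (if 1 - 1 / real m \<le> r then (1 - r) powr (q - 1) else real m powr (1 - q) * r powr s)"
        proof (cases "1 - 1 / real m \<le> r")
          case far: False
          have "(1 - r) powr (q - 1) \<le> (1 / real m) powr (q - 1)"
            using far q m by (intro powr_mono2') auto
          also have "\<dots> = real m powr (1 - q)" using powr_minus_divide[of "real m" "q - 1"] powr_divide[of 1 "real m" "q - 1"] m by simp
          finally have "(1 - r) powr (q - 1) * r powr s \<le> real m powr (1 - q) * r powr s" by (intro mult_right_mono) auto
          then show ?thesis using far rs by simp
        next
          case True': True
          have "r powr s \<le> 1" using True s by (intro powr_le1) auto
          then have "(1 - r) powr (q - 1) * r powr s \<le> (1 - r) powr (q - 1) * 1" by (intro mult_left_mono) auto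
          then show ?thesis using True' rs by simp
        qed
        have "indicator {0..1} r * ennreal (2 * pi * r) * ennreal ((1 - r) powr (q - 1) * (r ^ (m - 1)) powr q)
          \<le> ennreal (2*pi) * ennreal (if 1 - 1 / real m \<le> r then (1 - r) powr (q - 1) else real m powr (1 - q) * r powr s)"
          using True by (intro mult_mono ennreal_leI A) (auto simp: mult_left_le intro!: ennreal_leI)
        also have "\<dots> \<le> ennreal (2*pi) * (indicator {1 - 1 / real m..1} r * ennreal ((1 - r) powr (q - 1))
          + indicator {0..1} r * ennreal (real m powr (1 - q) * r powr s))"
          using True by (intro mult_left_mono) (auto simp: indicator_def)
        finally show ?thesis .
      qed
    qed
  qed
  also have "\<dots> = ennreal (2*pi) * ((\<integral>\<^sup>+r. indicator {1 - 1 / real m..1} r * ennreal ((1 - r) powr (q - 1)) \<partial>lborel)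
        + (\<integral>\<^sup>+r. indicator {0..1} r * ennreal (real m powr (1 - q) * r powr s) \<partial>lborel))"
    by (subst nn_integral_cmult, measurable, subst nn_integral_add, auto)
  also have "\<dots> \<le> ennreal (2*pi) * (ennreal (real m powr (- q) / q) + ennreal (real m powr (- q) / q))"
    unfolding near by (intro mult_left_mono add_mono far order_refl) auto
  also have "\<dots> = ennreal (4 * pi / q * real m powr (- q))"
    using q by (simp add: ennreal_plus[symmetric] ennreal_mult[symmetric] del: ennreal_plus)
  finally show ?thesis .
qed

text \<open>Two summands are normalized by their sum; on [0, 1] one has t \<le> t^q since q \<le>
  1.\<close>

lemma powr_sum_le:
  fixes x :: "nat \<Rightarrow> real"
  assumes q: "0 < q" "q \<le> 1" and x: "\<And>k. x k \<ge> 0"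
  shows "(\<Sum>k<n. x k) powr q \<le> (\<Sum>k<n. x k powr q)"
proof (induction n)
  case (Suc n)
  have sub: "(a + b) powr q \<le> a powr q + b powr q" if ab: "a \<ge> 0" "b \<ge> 0" for a b :: real
  proof (cases "a + b = 0")
    case True then show ?thesis using ab by simp
  next
    case False
    then have p: "a + b > 0" using ab by linarith
    have key: "t \<le> t powr q" if "0 \<le> t" "t \<le> 1" for t :: real
      using that q powr_mono'[of q 1 t] by (cases "t = 0") auto
    have "1 = a / (a + b) + b / (a + b)" using p by (simp add: add_divide_distrib[symmetric])
    also have "\<dots> \<le> (a / (a + b)) powr q + (b / (a + b)) powr q" using ab p by (intro add_mono key) auto
    also have "\<dots> = (a powr q + b powr q) / (a + b) powr q" using ab p by (simp add: powr_divide add_divide_distrib)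
    finally show ?thesis using p by (simp add: pos_le_divide_eq)
  qed
  have "(\<Sum>k<Suc n. x k) powr q \<le> (\<Sum>k<n. x k) powr q + x n powr q"
    using sub[of "\<Sum>k<n. x k" "x n"] x by (simp add: sum_nonneg)
  then show ?case using Suc by simp
qed simp

lemma powr_norm_sums_le:
  fixes c :: "nat \<Rightarrow> complex"
  assumes s: "c sums w" and q: "0 < q" "q \<le> 1"
  shows "ennreal (norm w powr q) \<le> (\<Sum>k. ennreal (norm (c k) powr q))"
proof (rule tendsto_upperbound)
  have "(\<lambda>n. norm (\<Sum>k<n. c k)) \<longlonglongrightarrow> norm w" using s by (intro tendsto_norm) (simp add: sums_def)
  then show "(\<lambda>n. ennreal (norm (\<Sum>k<n. c k) powr q)) \<longlonglongrightarrow> ennreal (norm w powr q)"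
    using q by (intro tendsto_ennrealI tendsto_powr2) auto
  show "\<forall>\<^sub>F n in sequentially. ennreal (norm (\<Sum>k<n. c k) powr q) \<le> (\<Sum>k. ennreal (norm (c k) powr q))"
  proof (intro always_eventually allI)
    fix n
    have "norm (\<Sum>k<n. c k) powr q \<le> (\<Sum>k<n. norm (c k)) powr q" using q by (intro powr_mono2 norm_sum) auto
    also have "\<dots> \<le> (\<Sum>k<n. norm (c k) powr q)" by (rule powr_sum_le[OF q]) auto
    finally have "ennreal (norm (\<Sum>k<n. c k) powr q) \<le> ennreal (\<Sum>k<n. norm (c k) powr q)" by (rule ennreal_leI)
    also have "\<dots> = (\<Sum>k<n. ennreal (norm (c k) powr q))" by (rule sum_ennreal[symmetric]) auto
    also have "\<dots> \<le> (\<Sum>k. ennreal (norm (c k) powr q))" by (rule sum_le_suminf) auto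
    finally show "ennreal (norm (\<Sum>k<n. c k) powr q) \<le> (\<Sum>k. ennreal (norm (c k) powr q))" .
  qed
qed simp

lemma summable_series_deriv:
  fixes b :: "nat \<Rightarrow> complex" and m :: "nat \<Rightarrow> nat"
  assumes sb: "summable (\<lambda>k. norm (b k))" and sums: "\<And>z. z \<in> ball 0 1 \<Longrightarrow> (\<lambda>k. b k * z ^ m k) sums f z"
  shows "f holomorphic_on ball 0 1"
    and "\<And>z. z \<in> ball 0 1 \<Longrightarrow> (\<lambda>k. b k * (of_nat (m k) * z ^ (m k - 1))) sums deriv f z"
proof -
  obtain g g' where g: "\<forall>x\<in>ball 0 1. (\<lambda>n. b n * x ^ m n) sums g x \<and>
      (\<lambda>n. b n * (of_nat (m n) * x ^ (m n - 1))) sums g' x \<and> (g has_field_derivative g' x) (at x)"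
  proof (rule series_and_derivative_comparison[OF open_ball sb])
    show "((\<lambda>x. b n * x ^ m n) has_field_derivative b n * (of_nat (m n) * x ^ (m n - 1))) (at x)" for n x
      by (auto intro!: derivative_eq_intros)
    show "\<forall>\<^sub>F n in sequentially. \<forall>x\<in>ball 0 1. norm (b n * x ^ m n) \<le> norm (b n)"
      by (intro always_eventually) (auto simp: norm_mult norm_power intro!: mult_left_le power_le_one)
  qed (rule that)
  have gf: "g x = f x" if "x \<in> ball 0 1" for x
    using g that sums[OF that] sums_unique2 by blast
  have d: "(f has_field_derivative g' z) (at z)" if z: "z \<in> ball 0 1" for z
    by (rule has_field_derivative_transform_within_open[of g _ _ "ball 0 1"]) (use g z gf in auto)
  then show "f holomorphic_on ball 0 1"
    unfolding holomorphic_on_open[OF open_ball] by blast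
  fix z :: complex assume z: "z \<in> ball 0 1"
  show "(\<lambda>k. b k * (of_nat (m k) * z ^ (m k - 1))) sums deriv f z"
    using DERIV_imp_deriv[OF d[OF z]] g z by simp
qed

context mult_series
begin

lemma deriv_sums:
  "z \<in> ball 0 1 \<Longrightarrow> (\<lambda>k. b k * (of_nat (m k) * z ^ (m k - 1))) sums deriv f z"
  by (rule summable_series_deriv(2)[OF sb sums])

text \<open>Subadditivity of the q-th power bounds |f'|^q term by term by radial functions, so
  rotation averaging removes h. Each term then contributes at most a constant times |b k|^q. The
  weight 1 + |h| majorizes |h|^q and is linear in |h|, as the H1 bound demands.\<close>

lemma area_finite:
  assumes q: "1/2 < q" "q \<le> 1" and h: "h \<in> hardy1"
  shows "(\<integral>\<^sup>+z. indicator (ball 0 1) z * ennreal ((1 - norm z) powr (q - 1) * norm (deriv f z) powr q * (1 + norm (h z))) \<partial>lborel) < \<infinity>"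
proof -
  obtain C where hh: "h holomorphic_on ball 0 1" and C: "C \<ge> 0" "\<And>r. 0 \<le> r \<Longrightarrow> r < 1 \<Longrightarrow>
      (\<integral>\<^sup>+t. ennreal (norm (h (of_real r * cis t))) \<partial>arc_meas 0 (2*pi)) \<le> ennreal C"
    using h unfolding hardy1_iff by blast
  have hc: "continuous_on (ball 0 1) h" by (rule holomorphic_on_imp_continuous_on[OF hh])
  define a where "a = (\<lambda>k. (norm (b k) * real (m k)) powr q)"
  define w where "w = (\<lambda>k r. ennreal ((1 - r) powr (q - 1) * (r ^ (m k - 1)) powr q))"
  define I where "I = (\<lambda>z::complex. indicator (ball (0::complex) 1) z :: ennreal)"
  define J where "J = (\<lambda>z::complex. I z * ennreal (norm (h z)))"
  have wm: "w k \<in> borel_measurable borel" for k unfolding w_def by measurable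
  have wn [measurable]: "(\<lambda>z::complex. w k (norm z)) \<in> borel_measurable borel" for k
    by (rule measurable_compose[OF borel_measurable_norm_ident wm])
  have Im [measurable]: "I \<in> borel_measurable borel" unfolding I_def by (rule borel_measurable_indicator) simp
  have Jm [measurable]: "J \<in> borel_measurable borel"
    unfolding J_def I_def by (rule borel_measurable_disc_nn) (intro continuous_intros hc)
  define D where "D = (1 + C / (2*pi)) * (4 * pi / q)"
  have D: "D \<ge> 0" using C q by (simp add: D_def)
  have pt: "indicator (ball 0 1) z * ennreal ((1 - norm z) powr (q - 1) * norm (deriv f z) powr q * (1 + norm (h z)))
     \<le> (\<Sum>k. ennreal (a k) * (w k (norm z) * I z + w k (norm z) * J z))" for z
  proof (cases "z \<in> ball 0 1")
    case True
    have "ennreal (norm (deriv f z) powr q) \<le> (\<Sum>k. ennreal (norm (b k * (of_nat (m k) * z ^ (m k - 1))) powr q))"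
      by (rule powr_norm_sums_le[OF deriv_sums[OF True]]) (use q in auto)
    also have "\<dots> = (\<Sum>k. ennreal (a k) * ennreal ((norm z ^ (m k - 1)) powr q))"
    proof (rule arg_cong[of _ _ suminf], rule ext)
      fix k
      have "norm (b k * (of_nat (m k) * z ^ (m k - 1))) powr q = a k * (norm z ^ (m k - 1)) powr q"
        unfolding a_def by (simp add: norm_mult norm_power powr_mult mult.assoc)
      then show "ennreal (norm (b k * (of_nat (m k) * z ^ (m k - 1))) powr q) = ennreal (a k) * ennreal ((norm z ^ (m k - 1)) powr q)"
        by (simp add: ennreal_mult a_def)
    qed
    finally have le: "ennreal (norm (deriv f z) powr q) \<le> (\<Sum>k. ennreal (a k) * ennreal ((norm z ^ (m k - 1)) powr q))" .
    have "indicator (ball 0 1) z * ennreal ((1 - norm z) powr (q - 1) * norm (deriv f z) powr q * (1 + norm (h z)))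
      = ennreal ((1 - norm z) powr (q - 1)) * ennreal (1 + norm (h z)) * ennreal (norm (deriv f z) powr q)"
      using True by (simp add: ennreal_mult[symmetric] mult_ac del: ennreal_plus)
    also have "\<dots> \<le> ennreal ((1 - norm z) powr (q - 1)) * ennreal (1 + norm (h z)) * (\<Sum>k. ennreal (a k) * ennreal ((norm z ^ (m k - 1)) powr q))"
      by (intro mult_left_mono le) auto
    also have "\<dots> = (\<Sum>k. ennreal ((1 - norm z) powr (q - 1)) * ennreal (1 + norm (h z)) * (ennreal (a k) * ennreal ((norm z ^ (m k - 1)) powr q)))"
      by (rule ennreal_suminf_cmult[symmetric])
    also have "\<dots> = (\<Sum>k. ennreal (a k) * (w k (norm z) * I z + w k (norm z) * J z))"
      using True by (intro arg_cong[of _ _ suminf] ext)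
        (simp add: w_def I_def J_def ennreal_mult distrib_left distrib_right mult_ac)
    finally show ?thesis .
  qed simp
  have mI: "(\<lambda>z. w k (norm z) * I z) \<in> borel_measurable borel" "(\<lambda>z. w k (norm z) * J z) \<in> borel_measurable borel" for k
    by (intro borel_measurable_times_ennreal wn Im Jm)+
  have each: "(\<integral>\<^sup>+z. ennreal (a k) * (w k (norm z) * I z + w k (norm z) * J z) \<partial>lborel) \<le> ennreal (D * norm (b k) powr q)" for k
  \<comment> \<open>A constant term has derivative 0, so its coefficient \<open>a k\<close>
    vanishes; only exponents at least 1 meet the radial estimate.\<close>
  proof (cases "m k = 0")
    case True
    then show ?thesis by (simp add: a_def)
  next
    case False
    define W where "W = (\<integral>\<^sup>+z. w k (norm z) * I z \<partial>lborel)"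
    have W: "W \<le> ennreal (4 * pi / q * real (m k) powr (- q))"
      using radial_weight_bound[of q "m k"] q False unfolding W_def w_def I_def by (simp add: mult.commute)
    have "ennreal (2*pi) * (\<integral>\<^sup>+z. w k (norm z) * J z \<partial>lborel) \<le> ennreal C * W"
      using hardy1_radial_area[OF hh C(2) wm, of k] unfolding W_def J_def I_def by (simp add: mult_ac)
    then have "ennreal (1 / (2*pi)) * (ennreal (2*pi) * (\<integral>\<^sup>+z. w k (norm z) * J z \<partial>lborel)) \<le> ennreal (1 / (2*pi)) * (ennreal C * W)"
      by (intro mult_left_mono) auto
    then have WJ: "(\<integral>\<^sup>+z. w k (norm z) * J z \<partial>lborel) \<le> ennreal (C / (2*pi)) * W"
      using C(1) by (simp add: mult.assoc[symmetric] ennreal_mult[symmetric])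
    have "(\<integral>\<^sup>+z. ennreal (a k) * (w k (norm z) * I z + w k (norm z) * J z) \<partial>lborel)
      = ennreal (a k) * (W + (\<integral>\<^sup>+z. w k (norm z) * J z \<partial>lborel))"
      unfolding W_def using mI[of k] by (subst nn_integral_cmult, simp, subst nn_integral_add, auto)
    also have "\<dots> \<le> ennreal (a k) * (W + ennreal (C / (2*pi)) * W)" by (intro mult_left_mono add_left_mono WJ) auto
    also have "\<dots> = ennreal (a k) * (ennreal (1 + C / (2*pi)) * W)"
      using C(1) by (simp add: distrib_right)
    also have "\<dots> \<le> ennreal (a k) * (ennreal (1 + C / (2*pi)) * ennreal (4 * pi / q * real (m k) powr (- q)))"
      by (intro mult_left_mono W) auto
    also have "\<dots> = ennreal (a k * ((1 + C / (2*pi)) * (4 * pi / q * real (m k) powr (- q))))"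
    proof -
      have "0 \<le> 1 + C / (2*pi)" "0 \<le> 4 * pi / q * real (m k) powr (- q)" "0 \<le> a k" using C q by (auto simp: a_def)
      moreover have "ennreal x * (ennreal y * ennreal z) = ennreal (x * (y * z))" if "0 \<le> x" "0 \<le> y" "0 \<le> z" for x y z :: real
        using that by (simp add: ennreal_mult)
      ultimately show ?thesis by blast
    qed
    also have "a k * ((1 + C / (2*pi)) * (4 * pi / q * real (m k) powr (- q))) = D * norm (b k) powr q"
    proof -
      have "real (m k) powr q * real (m k) powr (- q) = 1" using False by (simp add: powr_minus)
      then show ?thesis unfolding D_def a_def by (simp add: powr_mult)
    qed
    finally show ?thesis .
  qed
  have "(\<integral>\<^sup>+z. indicator (ball 0 1) z * ennreal ((1 - norm z) powr (q - 1) * norm (deriv f z) powr q * (1 + norm (h z))) \<partial>lborel)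
    \<le> (\<integral>\<^sup>+z. (\<Sum>k. ennreal (a k) * (w k (norm z) * I z + w k (norm z) * J z)) \<partial>lborel)"
    by (intro nn_integral_mono pt)
  also have "\<dots> = (\<Sum>k. \<integral>\<^sup>+z. ennreal (a k) * (w k (norm z) * I z + w k (norm z) * J z) \<partial>lborel)"
  proof (rule nn_integral_suminf)
    fix k
    have "(\<lambda>z. ennreal (a k) * (w k (norm z) * I z + w k (norm z) * J z)) \<in> borel_measurable borel"
      by (intro borel_measurable_times_ennreal borel_measurable_add mI borel_measurable_const)
    then show "(\<lambda>z. ennreal (a k) * (w k (norm z) * I z + w k (norm z) * J z)) \<in> borel_measurable lborel" by simp
  qed
  also have "\<dots> \<le> (\<Sum>k. ennreal (D * norm (b k) powr q))" by (intro suminf_le each summableI)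
  also have "\<dots> = ennreal (\<Sum>k. D * norm (b k) powr q)"
  proof (rule suminf_ennreal2)
    show "summable (\<lambda>k. D * norm (b k) powr q)"
      using lms q by (intro summable_mult) (auto simp: lacunary_mult_series_def)
  qed (use D in auto)
  also have "\<dots> < \<infinity>" by simp
  finally show ?thesis .
qed

text \<open>For q > 1 put y = |h f'|. The Bloch bounds of h f and h give (1 - |z|) y \<le> B, and (1
  - |z|)^(q-1) y^q = ((1 - |z|) y)^(q-1) y reduces the integral to exponent 1.\<close>

lemma area_finite':
  assumes q: "1/2 < q" and h: "h \<in> BMOA"
  shows "(\<integral>\<^sup>+z. indicator (ball 0 1) z * ennreal ((1 - norm z) powr (q - 1) * norm (h z * deriv f z) powr q) \<partial>lborel) < \<infinity>"
proof (cases "q \<le> 1")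
  case True
  have h1: "h \<in> hardy1" using h by (simp add: BMOA_def)
  have "(\<integral>\<^sup>+z. indicator (ball 0 1) z * ennreal ((1 - norm z) powr (q - 1) * norm (h z * deriv f z) powr q) \<partial>lborel)
    \<le> (\<integral>\<^sup>+z. indicator (ball 0 1) z * ennreal ((1 - norm z) powr (q - 1) * norm (deriv f z) powr q * (1 + norm (h z))) \<partial>lborel)"
  proof (intro nn_integral_mono mult_left_mono ennreal_leI)
    fix z
    have "norm (h z) powr q \<le> 1 + norm (h z)"
    proof (cases "norm (h z) \<le> 1")
      case le: True
      have "norm (h z) powr q \<le> 1" using le q by (intro powr_le1) auto
      then show ?thesis by (simp add: add_increasing2)
    next
      case False
      then have "norm (h z) powr q \<le> norm (h z) powr 1" using \<open>q \<le> 1\<close> by (intro powr_mono) auto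
      then show ?thesis by simp
    qed
    then have "(1 - norm z) powr (q - 1) * norm (deriv f z) powr q * norm (h z) powr q \<le> (1 - norm z) powr (q - 1) * norm (deriv f z) powr q * (1 + norm (h z))"
      by (intro mult_left_mono) auto
    then show "(1 - norm z) powr (q - 1) * norm (h z * deriv f z) powr q \<le> (1 - norm z) powr (q - 1) * norm (deriv f z) powr q * (1 + norm (h z))"
      by (simp add: norm_mult powr_mult mult_ac)
  qed auto
  also have "\<dots> < \<infinity>" by (rule area_finite[OF q True h1])
  finally show ?thesis .
next
  case False
  have h1: "h \<in> hardy1" using h by (simp add: BMOA_def)
  have hh: "h holomorphic_on ball 0 1" using h1 by (simp add: hardy1_iff)
  obtain B1 where B1: "B1 \<ge> 0" "\<And>z. norm z < 1 \<Longrightarrow> (1 - norm z) * norm (deriv h z) \<le> B1"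
    by (rule BMOA_imp_Bloch[OF h]) (rule that)
  obtain B2 where B2: "B2 \<ge> 0" "\<And>z. norm z < 1 \<Longrightarrow> (1 - norm z) * norm (deriv (\<lambda>z. h z * f z) z) \<le> B2"
    by (rule BMOA_imp_Bloch[OF mult_BMOA[OF h]]) (rule that)
  define B where "B = B2 + B1 * S"
  have B: "B \<ge> 0" using B1 B2 S_nonneg by (simp add: B_def)
  have bd: "(1 - norm z) * norm (h z * deriv f z) \<le> B" if z: "norm z < 1" for z
  proof -
    have zb: "z \<in> ball 0 1" using z by simp
    have "deriv (\<lambda>z. h z * f z) z = h z * deriv f z + deriv h z * f z"
      using holomorphic_on_imp_differentiable_at[OF hh open_ball zb] holomorphic_on_imp_differentiable_at[OF hol open_ball zb]
      by (rule deriv_mult)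
    then have "norm (h z * deriv f z) \<le> norm (deriv (\<lambda>z. h z * f z) z) + norm (deriv h z * f z)"
      using norm_triangle_ineq4[of "deriv (\<lambda>z. h z * f z) z" "deriv h z * f z"] by simp
    then have "(1 - norm z) * norm (h z * deriv f z) \<le> (1 - norm z) * (norm (deriv (\<lambda>z. h z * f z) z) + norm (deriv h z * f z))"
      using z by (intro mult_left_mono) auto
    also have "\<dots> = (1 - norm z) * norm (deriv (\<lambda>z. h z * f z) z) + ((1 - norm z) * norm (deriv h z)) * norm (f z)"
      by (simp add: norm_mult distrib_left mult.assoc)
    also have "\<dots> \<le> B" unfolding B_def
      using B1 B2 z norm_f_le[OF zb] by (intro add_mono mult_mono) auto
    finally show ?thesis .
  qed
  have "(\<integral>\<^sup>+z. indicator (ball 0 1) z * ennreal ((1 - norm z) powr (q - 1) * norm (h z * deriv f z) powr q) \<partial>lborel)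
    \<le> (\<integral>\<^sup>+z. ennreal (B powr (q - 1)) * (indicator (ball 0 1) z * ennreal ((1 - norm z) powr (1 - 1) * norm (deriv f z) powr 1 * (1 + norm (h z)))) \<partial>lborel)"
  proof (rule nn_integral_mono)
    fix z
    show "indicator (ball 0 1) z * ennreal ((1 - norm z) powr (q - 1) * norm (h z * deriv f z) powr q)
      \<le> ennreal (B powr (q - 1)) * (indicator (ball 0 1) z * ennreal ((1 - norm z) powr (1 - 1) * norm (deriv f z) powr 1 * (1 + norm (h z))))"
    proof (cases "norm z < 1")
      case True
      define y where "y = norm (h z * deriv f z)"
      have y: "y \<ge> 0" by (simp add: y_def)
      have "(1 - norm z) powr (q - 1) * y powr q = ((1 - norm z) * y) powr (q - 1) * y"
        using True y powr_add[of y "q - 1" 1] by (cases "y = 0") (auto simp: powr_mult mult.assoc)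
      also have "\<dots> \<le> B powr (q - 1) * y"
        using bd[OF True] False True y by (intro mult_right_mono powr_mono2) (auto simp: y_def)
      also have "\<dots> \<le> B powr (q - 1) * (norm (deriv f z) * (1 + norm (h z)))"
        by (intro mult_left_mono) (auto simp: y_def norm_mult algebra_simps)
      finally have "ennreal ((1 - norm z) powr (q - 1) * y powr q) \<le> ennreal (B powr (q - 1) * (norm (deriv f z) * (1 + norm (h z))))"
        by (rule ennreal_leI)
      then show ?thesis using True by (simp add: y_def ennreal_mult del: ennreal_plus)
    qed simp
  qed
  also have "\<dots> = ennreal (B powr (q - 1)) * (\<integral>\<^sup>+z. indicator (ball 0 1) z * ennreal ((1 - norm z) powr (1 - 1) * norm (deriv f z) powr 1 * (1 + norm (h z))) \<partial>lborel)"
  proof (rule nn_integral_cmult)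
    have "continuous_on (ball 0 1) (\<lambda>z. norm (deriv f z) * (1 + norm (h z)))"
      by (intro continuous_intros holomorphic_on_imp_continuous_on holomorphic_deriv hol hh open_ball)
    then have "(\<lambda>z. indicator (ball 0 1) z * ennreal (norm (deriv f z) * (1 + norm (h z)))) \<in> borel_measurable borel"
      by (rule borel_measurable_disc_nn)
    also have "(\<lambda>z. indicator (ball 0 1) z * ennreal (norm (deriv f z) * (1 + norm (h z))))
       = (\<lambda>z. indicator (ball 0 1) z * ennreal ((1 - norm z) powr (1 - 1) * norm (deriv f z) powr 1 * (1 + norm (h z))))"
      by (rule ext) (auto simp: indicator_def)
    finally show "(\<lambda>z. indicator (ball 0 1) z * ennreal ((1 - norm z) powr (1 - 1) * norm (deriv f z) powr 1 * (1 + norm (h z)))) \<in> borel_measurable lborel"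
      by simp
  qed
  also have "\<dots> < \<infinity>" using area_finite[OF _ order_refl h1] by (simp add: ennreal_mult_less_top)
  finally show ?thesis .
qed

lemma powr_add_le:
  fixes x y q :: real
  assumes "x \<ge> 0" "y \<ge> 0" "q > 0" shows "(x + y) powr q \<le> 2 powr q * (x powr q + y powr q)"
proof -
  have "(x + y) powr q \<le> (2 * max x y) powr q" using assms by (intro powr_mono2) auto
  also have "\<dots> = 2 powr q * (max x y) powr q" using assms by (simp add: powr_mult)
  also have "(max x y) powr q \<le> x powr q + y powr q" by (auto simp: max_def)
  finally show ?thesis by (simp add: mult_left_mono)
qed

text \<open>For h' f the function f is bounded, and q - p powers of (1 - |z|) |h'| are absorbed by
  the Bloch bound, leaving the p-integral of h; here p \<le> q enters. The other part h f' needs q >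
  1/2.\<close>

lemma mult_dirichlet_type:
  assumes pq: "0 < p" "p \<le> q" "1/2 < q" and h: "h \<in> dirichlet_type p" "h \<in> BMOA"
  shows "(\<lambda>z. h z * f z) \<in> dirichlet_type q"
proof -
  have hh: "h holomorphic_on ball 0 1" using h(1) by (simp add: dirichlet_type_def)
  have hp: "(\<integral>\<^sup>+ z. indicator (ball (0::complex) 1) z * ennreal ((1 - norm z) powr (p - 1) * norm (deriv h z) powr p / pi) \<partial>lborel) < \<infinity>"
    using h(1) by (simp add: dirichlet_type_def)
  obtain B where B: "B \<ge> 0" "\<And>z. norm z < 1 \<Longrightarrow> (1 - norm z) * norm (deriv h z) \<le> B"
    by (rule BMOA_imp_Bloch[OF h(2)]) (rule that)
  define c where "c = 2 powr q * S powr q * B powr (q - p)"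
  define d where "d = 2 powr q / pi"
  have cd: "c \<ge> 0" "d \<ge> 0" by (auto simp: c_def d_def)
  define P where "P = (\<lambda>z. indicator (ball (0::complex) 1) z * ennreal ((1 - norm z) powr (p - 1) * norm (deriv h z) powr p / pi))"
  define Q where "Q = (\<lambda>z. indicator (ball (0::complex) 1) z * ennreal ((1 - norm z) powr (q - 1) * norm (h z * deriv f z) powr q))"
  have dh: "continuous_on (ball 0 1) (deriv h)" "continuous_on (ball 0 1) (deriv f)" "continuous_on (ball 0 1) h"
    by (intro holomorphic_on_imp_continuous_on holomorphic_deriv hol hh open_ball)+
  have ball_pos: "z \<in> ball 0 1 \<Longrightarrow> 1 - norm z \<noteq> 0" for z :: complex by auto
  have PQ: "P \<in> borel_measurable borel" "Q \<in> borel_measurable borel"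
    unfolding P_def Q_def using pq ball_pos
    by (intro borel_measurable_disc_nn continuous_intros continuous_on_powr' dh; force)+
  have "(\<integral>\<^sup>+ z. indicator (ball (0::complex) 1) z * ennreal ((1 - norm z) powr (q - 1) * norm (deriv (\<lambda>z. h z * f z) z) powr q / pi) \<partial>lborel)
    \<le> (\<integral>\<^sup>+ z. ennreal c * P z + ennreal d * Q z \<partial>lborel)"
  proof (rule nn_integral_mono)
    fix z
    show "indicator (ball (0::complex) 1) z * ennreal ((1 - norm z) powr (q - 1) * norm (deriv (\<lambda>z. h z * f z) z) powr q / pi) \<le> ennreal c * P z + ennreal d * Q z"
    proof (cases "z \<in> ball 0 1")
      case zb: True
      define r where "r = 1 - norm z"
      have r: "r > 0" using zb by (simp add: r_def)
      define x y where "x = norm (deriv h z * f z)" and "y = norm (h z * deriv f z)"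
      have dv: "deriv (\<lambda>z. h z * f z) z = h z * deriv f z + deriv h z * f z"
        using holomorphic_on_imp_differentiable_at[OF hh open_ball zb] holomorphic_on_imp_differentiable_at[OF hol open_ball zb]
        by (rule deriv_mult)
      have "norm (deriv (\<lambda>z. h z * f z) z) powr q \<le> (x + y) powr q"
        using norm_triangle_ineq[of "h z * deriv f z" "deriv h z * f z"] pq unfolding dv x_def y_def
        by (intro powr_mono2) (auto simp: add.commute)
      also have "\<dots> \<le> 2 powr q * (x powr q + y powr q)" by (rule powr_add_le) (use pq in \<open>auto simp: x_def y_def\<close>)
      finally have 1: "norm (deriv (\<lambda>z. h z * f z) z) powr q \<le> 2 powr q * (x powr q + y powr q)" .
      have "x powr q \<le> S powr q * norm (deriv h z) powr q"
      proof -
        have "x \<le> norm (deriv h z) * S" unfolding x_def norm_mult using norm_f_le[OF zb] by (intro mult_left_mono) auto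
        then have "x powr q \<le> (norm (deriv h z) * S) powr q" using pq by (intro powr_mono2) (auto simp: x_def)
        then show ?thesis using S_nonneg by (simp add: powr_mult mult.commute)
      qed
      moreover have "r powr (q - 1) * norm (deriv h z) powr q \<le> B powr (q - p) * (r powr (p - 1) * norm (deriv h z) powr p)"
      proof -
        define u where "u = norm (deriv h z)"
        have u: "u \<ge> 0" by (simp add: u_def)
        have "r powr (q - 1) * u powr q = (r * u) powr (q - p) * (r powr (p - 1) * u powr p)"
        proof (cases "u = 0")
          case False
          then have "u > 0" using u by simp
          then show ?thesis using r powr_add[of r "q - p" "p - 1"] powr_add[of u "q - p" p] by (simp add: powr_mult)
        qed simp
        also have "\<dots> \<le> B powr (q - p) * (r powr (p - 1) * u powr p)"
          using B(2)[of z] zb pq r u by (intro mult_right_mono powr_mono2) (auto simp: r_def u_def)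
        finally show ?thesis by (simp add: u_def)
      qed
      ultimately have 2: "r powr (q - 1) * x powr q \<le> S powr q * (B powr (q - p) * (r powr (p - 1) * norm (deriv h z) powr p))"
        by (smt (verit, best) mult.left_commute mult_left_mono powr_ge_zero)
      have "r powr (q - 1) * norm (deriv (\<lambda>z. h z * f z) z) powr q \<le> r powr (q - 1) * (2 powr q * (x powr q + y powr q))"
        by (intro mult_left_mono 1) auto
      also have "\<dots> = 2 powr q * (r powr (q - 1) * x powr q) + 2 powr q * (r powr (q - 1) * y powr q)" by (simp add: algebra_simps)
      also have "\<dots> \<le> 2 powr q * (S powr q * (B powr (q - p) * (r powr (p - 1) * norm (deriv h z) powr p))) + 2 powr q * (r powr (q - 1) * y powr q)"
        by (intro add_right_mono mult_left_mono 2) auto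
      finally have "r powr (q - 1) * norm (deriv (\<lambda>z. h z * f z) z) powr q / pi
          \<le> (2 powr q * (S powr q * (B powr (q - p) * (r powr (p - 1) * norm (deriv h z) powr p))) + 2 powr q * (r powr (q - 1) * y powr q)) / pi"
        by (rule divide_right_mono) simp
      also have "\<dots> = c * (r powr (p - 1) * norm (deriv h z) powr p / pi) + d * (r powr (q - 1) * y powr q)"
        by (simp add: c_def d_def add_divide_distrib)
      finally have "ennreal (r powr (q - 1) * norm (deriv (\<lambda>z. h z * f z) z) powr q / pi)
          \<le> ennreal (c * (r powr (p - 1) * norm (deriv h z) powr p / pi) + d * (r powr (q - 1) * y powr q))"
        by (rule ennreal_leI)
      also have "\<dots> = ennreal c * ennreal (r powr (p - 1) * norm (deriv h z) powr p / pi) + ennreal d * ennreal (r powr (q - 1) * y powr q)"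
      proof -
        have e: "ennreal (x * y + u * v) = ennreal x * ennreal y + ennreal u * ennreal v"
          if "0 \<le> x" "0 \<le> y" "0 \<le> u" "0 \<le> v" for x y u v :: real
          using that by (simp add: ennreal_mult)
        show ?thesis by (rule e) (use cd in auto)
      qed
      finally show ?thesis using zb by (simp add: P_def Q_def r_def y_def)
    qed simp
  qed
  also have "\<dots> = ennreal c * (\<integral>\<^sup>+ z. P z \<partial>lborel) + ennreal d * (\<integral>\<^sup>+ z. Q z \<partial>lborel)"
    using PQ by (simp add: nn_integral_add nn_integral_cmult)
  also have "\<dots> < \<infinity>"
    using hp area_finite'[OF pq(3) h(2)] by (simp add: P_def Q_def ennreal_mult_less_top)
  finally show ?thesis using hh hol by (auto simp: dirichlet_type_def intro!: holomorphic_intros)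
qed

lemma multiplier_dirichlet:
  assumes "0 < p" "p \<le> q" "1/2 < q"
  shows "f \<in> multipliers (dirichlet_type p \<inter> BMOA) (dirichlet_type q \<inter> BMOA)"
  using hol mult_BMOA mult_dirichlet_type[OF assms] by (auto simp: multipliers_def)

end

subsection \<open>A lacunary series outside the Dirichlet-type space\<close>

lemma emeasure_annulus_ge:
  assumes n: "n \<ge> (2::real)"
  shows "emeasure lborel {z::complex. 1 - 1 / n \<le> norm z \<and> norm z \<le> 1 - 1 / (2 * n)} \<ge> ennreal (pi / (2 * n))"
proof -
  have b: "0 \<le> 1 - 1 / n" "0 \<le> 1 - 1 / (2 * n)" "1 - 1 / n \<le> 1 - 1 / (2 * n)" using n by (auto simp: field_simps)
  have "{z::complex. 1 - 1 / n \<le> norm z \<and> norm z \<le> 1 - 1 / (2 * n)} = cball 0 (1 - 1 / (2 * n)) - ball 0 (1 - 1 / n)"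
    by (auto simp: not_less)
  also have "emeasure lborel \<dots> = emeasure lborel (cball (0::complex) (1 - 1 / (2 * n))) - emeasure lborel (ball (0::complex) (1 - 1 / n))"
    using b by (intro emeasure_Diff) (auto simp: emeasure_ball)
  also have "\<dots> = ennreal (pi * (1 - 1 / (2 * n))^2 - pi * (1 - 1 / n)^2)"
    using b by (subst ennreal_minus[symmetric]) (auto simp: emeasure_ball emeasure_cball unit_ball_vol_2)
  also have "\<dots> \<ge> ennreal (pi / (2 * n))"
  proof (rule ennreal_leI)
    define x where "x = 1 / (2 * n)"
    have x: "0 < x" "x \<le> 1/4" "1 / n = 2 * x" using n by (auto simp: x_def field_simps)
    have "pi * (1 - 1 / (2 * n))^2 - pi * (1 - 1 / n)^2 = pi * x * (2 - 3 * x)"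
      unfolding x(3) x_def[symmetric] by (simp add: power2_eq_square algebra_simps)
    also have "\<dots> \<ge> pi * x * 1" using x by (intro mult_left_mono) auto
    finally show "pi / (2 * n) \<le> pi * (1 - 1 / (2 * n))^2 - pi * (1 - 1 / n)^2" by (simp add: x_def)
  qed
  finally show ?thesis .
qed

text \<open>The bound on N makes \<theta> \<le> 1/72: the lower and upper remainders of f' each
  amount to at most 2 \<theta> of the k-th coefficient, together at most 1/18, against a main term
  of at least 1/9. In \<theta>, 2^(1/q) comes from the ratio of consecutive coefficients and 16 from
  the exponential decay of high powers.\<close>

locale lacunary_example =
  fixes q :: real and N :: nat
  assumes q: "0 < q" "q < 1/2" and N: "real N \<ge> 72 * (2 powr (1/q) + 16)"
begin

definition s :: real where "s = 1 / q"
definition a :: "nat \<Rightarrow> real" where "a k = real (k + 1) powr (- s)"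
definition n :: "nat \<Rightarrow> nat" where "n k = N ^ k"
definition f :: "complex \<Rightarrow> complex" where "f z = (\<Sum>k. of_real (a k) * z ^ n k)"
definition \<theta> :: real where "\<theta> = (2 powr s + 16) / real N"

lemma s_gt: "s > 2" using q by (simp add: s_def field_simps)

lemma N_big: "real N \<ge> 1152" "real N > 0"
proof -
  have "72 * (y + 16) \<ge> 1152" if "y \<ge> 0" for y :: real using that by simp
  from order_trans[OF this[of "2 powr (1/q)"] N] show "real N \<ge> 1152" by simp
  then show "real N > 0" by linarith
qed

lemma \<theta>: "0 \<le> \<theta>" "\<theta> \<le> 1/72"
  using N N_big by (auto simp: \<theta>_def s_def field_simps)

lemma a_pos: "a k > 0" by (simp add: a_def)
lemma n_pos: "real (n k) > 0" using N_big by (simp add: n_def)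

lemma n_ge_2: assumes "k \<ge> 1" shows "real (n k) \<ge> 2"
proof -
  have "real N ^ 1 \<le> real N ^ k" using N_big assms by (intro power_increasing) auto
  then have "real N \<le> real (n k)" by (simp only: n_def of_nat_power power_one_right)
  then show ?thesis using N_big by linarith
qed

lemma summable_a: "summable a"
proof -
  have "summable (\<lambda>k. real k powr (- s))" using s_gt by (simp add: summable_real_powr_iff)
  then have "summable (\<lambda>k. real (k + 1) powr (- s))" by (rule summable_ignore_initial_segment)
  then show ?thesis by (simp add: a_def[abs_def])
qed

lemma summable_na: "summable (\<lambda>k. norm (complex_of_real (a k)))"
  using summable_a a_pos by (simp add: less_imp_le)

lemma f_sums: "z \<in> ball 0 1 \<Longrightarrow> (\<lambda>k. of_real (a k) * z ^ n k) sums f z"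
  unfolding f_def
  by (intro summable_sums summable_comparison_test'[OF summable_na, of 0])
     (auto simp: norm_mult norm_power intro!: mult_left_le power_le_one)

lemma f_hol: "f holomorphic_on ball 0 1"
  by (rule summable_series_deriv(1)[OF summable_na]) (rule f_sums)

lemma f_deriv: "z \<in> ball 0 1 \<Longrightarrow> (\<lambda>k. of_real (a k) * (of_nat (n k) * z ^ (n k - 1))) sums deriv f z"
  by (rule summable_series_deriv(2)[OF summable_na]) (rule f_sums)

text \<open>The logarithm of the k-th exponent is k ln N, so the weighted terms are of order k^(3 -
  2 s), and s = 1/q > 2 makes them summable.\<close>

lemma repr: "lacunary_repr f (\<lambda>k. of_real (a k)) n (real N)"
  unfolding lacunary_repr_def
proof (intro conjI allI ballI)
  show "real N > 1" using N_big by linarith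
  show "real (n (Suc k)) \<ge> real N * real (n k)" for k by (simp add: n_def)
  show "f holomorphic_on ball 0 1" by (rule f_hol)
  show "(\<lambda>k. of_real (a k) * z ^ n k) sums f z" if "z \<in> ball 0 1" for z by (rule f_sums[OF that])
  show "summable (\<lambda>k. norm (complex_of_real (a (Suc k))) ^ 2 * (ln (real (n (Suc k)))) ^ 3)"
  proof (rule summable_comparison_test'[where N = 0])
    have "summable (\<lambda>k. real k powr (3 - 2 * s))" using s_gt by (simp add: summable_real_powr_iff)
    then have "summable (\<lambda>k. real (k + 2) powr (3 - 2 * s))" by (rule summable_ignore_initial_segment)
    then show "summable (\<lambda>k. (ln (real N)) ^ 3 * real (k + 2) powr (3 - 2 * s))" by (rule summable_mult)
    fix k :: nat
    have lN: "ln (real N) \<ge> 0" using N_big by simp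
    have "ln (real (n (Suc k))) = real (k + 1) * ln (real N)"
      using N_big ln_realpow[of "real N" "Suc k"] by (simp add: n_def del: power_Suc)
    also have "\<dots> \<le> real (k + 2) * ln (real N)" using lN by (intro mult_right_mono) auto
    finally have "ln (real (n (Suc k))) \<le> real (k + 2) * ln (real N)" .
    moreover have "ln (real (n (Suc k))) \<ge> 0" using n_pos[of "Suc k"] by simp
    ultimately have l: "(ln (real (n (Suc k)))) ^ 3 \<le> (real (k + 2) * ln (real N)) ^ 3" by (intro power_mono)
    have "norm (complex_of_real (a (Suc k))) ^ 2 = real (k + 2) powr (- 2 * s)"
      using powr_add[of "real (k + 2)" "- s" "- s"] by (simp add: a_def power2_eq_square)
    then have "norm (complex_of_real (a (Suc k))) ^ 2 * (ln (real (n (Suc k)))) ^ 3 \<le> real (k + 2) powr (- 2 * s) * (real (k + 2) * ln (real N)) ^ 3"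
      using l by (simp only:) (rule mult_left_mono, auto)
    also have "\<dots> = (ln (real N)) ^ 3 * (real (k + 2) powr (- 2 * s) * real (k + 2) powr 3)"
      by (simp add: power_mult_distrib powr_numeral)
    also have "real (k + 2) powr (- 2 * s) * real (k + 2) powr 3 = real (k + 2) powr (3 - 2 * s)"
      by (subst powr_add[symmetric]) (simp add: algebra_simps)
    finally show "norm (norm (complex_of_real (a (Suc k))) ^ 2 * (ln (real (n (Suc k)))) ^ 3) \<le> (ln (real N)) ^ 3 * real (k + 2) powr (3 - 2 * s)"
      using n_pos[of "Suc k"] by simp
  qed
qed

lemma a_ratio: "a j \<le> 2 powr s * a (Suc j)"
proof -
  have "real (j + 2) powr s \<le> (2 * real (j + 1)) powr s" using s_gt by (intro powr_mono2) auto
  also have "\<dots> = 2 powr s * real (j + 1) powr s" by (subst powr_mult) auto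
  finally have "real (j + 2) powr s \<le> 2 powr s * real (j + 1) powr s" .
  then have "inverse (2 powr s * real (j + 1) powr s) \<le> inverse (real (j + 2) powr s)" by (intro le_imp_inverse_le) auto
  then show ?thesis by (simp add: a_def powr_minus field_simps)
qed

text \<open>Going down one index multiplies the coefficient by at most 2^s and divides the exponent
  by N.\<close>

lemma lower_terms: "j \<le> k \<Longrightarrow> a j * real (n j) \<le> \<theta> ^ (k - j) * (a k * real (n k))"
proof (induction "k - j" arbitrary: j)
  case (Suc d)
  have j: "Suc j \<le> k" "k - Suc j = d" "k - j = Suc d" using Suc by auto
  have "a j * real (n j) \<le> 2 powr s * a (Suc j) * real (n j)" using a_ratio[of j] by (intro mult_right_mono) auto
  also have "\<dots> = (2 powr s / real N) * (a (Suc j) * real (n (Suc j)))" using N_big by (simp add: n_def)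
  also have "\<dots> \<le> \<theta> * (a (Suc j) * real (n (Suc j)))"
    using N_big a_pos[of "Suc j"] by (intro mult_right_mono) (auto simp: \<theta>_def divide_right_mono)
  also have "\<dots> \<le> \<theta> * (\<theta> ^ d * (a k * real (n k)))"
    using Suc.hyps(1)[of "Suc j"] j \<theta> by (intro mult_left_mono) auto
  finally show ?case using j by simp
qed auto

text \<open>With M = N^(j+1), the bound r \<le> 1 - 1 / (2 n_k) gives r^(M n_k) \<le> exp(-M/2)
  \<le> 8 / M^2. Passing to the exponent minus one costs a factor 2, as r \<ge> 1/2. The coefficient
  grows at most by M, and 16 / M is at most \<theta>^(j+1).\<close>

lemma upper_terms:
  assumes r: "1 - 1 / real (n k) \<le> r" "r \<le> 1 - 1 / (2 * real (n k))" and k: "k \<ge> 1"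
  shows "a (j + k + 1) * real (n (j + k + 1)) * r ^ (n (j + k + 1) - 1) \<le> \<theta> ^ (j + 1) * (a k * real (n k))"
proof -
  define M where "M = real N ^ (j + 1)"
  have M: "M > 0" using N_big by (simp add: M_def)
  have nk: "real (n k) \<ge> 2" 
    by (rule n_ge_2[OF k])
  have "1 / real (n k) \<le> 1/2" using nk by simp
  then have r12: "r \<ge> 1/2" "r > 0" using r by linarith+
  have nn: "real (n (j + k + 1)) = M * real (n k)" by (simp add: n_def M_def power_add)
  have n1: "n (j + k + 1) \<ge> 1" using n_pos[of "j + k + 1"] by (simp add: Suc_le_eq)
  have "r ^ n (j + k + 1) = r ^ (n (j + k + 1) - 1) * r" using n1 by (metis One_nat_def Suc_pred' less_eq_Suc_le mult.commute power_Suc)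
  then have "r ^ (n (j + k + 1) - 1) \<le> 2 * r ^ n (j + k + 1)" using r12 by simp
  also have "r ^ n (j + k + 1) \<le> exp (- M / 2)"
  proof -
    have "r \<le> exp (- 1 / (2 * real (n k)))" using r(2) exp_ge_add_one_self[of "- 1 / (2 * real (n k))"] by simp
    then have "r ^ n (j + k + 1) \<le> exp (- 1 / (2 * real (n k))) ^ n (j + k + 1)" using r12 by (intro power_mono) auto
    also have "\<dots> = exp (real (n (j + k + 1)) * (- 1 / (2 * real (n k))))" by (rule exp_of_nat_mult[symmetric])
    also have "real (n (j + k + 1)) * (- 1 / (2 * real (n k))) = - M / 2" unfolding nn using nk by simp
    finally show ?thesis .
  qed
  also have "exp (- M / 2) \<le> 8 / M^2"
  proof -
    have "(M/2)^2 / 2 \<le> exp (M/2)" using exp_lower_Taylor_quadratic[of "M/2"] M by simp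
    then have "M^2 / 8 \<le> exp (M/2)" by (simp add: power_divide)
    then have "inverse (exp (M/2)) \<le> inverse (M^2 / 8)" using M by (intro le_imp_inverse_le) auto
    then show ?thesis by (simp add: exp_minus)
  qed
  finally have re: "r ^ (n (j + k + 1) - 1) \<le> 16 / M^2" by simp
  have "a (j + k + 1) \<le> a k" using s_gt by (auto simp: a_def intro!: powr_mono2')
  then have "a (j + k + 1) * real (n (j + k + 1)) * r ^ (n (j + k + 1) - 1) \<le> a k * real (n (j + k + 1)) * (16 / M^2)"
    using re r12 a_pos[of k] by (intro mult_mono) auto
  also have "\<dots> = (16 / M) * (a k * real (n k))" unfolding nn using M by (simp add: power2_eq_square)
  also have "\<dots> \<le> \<theta> ^ (j + 1) * (a k * real (n k))"
  proof (rule mult_right_mono)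
    have "16 / M \<le> 16 ^ (j + 1) / M" using M by (intro divide_right_mono) auto
    also have "\<dots> = (16 / real N) ^ (j + 1)" by (simp add: M_def power_divide)
    also have "\<dots> \<le> \<theta> ^ (j + 1)" using N_big by (intro power_mono) (auto simp: \<theta>_def divide_right_mono)
    finally show "16 / M \<le> \<theta> ^ (j + 1)" .
  qed (use a_pos[of k] in auto)
  finally show ?thesis .
qed

lemma geometric_lower: "(\<Sum>j<k. \<theta> ^ (k - j)) \<le> 2 * \<theta>"
proof (induction k)
  case (Suc k)
  have "(\<Sum>j<Suc k. \<theta> ^ (Suc k - j)) = (\<Sum>j<Suc k. \<theta> * \<theta> ^ (k - j))"
    by (intro sum.cong refl) (auto simp: Suc_diff_le)
  also have "\<dots> = \<theta> * ((\<Sum>j<k. \<theta> ^ (k - j)) + 1)" by (simp add: sum_distrib_left distrib_left)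
  also have "\<dots> \<le> \<theta> * (2 * \<theta> + 1)" using Suc \<theta> by (intro mult_left_mono) auto
  also have "\<dots> \<le> \<theta> * 2" using \<theta> by (intro mult_left_mono) auto
  finally show ?case by simp
qed (use \<theta> in simp)

text \<open>On this annulus the k-th term dominates: its power of |z| is at least (1 - 1/n_k)^(n_k)
  \<ge> exp(-2) \<ge> 1/9. The remainders take away at most 4 \<theta> \<le> 1/18, which leaves
  1/18.\<close>

lemma deriv_lower:
  assumes z: "1 - 1 / real (n k) \<le> norm z" "norm z \<le> 1 - 1 / (2 * real (n k))" and k: "k \<ge> 1"
  shows "norm (deriv f z) \<ge> a k * real (n k) / 18"
proof -
  define r where "r = norm z"
  define A where "A = a k * real (n k)"
  have A: "A > 0" using a_pos n_pos by (simp add: A_def)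
  define c where "c = (\<lambda>j. complex_of_real (a j) * (of_nat (n j) * z ^ (n j - 1)))"
  have nk: "real (n k) \<ge> 2" 
    by (rule n_ge_2[OF k])
  have "1 / (2 * real (n k)) > 0" using nk by simp
  then have zb: "z \<in> ball 0 1" using z unfolding mem_ball_0 by linarith
  have "1 / real (n k) \<le> 1/2" using nk by simp
  then have r12: "r \<ge> 1/2" "r < 1" using z zb by (auto simp: r_def)
  have nc: "norm (c j) = a j * real (n j) * r ^ (n j - 1)" for j
    using a_pos[of j] by (simp add: c_def r_def norm_mult norm_power)
  have cs: "c sums deriv f z" unfolding c_def by (rule f_deriv[OF zb])
  then have "deriv f z = (\<Sum>j. c (j + (k + 1))) + (\<Sum>j<k + 1. c j)"
    using suminf_split_initial_segment[of c "k + 1"] by (simp add: sums_iff)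
  then have eq: "deriv f z = c k + ((\<Sum>j<k. c j) + (\<Sum>j. c (j + (k + 1))))" by simp
  have low: "norm (\<Sum>j<k. c j) \<le> 2 * \<theta> * A"
  proof -
    have "norm (\<Sum>j<k. c j) \<le> (\<Sum>j<k. norm (c j))" by (rule norm_sum)
    also have "\<dots> \<le> (\<Sum>j<k. \<theta> ^ (k - j) * A)"
    proof (rule sum_mono)
      fix j assume j: "j \<in> {..<k}"
      have "norm (c j) \<le> a j * real (n j) * 1" unfolding nc
        using r12 a_pos[of j] by (intro mult_left_mono power_le_one) auto
      also have "\<dots> \<le> \<theta> ^ (k - j) * A" using lower_terms[of j k] j by (simp add: A_def)
      finally show "norm (c j) \<le> \<theta> ^ (k - j) * A" .
    qed
    also have "\<dots> = (\<Sum>j<k. \<theta> ^ (k - j)) * A" by (simp add: sum_distrib_right)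
    also have "\<dots> \<le> 2 * \<theta> * A" using A geometric_lower by (intro mult_right_mono) auto
    finally show ?thesis .
  qed
  have up: "norm (\<Sum>j. c (j + (k + 1))) \<le> 2 * \<theta> * A"
  proof -
    have sg: "(\<lambda>j. \<theta> ^ (j + 1) * A) sums (\<theta> * (1 / (1 - \<theta>)) * A)"
      using sums_mult2[OF sums_mult[OF geometric_sums[of \<theta>], of \<theta>], of A] \<theta> by simp
    have "norm (\<Sum>j. c (j + (k + 1))) \<le> (\<Sum>j. \<theta> ^ (j + 1) * A)"
    proof (rule norm_suminf_le)
      show "norm (c (j + (k + 1))) \<le> \<theta> ^ (j + 1) * A" for j
        using upper_terms[OF z k, of j] unfolding nc A_def r_def by (simp add: add.assoc)
    qed (use sg in \<open>simp add: sums_iff\<close>)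
    also have "\<dots> = \<theta> * (1 / (1 - \<theta>)) * A" using sg by (simp add: sums_iff)
    also have "\<dots> \<le> \<theta> * 2 * A" using \<theta> A by (intro mult_right_mono mult_left_mono) (auto simp: field_simps)
    finally show ?thesis by (simp add: mult.commute)
  qed
  have main: "norm (c k) \<ge> A / 9"
  proof -
    define x where "x = 1 / real (n k)"
    have x: "0 \<le> x" "x \<le> 1/2" "real (n k) * x = 1" using nk by (auto simp: x_def)
    have "r ^ n k \<le> r ^ (n k - 1)" using r12 by (intro power_decreasing) auto
    moreover have "(1 - x) ^ n k \<le> r ^ n k" using z x by (intro power_mono) (auto simp: x_def r_def)
    moreover have "(1 - x) ^ n k = exp (real (n k) * ln (1 - x))" using x by (simp add: exp_of_nat_mult)
    \<comment> \<open>With x = 1 / n_k \<le> 1/2, the bound ln (1 - x) \<ge> -x - 2 x^2 multiplied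
      by n_k is -1 - 2 x \<ge> -2.\<close>
    moreover have "exp (real (n k) * ln (1 - x)) \<ge> exp (-2)"
    proof -
      have "- x - 2 * x^2 \<le> ln (1 - x)" using x ln_one_minus_pos_lower_bound[of x] by simp
      then have "real (n k) * (- x - 2 * x^2) \<le> real (n k) * ln (1 - x)" by (rule mult_left_mono) simp
      moreover have "real (n k) * (- x - 2 * x^2) = - (real (n k) * x) - 2 * (real (n k) * x) * x"
        by (simp add: power2_eq_square algebra_simps)
      ultimately show ?thesis using x by simp
    qed
    moreover have "exp (-2::real) \<ge> 1 / 9"
    proof -
      have "exp (2::real) = exp 1 * exp 1" by (simp add: exp_add[symmetric])
      also have "\<dots> \<le> 3 * 3" using exp_le by (intro mult_mono) auto
      finally have "inverse 9 \<le> inverse (exp (2::real))" by (intro le_imp_inverse_le) auto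
      then show ?thesis by (simp add: exp_minus)
    qed
    ultimately have "r ^ (n k - 1) \<ge> 1 / 9" by linarith
    then have "A * r ^ (n k - 1) \<ge> A * (1 / 9)" using A by (intro mult_left_mono) auto
    then show ?thesis by (simp add: nc A_def)
  qed
  have tri: "norm x \<le> norm (x + (y + w)) + (norm y + norm w)" for x y w :: complex by norm
  have "norm (c k) \<le> norm (deriv f z) + (norm (\<Sum>j<k. c j) + norm (\<Sum>j. c (j + (k + 1))))"
    unfolding eq by (rule tri)
  then have "A / 9 - 4 * \<theta> * A \<le> norm (deriv f z)" using low up main by simp
  moreover have "4 * \<theta> * A \<le> 4 * (1/72) * A" using \<theta> A by (intro mult_right_mono) auto
  ultimately show ?thesis by (simp add: A_def)
qed

text \<open>On the k-th annulus the integrand is at least v k, and v k times the lower bound pi / (2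
  n) of the area is c / (k + 2): the powers of n cancel and the coefficient to the power q is
  harmonic. The annuli are disjoint because consecutive exponents differ by more than a factor 2, so
  the integral dominates a divergent series.\<close>

lemma not_dirichlet: "f \<notin> dirichlet_type q"
proof
  assume "f \<in> dirichlet_type q"
  then have fin: "(\<integral>\<^sup>+ z. indicator (ball (0::complex) 1) z * ennreal ((1 - norm z) powr (q - 1) * norm (deriv f z) powr q / pi) \<partial>lborel) < \<infinity>"
    by (simp add: dirichlet_type_def)
  define R where "R = (\<lambda>k. {z::complex. 1 - 1 / real (n (Suc k)) \<le> norm z \<and> norm z \<le> 1 - 1 / (2 * real (n (Suc k)))})"
  define v where "v = (\<lambda>k. (1 / real (n (Suc k))) powr (q - 1) * (a (Suc k) * real (n (Suc k)) / 18) powr q / pi)"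
  have nk: "real (n (Suc k)) \<ge> 2" for k 
    by (rule n_ge_2) simp
  have v0: "v k \<ge> 0" for k by (simp add: v_def)
  have Rm [measurable]: "R k \<in> sets borel" for k
  proof -
    have "R k = {z. 1 - 1 / real (n (Suc k)) \<le> norm z} \<inter> {z. norm z \<le> 1 - 1 / (2 * real (n (Suc k)))}" by (auto simp: R_def)
    also have "closed \<dots>" by (intro closed_Int closed_Collect_le continuous_intros)
    finally show ?thesis by auto
  qed
  have sep: "R i \<inter> R j = {}" if "i < j" for i j
  proof -
    have "real N ^ (Suc i + 1) \<le> real N ^ Suc j" using N_big that by (intro power_increasing) auto
    then have "real N * real (n (Suc i)) \<le> real (n (Suc j))" by (simp add: n_def mult_ac)
    moreover have "2 * real (n (Suc i)) < real N * real (n (Suc i))" using N_big n_pos[of "Suc i"] by (intro mult_strict_right_mono) auto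
    ultimately have "2 * real (n (Suc i)) < real (n (Suc j))" by linarith
    then have "1 / real (n (Suc j)) < 1 / (2 * real (n (Suc i)))" using n_pos[of "Suc i"] by (intro divide_strict_left_mono) auto
    then show ?thesis by (auto simp: R_def)
  qed
  have dis: "disjoint_family R"
    unfolding disjoint_family_on_def using sep by (metis Int_commute linorder_neq_iff)
  have pt: "(\<Sum>k. ennreal (v k) * indicator (R k) z) \<le> indicator (ball (0::complex) 1) z * ennreal ((1 - norm z) powr (q - 1) * norm (deriv f z) powr q / pi)" for z
  proof (cases "\<exists>k. z \<in> R k")
    case False
    then show ?thesis by (simp add: indicator_def)
  next
    case True
    then obtain k where k: "z \<in> R k" by blast
    then have zz: "1 - 1 / real (n (Suc k)) \<le> norm z" "norm z \<le> 1 - 1 / (2 * real (n (Suc k)))" by (auto simp: R_def)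
    have "1 / (2 * real (n (Suc k))) > 0" using n_pos[of "Suc k"] by simp
    then have z1: "norm z < 1" using zz by linarith
    have "(\<Sum>k. ennreal (v k) * indicator (R k) z) = ennreal (v k)"
      by (rule suminf_cmult_indicator[OF dis k])
    also have "\<dots> \<le> ennreal ((1 - norm z) powr (q - 1) * norm (deriv f z) powr q / pi)"
    proof (rule ennreal_leI, unfold v_def, intro divide_right_mono mult_mono)
      show "(1 / real (n (Suc k))) powr (q - 1) \<le> (1 - norm z) powr (q - 1)"
        using zz z1 q by (intro powr_mono2') auto
      show "(a (Suc k) * real (n (Suc k)) / 18) powr q \<le> norm (deriv f z) powr q"
        using deriv_lower[OF zz] q a_pos[of "Suc k"] by (intro powr_mono2) auto
    qed auto
    finally show ?thesis using z1 by simp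
  qed
  define c where "c = 1 / (2 * 18 powr q)"
  have c: "c > 0" by (simp add: c_def)
  have trm: "ennreal (c / real (k + 2)) \<le> ennreal (v k) * emeasure lborel (R k)" for k
  proof -
    define x where "x = real (n (Suc k))"
    have x: "x > 0" using n_pos by (simp add: x_def)
    have sq: "- s * q = -1" using q by (simp add: s_def)
    have "(a (Suc k)) powr q = real (k + 2) powr (- s * q)" by (simp add: a_def powr_powr)
    also have "\<dots> = 1 / real (k + 2)" unfolding sq using powr_minus_divide[of "real (k + 2)" 1] by simp
    finally have ak: "(a (Suc k)) powr q = 1 / real (k + 2)" .
    have xx: "(1 / x) powr (q - 1) * x powr q = x"
      using x powr_minus_divide[of x "q - 1"] powr_divide[of 1 x "q - 1"] powr_add[of x "1 - q" q] by simp
    have "(a (Suc k) * x / 18) powr q = a (Suc k) powr q * x powr q / 18 powr q"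
      using x a_pos[of "Suc k"] by (simp add: powr_mult powr_divide)
    then have "v k = ((1 / x) powr (q - 1) * x powr q) * (a (Suc k) powr q / 18 powr q / pi)"
      unfolding v_def x_def[symmetric] by simp
    also have "\<dots> = x / (18 powr q * pi * real (k + 2))" unfolding xx ak by simp
    finally have vk: "v k = x / (18 powr q * pi * real (k + 2))" .
    have "v k * (pi / (2 * x)) = c / real (k + 2)" unfolding vk using x by (simp add: c_def)
    then have "ennreal (c / real (k + 2)) = ennreal (v k) * ennreal (pi / (2 * x))"
      using v0[of k] x by (simp add: ennreal_mult[symmetric])
    also have "\<dots> \<le> ennreal (v k) * emeasure lborel (R k)"
      unfolding R_def x_def by (intro mult_left_mono emeasure_annulus_ge nk) auto
    finally show ?thesis .
  qed
  have "(\<Sum>k. ennreal (c / real (k + 2))) \<le> (\<Sum>k. ennreal (v k) * emeasure lborel (R k))"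
    by (intro suminf_le trm summableI)
  also have "\<dots> = (\<Sum>k. \<integral>\<^sup>+z. ennreal (v k) * indicator (R k) z \<partial>lborel)"
    by (simp add: nn_integral_cmult_indicator)
  also have "\<dots> = (\<integral>\<^sup>+z. (\<Sum>k. ennreal (v k) * indicator (R k) z) \<partial>lborel)"
    by (rule nn_integral_suminf[symmetric]) measurable
  also have "\<dots> \<le> (\<integral>\<^sup>+ z. indicator (ball (0::complex) 1) z * ennreal ((1 - norm z) powr (q - 1) * norm (deriv f z) powr q / pi) \<partial>lborel)"
    by (intro nn_integral_mono pt)
  finally have "(\<Sum>k. ennreal (c / real (k + 2))) \<noteq> top" using fin by (auto simp: top_unique)
  then have "summable (\<lambda>k. c / real (k + 2))" using c by (intro summable_suminf_not_top) auto
  then have "summable (\<lambda>k. c * (1 / real (k + 2)))" by simp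
  then have "summable (\<lambda>k. 1 / real (k + 2))" using c by (simp only: summable_cmult_iff) auto
  then have "summable (\<lambda>k. 1 / real k)" using summable_iff_shift[of "\<lambda>k. 1 / real k" 2] by simp
  then show False using not_summable_harmonic[where 'a = real] by (simp add: inverse_eq_divide)
qed

end

text \<open>The constant 1 serves as test function for the negative statement: a multiplier defined
  on a space containing 1 must itself lie in the target space.\<close>

lemma one_in_dirichlet_type: "(\<lambda>_. 1) \<in> dirichlet_type p"
  by (simp add: dirichlet_type_def)

lemma one_in_BMOA: "(\<lambda>_. 1) \<in> BMOA"
proof -
  have b: "boundary_fn (\<lambda>_. 1) = (\<lambda>_. 1)" by (rule ext, rule boundary_fn_tendsto) simp
  have h: "(\<lambda>_. 1) \<in> hardy1"
    unfolding hardy1_iff using nn_integral_const_arc[of 0 "2*pi" 1] by (auto intro!: exI[of _ "2*pi"])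
  have "bmo_circle (\<lambda>_. 1)" unfolding bmo_circle_def
  proof (intro exI[of _ 0] allI impI conjI)
    fix x y :: real assume xy: "x < y \<and> y - x \<le> 2*pi"
    interpret finite_measure "arc_meas x y" by simp
    show si: "set_integrable lborel {x..y} (\<lambda>_. 1::complex)"
      by (subst integrable_arc_meas[symmetric]) auto
    have "ennreal (norm (arc_avg (\<lambda>_. 1) x y - 1) * (y - x)) \<le> (\<integral>\<^sup>+t. ennreal (norm ((1::complex) - 1)) \<partial>arc_meas x y)"
      by (rule arc_avg_diff_le[OF _ si]) (use xy in auto)
    then have "norm (arc_avg (\<lambda>_. 1) x y - 1) * (y - x) \<le> 0" by (simp add: ennreal_eq_0_iff)
    then have "arc_avg (\<lambda>_. 1) x y = 1" using xy by (auto simp: mult_le_0_iff)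
    then show "(\<integral>\<^sup>+ t. indicator {x..y} t * ennreal (norm (1 - (LINT s:{x..y}|lborel. 1) / complex_of_real (y - x))) \<partial>lborel) \<le> ennreal (0 * (y - x))"
      by (simp add: arc_avg_def)
  qed
  then show ?thesis using h b by (simp add: BMOA_def)
qed

section \<open>Transfer to lacunary representations and conclusion\<close>

lemma lacunary_repr_mult_series:
  assumes "lacunary_repr f a n lam" obtains b m where "mult_series f b m"
proof -
  obtain b m where "lacunary_mult_series f b m" using lacunary_reprD[OF assms] by blast
  moreover have "f holomorphic_on ball 0 1" using assms by (simp add: lacunary_repr_def)
  ultimately show thesis by (intro that[of b m]) (simp add: mult_series_def)
qed

lemma lacunary_repr_multiplier:
  assumes "lacunary_repr f a n lam"
  shows "f \<in> multipliers BMOA BMOA"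
    and "0 < p \<Longrightarrow> p \<le> q \<Longrightarrow> 1/2 < q \<Longrightarrow> f \<in> multipliers (dirichlet_type p \<inter> BMOA) (dirichlet_type q \<inter> BMOA)"
proof -
  obtain b m where "mult_series f b m" by (rule lacunary_repr_mult_series[OF assms])
  then interpret mult_series f b m .
  show "f \<in> multipliers BMOA BMOA" by (rule multiplier_BMOA)
  show "0 < p \<Longrightarrow> p \<le> q \<Longrightarrow> 1/2 < q \<Longrightarrow> f \<in> multipliers (dirichlet_type p \<inter> BMOA) (dirichlet_type q \<inter> BMOA)"
    by (rule multiplier_dirichlet)
qed

lemma ex_lacunary_not_dirichlet:
  fixes q :: real
  assumes "0 < q" "q < 1/2"
  shows "\<exists>f a n lam. lacunary_repr f a n lam \<and> f \<notin> dirichlet_type q"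
proof -
  obtain N :: nat where "72 * (2 powr (1/q) + 16) \<le> real N" using real_arch_simple by blast
  then interpret lacunary_example q N using assms by unfold_locales
  show ?thesis using repr not_dirichlet by blast
qed

theorem mainTheorem20:
  shows "(\<forall>f a n lam. lacunary_repr f a n lam \<longrightarrow>
            f \<in> multipliers BMOA BMOA \<and>
            (\<forall>p q. 0 < p \<and> p \<le> q \<and> q > 1/2 \<longrightarrow>
               f \<in> multipliers (dirichlet_type p \<inter> BMOA) (dirichlet_type q \<inter> BMOA))) \<and>
         (\<forall>q::real. 0 < q \<and> q < 1/2 \<longrightarrow>
            (\<exists>f a n lam. lacunary_repr f a n lam \<and> f \<notin> dirichlet_type q \<and>
               f \<in> multipliers BMOA BMOA \<and>
               (\<forall>p \<mu>. \<mu> > 1/2 \<and> 0 < p \<and> p \<le> \<mu> \<longrightarrow>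
                  f \<in> multipliers (dirichlet_type p \<inter> BMOA) (dirichlet_type \<mu>)) \<and>
               (\<forall>p. 0 < p \<and> p \<le> q \<longrightarrow>
                  f \<notin> multipliers (dirichlet_type p \<inter> BMOA) (dirichlet_type q \<inter> BMOA))))"
proof (intro conjI allI impI)
  fix f a n lam assume "lacunary_repr f a n lam"
  note * = lacunary_repr_multiplier[OF this]
  show "f \<in> multipliers BMOA BMOA" by (rule *)
  show "f \<in> multipliers (dirichlet_type p \<inter> BMOA) (dirichlet_type q \<inter> BMOA)" if "0 < p \<and> p \<le> q \<and> q > 1/2" for p q
    using that * by blast
next
  fix q :: real assume "0 < q \<and> q < 1/2"
  then obtain f a n lam where f: "lacunary_repr f a n lam" "f \<notin> dirichlet_type q"
    using ex_lacunary_not_dirichlet by blast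
  note * = lacunary_repr_multiplier[OF f(1)]
  have b: "f \<in> multipliers (dirichlet_type p \<inter> BMOA) (dirichlet_type \<mu>)" if "\<mu> > 1/2 \<and> 0 < p \<and> p \<le> \<mu>" for p \<mu>
  proof -
    have "f \<in> multipliers (dirichlet_type p \<inter> BMOA) (dirichlet_type \<mu> \<inter> BMOA)" using that * by blast
    then show ?thesis by (auto simp: multipliers_def)
  qed
  have c: "f \<notin> multipliers (dirichlet_type p \<inter> BMOA) (dirichlet_type q \<inter> BMOA)" for p
  proof
    assume "f \<in> multipliers (dirichlet_type p \<inter> BMOA) (dirichlet_type q \<inter> BMOA)"
    then have "\<forall>g\<in>dirichlet_type p \<inter> BMOA. (\<lambda>z. g z * f z) \<in> dirichlet_type q \<inter> BMOA"
      by (simp add: multipliers_def)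
    from bspec[OF this, of "\<lambda>_. 1"] have "(\<lambda>z. 1 * f z) \<in> dirichlet_type q"
      using one_in_dirichlet_type one_in_BMOA by simp
    then show False using f(2) by simp
  qed
  show "\<exists>f a n lam. lacunary_repr f a n lam \<and> f \<notin> dirichlet_type q \<and>
               f \<in> multipliers BMOA BMOA \<and>
               (\<forall>p \<mu>. \<mu> > 1/2 \<and> 0 < p \<and> p \<le> \<mu> \<longrightarrow>
                  f \<in> multipliers (dirichlet_type p \<inter> BMOA) (dirichlet_type \<mu>)) \<and>
               (\<forall>p. 0 < p \<and> p \<le> q \<longrightarrow>
                  f \<notin> multipliers (dirichlet_type p \<inter> BMOA) (dirichlet_type q \<inter> BMOA))"
    using f *(1) b c by blast
qed

end
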